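(* Let $d\in\mathbb{N}$, let $\Omega\subset\mathbb{R}^d$ be a bounded open domain with $\mathcal{C}^1$ boundary and outer unit normal $\nu$, and let $f\in\mathcal{C}^1(\mathbb{R}^d;\mathbb{R}^d)$ satisfy $\nu(x)^\top f(x)\le 0$ for all $x\in\partial\Omega$. Let $w:\Omega\to\mathbb{R}_+$ be a measurable weight with $w^{-1}\in W^{1,\infty}(\Omega)$ and assume $f_i\in \mathrm{L}^\infty_w(\Omega)\cap\mathcal{C}^1(\bar\Omega)$ for $i=1,\dots,d$. Let $S(t)$, $t\ge 0$, be the preadjoint on $X=\mathrm{L}^1_w(\Omega)$ of the composition semigroup $S^*(t)\varphi=\varphi\circ\Phi^t$ on $X^*=\mathrm{L}^\infty_w(\Omega)$, where $\Phi^t$ is the flow of $\dot x=f(x)$. If $$\operatorname*{ess\,sup}_{x\in\Omega}\; -\frac{f(x)^\top\nabla w(x)}{w(x)}=\omega_0<0,$$ then $S(t)$ is an exponentially stable semigroup of contractions of type $\omega_0$ over $X$, i.e. $\|S(t)\phi\|_{\mathrm{L}^1_w(\Omega)}\le e^{\omega_0 t}\|\phi\|_{\mathrm{L}^1_w(\Omega)}$ for all $t\ge0$ and $\phi\in X$.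
   Context: For $z\in\bar\Omega$, $\Phi^t(z)$ denotes the value at time $t\ge 0$ of the solution of $\dot x=f(x)$, $x(0)=z$; the condition $\nu^\top f\le 0$ on $\partial\Omega$ guarantees that $\Phi^t(z)$ exists and stays in $\bar\Omega$ for all $t\ge0$. The weight $w$ is positive and finite almost everywhere; $\nabla w$ is understood almost everywhere, $\nabla w=-w^2\nabla(w^{-1})$. The weighted spaces are defined by the norms $\|\phi\|_{\mathrm{L}^p_w(\Omega)}=\big(\int_\Omega|\phi|^p w\,dx\big)^{1/p}$ for $1\le p<\infty$ and $\|\phi\|_{\mathrm{L}^\infty_w(\Omega)}=\operatorname{ess\,sup}_{x\in\Omega}|\phi(x)w(x)|$ (the weight is inside the essential supremum). The dual of $X=\mathrm{L}^1_w(\Omega)$ is identified with $X^*=\mathrm{L}^\infty_w(\Omega)$ through the pairing $\langle\phi,\varphi\rangle_{X,X^*}=\int_\Omega\phi(x)\varphi(x)w(x)^2\,dx$. The preadjoint $S(t)\in\mathcal{L}(X)$ is the operator with $\langle S(t)\rho,\varphi\rangle_{X,X^*}=\langle\rho,S^*(t)\varphi\rangle_{X,X^*}$ for all $\rho\in X$, $\varphi\in X^*$. *)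

theory Defs
  imports "HOL-Analysis.Analysis" "HOL-Probability.Essential_Supremum"
begin

section \<open>Smoothness\<close>

definition C1_map :: "('a::euclidean_space \<Rightarrow> 'b::euclidean_space) \<Rightarrow> bool" where
  "C1_map g \<longleftrightarrow>
     (\<exists>g' :: 'a \<Rightarrow> 'a \<Rightarrow>\<^sub>L 'b.
        (\<forall>x. (g has_derivative blinfun_apply (g' x)) (at x)) \<and> continuous_on UNIV g')"

abbreviation partial_deriv :: "'a::euclidean_space \<Rightarrow> ('a \<Rightarrow> real) \<Rightarrow> 'a \<Rightarrow> real" where
  "partial_deriv b \<phi> x \<equiv> frechet_derivative \<phi> (at x) b"

fun Ck_fun :: "nat \<Rightarrow> ('a::euclidean_space \<Rightarrow> real) \<Rightarrow> bool" where
  "Ck_fun 0 \<phi> \<longleftrightarrow> continuous_on UNIV \<phi>"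
| "Ck_fun (Suc k) \<phi> \<longleftrightarrow>
     (\<forall>x. \<phi> differentiable (at x)) \<and> (\<forall>b\<in>Basis. Ck_fun k (partial_deriv b \<phi>))"

definition test_function :: "'a::euclidean_space set \<Rightarrow> ('a \<Rightarrow> real) \<Rightarrow> bool" where
  "test_function \<Omega> \<phi> \<longleftrightarrow>
     (\<forall>k. Ck_fun k \<phi>) \<and> compact (closure {x. \<phi> x \<noteq> 0}) \<and> closure {x. \<phi> x \<noteq> 0} \<subseteq> \<Omega>"


section \<open>\<open>C\<^sup>1\<close> boundary and outer unit normal\<close>

text \<open>Near \<open>p\<close> the set \<open>\<Omega>\<close> lies strictly above the graph of the \<open>C\<^sup>1\<close> function \<open>\<gamma>\<close> (with gradient
  \<open>D\<gamma>\<close>) in the direction of the unit vector \<open>e\<close>. The hyperplane orthogonal to \<open>e\<close> plays the role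
  of \<open>\<real>\<^sup>d\<^sup>-\<^sup>1\<close>: only the restriction of \<open>\<gamma>\<close> to it matters.\<close>

definition boundary_chart ::
  "'a::euclidean_space set \<Rightarrow> 'a \<Rightarrow> 'a \<Rightarrow> real \<Rightarrow> ('a \<Rightarrow> real) \<Rightarrow> ('a \<Rightarrow> 'a) \<Rightarrow> bool" where
  "boundary_chart \<Omega> p e r \<gamma> D\<gamma> \<longleftrightarrow>
     norm e = 1 \<and> 0 < r \<and> (\<forall>y. GDERIV \<gamma> y :> D\<gamma> y) \<and> continuous_on UNIV D\<gamma> \<and>
     \<Omega> \<inter> ball p r = {x \<in> ball p r. \<gamma> (x - (x \<bullet> e) *\<^sub>R e) < x \<bullet> e}"

definition C1_boundary :: "'a::euclidean_space set \<Rightarrow> bool" where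
  "C1_boundary \<Omega> \<longleftrightarrow> (\<forall>p\<in>frontier \<Omega>. \<exists>e r \<gamma> D\<gamma>. boundary_chart \<Omega> p e r \<gamma> D\<gamma>)"

text \<open>In a chart, \<open>\<Omega>\<close> is the set where \<open>\<gamma> (x - (x \<bullet> e) e) - x \<bullet> e\<close> is negative; the outer unit normal
  is the normalized gradient of this function.\<close>

definition outer_unit_normal :: "'a::euclidean_space set \<Rightarrow> 'a \<Rightarrow> 'a \<Rightarrow> bool" where
  "outer_unit_normal \<Omega> p n \<longleftrightarrow>
     (\<exists>e r \<gamma> D\<gamma>. boundary_chart \<Omega> p e r \<gamma> D\<gamma> \<and>
        (let v = D\<gamma> (p - (p \<bullet> e) *\<^sub>R e) in n = sgn (v - (v \<bullet> e) *\<^sub>R e - e)))"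


section \<open>The flow on the closed domain\<close>

text \<open>\<open>\<Phi> t z\<close> is constrained only for \<open>t \<ge> 0\<close> and \<open>z\<close> in the closure of \<open>\<Omega>\<close>. That trajectories
  remain in the closure is not part of the definition.\<close>

definition is_flow ::
  "('a::euclidean_space \<Rightarrow> 'a) \<Rightarrow> 'a set \<Rightarrow> (real \<Rightarrow> 'a \<Rightarrow> 'a) \<Rightarrow> bool" where
  "is_flow f \<Omega> \<Phi> \<longleftrightarrow>
     (\<forall>z\<in>closure \<Omega>. \<Phi> 0 z = z \<and>
        (\<forall>t\<ge>0. ((\<lambda>s. \<Phi> s z) has_vector_derivative f (\<Phi> t z)) (at t within {0..})))"


section \<open>Weighted Lebesgue spaces\<close>

text \<open>Elements are represented by functions on the whole space, of which only the restriction to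
  \<open>\<Omega>\<close> matters; equality is almost everywhere on \<open>\<Omega>\<close>.\<close>

definition L1w :: "'a::euclidean_space set \<Rightarrow> ('a \<Rightarrow> real) \<Rightarrow> ('a \<Rightarrow> real) set" where
  "L1w \<Omega> w = {\<phi> \<in> borel_measurable (lebesgue_on \<Omega>).
                integrable (lebesgue_on \<Omega>) (\<lambda>x. \<bar>\<phi> x\<bar> * w x)}"

definition norm_L1w :: "'a::euclidean_space set \<Rightarrow> ('a \<Rightarrow> real) \<Rightarrow> ('a \<Rightarrow> real) \<Rightarrow> real" where
  "norm_L1w \<Omega> w \<phi> = (LINT x|lebesgue_on \<Omega>. \<bar>\<phi> x\<bar> * w x)"

definition Linfw :: "'a::euclidean_space set \<Rightarrow> ('a \<Rightarrow> real) \<Rightarrow> ('a \<Rightarrow> real) set" where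
  "Linfw \<Omega> w = {\<phi> \<in> borel_measurable (lebesgue_on \<Omega>).
                  esssup (lebesgue_on \<Omega>) (\<lambda>x. ereal \<bar>\<phi> x * w x\<bar>) < \<infinity>}"

definition pairing ::
  "'a::euclidean_space set \<Rightarrow> ('a \<Rightarrow> real) \<Rightarrow> ('a \<Rightarrow> real) \<Rightarrow> ('a \<Rightarrow> real) \<Rightarrow> real" where
  "pairing \<Omega> w \<rho> \<phi> = (LINT x|lebesgue_on \<Omega>. \<rho> x * \<phi> x * (w x)\<^sup>2)"


section \<open>Weak gradients\<close>

definition has_weak_gradient ::
  "'a::euclidean_space set \<Rightarrow> ('a \<Rightarrow> real) \<Rightarrow> ('a \<Rightarrow> 'a) \<Rightarrow> bool" where
  "has_weak_gradient \<Omega> g G \<longleftrightarrow>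
     (\<forall>K. compact K \<and> K \<subseteq> \<Omega> \<longrightarrow> g absolutely_integrable_on K \<and> G absolutely_integrable_on K) \<and>
     (\<forall>\<phi>. test_function \<Omega> \<phi> \<longrightarrow>
        (\<forall>b\<in>Basis. (LINT x|lebesgue_on \<Omega>. g x * partial_deriv b \<phi> x)
                   = - (LINT x|lebesgue_on \<Omega>. (G x \<bullet> b) * \<phi> x)))"

text \<open>\<open>g \<in> W\<^sup>1\<^sup>,\<^sup>\<infinity>(\<Omega>)\<close> with weak gradient \<open>G\<close>; the unweighted \<open>L\<^sup>\<infinity>(\<Omega>)\<close> is the case of weight \<open>1\<close>.\<close>

definition has_W1inf_gradient ::
  "'a::euclidean_space set \<Rightarrow> ('a \<Rightarrow> real) \<Rightarrow> ('a \<Rightarrow> 'a) \<Rightarrow> bool" where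
  "has_W1inf_gradient \<Omega> g G \<longleftrightarrow>
     g \<in> Linfw \<Omega> (\<lambda>_. 1) \<and> has_weak_gradient \<Omega> g G \<and>
     (\<forall>b\<in>Basis. (\<lambda>x. G x \<bullet> b) \<in> Linfw \<Omega> (\<lambda>_. 1))"

text \<open>The gradient of \<open>w\<close>, given the weak gradient \<open>G\<close> of \<open>1 / w\<close>.\<close>

definition weight_gradient :: "('a::euclidean_space \<Rightarrow> real) \<Rightarrow> ('a \<Rightarrow> 'a) \<Rightarrow> 'a \<Rightarrow> 'a" where
  "weight_gradient w G x = - ((w x)\<^sup>2 *\<^sub>R G x)"


section \<open>Operators and semigroups on the weighted \<open>L\<^sup>1\<close> space\<close>

definition bounded_operator_L1w ::
  "'a::euclidean_space set \<Rightarrow> ('a \<Rightarrow> real) \<Rightarrow> (('a \<Rightarrow> real) \<Rightarrow> ('a \<Rightarrow> real)) \<Rightarrow> bool" where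
  "bounded_operator_L1w \<Omega> w A \<longleftrightarrow>
     (\<forall>\<rho>\<in>L1w \<Omega> w. A \<rho> \<in> L1w \<Omega> w) \<and>
     (\<forall>\<rho>\<in>L1w \<Omega> w. \<forall>\<sigma>\<in>L1w \<Omega> w. \<forall>a b.
        AE x in lebesgue_on \<Omega>. A (\<lambda>y. a * \<rho> y + b * \<sigma> y) x = a * A \<rho> x + b * A \<sigma> x) \<and>
     (\<exists>C. \<forall>\<rho>\<in>L1w \<Omega> w. norm_L1w \<Omega> w (A \<rho>) \<le> C * norm_L1w \<Omega> w \<rho>)"

definition composition_operator ::
  "(real \<Rightarrow> 'a \<Rightarrow> 'a) \<Rightarrow> real \<Rightarrow> ('a \<Rightarrow> real) \<Rightarrow> ('a::euclidean_space \<Rightarrow> real)" where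
  "composition_operator \<Phi> t \<phi> = (\<lambda>x. \<phi> (\<Phi> t x))"

definition is_preadjoint ::
  "'a::euclidean_space set \<Rightarrow> ('a \<Rightarrow> real) \<Rightarrow> (('a \<Rightarrow> real) \<Rightarrow> ('a \<Rightarrow> real))
     \<Rightarrow> (('a \<Rightarrow> real) \<Rightarrow> ('a \<Rightarrow> real)) \<Rightarrow> bool" where
  "is_preadjoint \<Omega> w A A_star \<longleftrightarrow>
     bounded_operator_L1w \<Omega> w A \<and>
     (\<forall>\<rho>\<in>L1w \<Omega> w. \<forall>\<phi>\<in>Linfw \<Omega> w. pairing \<Omega> w (A \<rho>) \<phi> = pairing \<Omega> w \<rho> (A_star \<phi>))"

definition semigroup_L1w ::
  "'a::euclidean_space set \<Rightarrow> ('a \<Rightarrow> real) \<Rightarrow> (real \<Rightarrow> ('a \<Rightarrow> real) \<Rightarrow> ('a \<Rightarrow> real)) \<Rightarrow> bool" where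
  "semigroup_L1w \<Omega> w S \<longleftrightarrow>
     (\<forall>t\<ge>0. bounded_operator_L1w \<Omega> w (S t)) \<and>
     (\<forall>\<rho>\<in>L1w \<Omega> w. AE x in lebesgue_on \<Omega>. S 0 \<rho> x = \<rho> x) \<and>
     (\<forall>s\<ge>0. \<forall>t\<ge>0. \<forall>\<rho>\<in>L1w \<Omega> w. AE x in lebesgue_on \<Omega>. S (s + t) \<rho> x = S s (S t \<rho>) x) \<and>
     (\<forall>\<rho>\<in>L1w \<Omega> w. ((\<lambda>t. norm_L1w \<Omega> w (\<lambda>x. S t \<rho> x - \<rho> x)) \<longlongrightarrow> 0) (at_right 0))"

end

theory Submission
  imports Defs
begin

text \<open>
Write \<open>g = 1 / w\<close>. Pairing \<open>S(t)\<rho>\<close> with \<open>sgn (S(t)\<rho>) g\<close> produces the norm of \<open>S(t)\<rho>\<close>, and the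
preadjoint identity moves the flow onto the test function, whose modulus becomes at most
\<open>g \<circ> \<Phi>\<^sup>t\<close>. The exponential bound is therefore the duality form of \<open>g \<circ> \<Phi>\<^sup>t \<le> exp (\<omega>\<^sub>0 t) g\<close> almost
everywhere (\<open>norm_S_le\<close>), which is the integrated form of \<open>f \<bullet> \<nabla>g \<le> \<omega>\<^sub>0 g\<close>; the latter is what the
hypothesis on the essential supremum says after substituting \<open>\<nabla>w = - w\<^sup>2 \<nabla>g\<close>.

Since \<open>g\<close> has only a weak gradient, the differential inequality is integrated for a mollification
of \<open>g\<close> along a single trajectory. Replacing the velocity at the centre of the kernel by the velocity
at the integration variable costs an error proportional to the radius, because \<open>f\<close> is Lipschitz and
\<open>\<nabla>g\<close> is bounded. The error disappears when the radius tends to zero, and the mollifications converge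
at every Lebesgue point of \<open>g\<close>. The flow pulls null sets back to null sets, so almost every trajectory
starts and ends at a Lebesgue point (\<open>AE_le_along_flow\<close>).

All this needs trajectories that remain in the open set \<open>\<Omega>\<close>. The pairing \<open>\<langle>S(t)\<rho>, \<phi>\<rangle>\<close> does not see the
values of \<open>\<phi>\<close> outside \<open>\<Omega>\<close>, hence neither does \<open>\<langle>\<rho>, \<phi> \<circ> \<Phi>\<^sup>t\<rangle>\<close>; taking for \<open>\<phi>\<close> the indicator of the exterior of
\<open>\<Omega>\<close> shows that \<open>\<Phi>\<^sup>t\<close> maps \<open>\<Omega>\<close> into its closure (\<open>preadjoint_imp_flow_in_closure\<close>). As \<open>\<Phi>\<^sup>t\<close> is continuous and
injective, the image of \<open>\<Omega>\<close> is open by invariance of domain, so it lies in the interior of the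
closure, and this interior is \<open>\<Omega>\<close> when the boundary is \<open>C\<^sup>1\<close> (\<open>flow_stays_in_domain\<close>).

The semigroup law follows by duality. For strong continuity put \<open>m = \<rho> w\<^sup>2\<close> and \<open>m\<^sub>t = (S(t)\<rho>) w\<^sup>2\<close>, the
density transported by the flow. By Gronwall's inequality the inverse of \<open>\<Phi>\<^sup>t\<close> is Lipschitz with
constant \<open>exp (L t)\<close>, so preimages increase volume by at most \<open>exp (d L t)\<close>
(\<open>expanding_preimage_emeasure_le\<close>), and \<open>m\<^sub>t\<close> satisfies \<open>\<parallel>m\<^sub>t\<parallel>\<^sup>2 \<le> exp (d L t) \<parallel>m\<parallel>\<^sup>2\<close> in \<open>L\<^sup>2\<close>
(\<open>S_tame_L2_bound\<close>). The inner product of \<open>m\<^sub>t\<close> and \<open>m\<close> is the integral of \<open>m (m \<circ> \<Phi>\<^sup>t)\<close> and tends to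
\<open>\<parallel>m\<parallel>\<^sup>2\<close>. As in any Hilbert space, these two facts force \<open>m\<^sub>t \<rightarrow> m\<close> in norm (\<open>S_tame_tendsto\<close>). This settles a
dense class of \<open>\<rho>\<close>, and contractivity extends it to all of \<open>L\<^sup>1\<^sub>w\<close> (\<open>S_strongly_continuous\<close>).
\<close>

section \<open>Trajectories of a continuously differentiable vector field\<close>

lemma C1_map_imp_lipschitz_on:
  fixes f :: "'a::euclidean_space \<Rightarrow> 'b::euclidean_space"
  assumes "C1_map f" "compact X" "convex X"
  obtains L where "L-lipschitz_on X f"
proof -
  obtain f' :: "'a \<Rightarrow> 'a \<Rightarrow>\<^sub>L 'b"
    where f': "\<And>x. (f has_derivative blinfun_apply (f' x)) (at x)" and cont: "continuous_on UNIV f'"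
    using assms(1) unfolding C1_map_def by blast
  have "compact (f' ` X)"
    by (rule compact_continuous_image[OF continuous_on_subset[OF cont] assms(2)]) simp
  then obtain C where C: "\<And>x. x \<in> X \<Longrightarrow> norm (f' x) \<le> C"
    using compact_imp_bounded bounded_iff by (metis imageI)
  have "(max 0 C)-lipschitz_on X f"
  proof (rule bounded_derivative_imp_lipschitz)
    show "(f has_derivative blinfun_apply (f' x)) (at x within X)" for x
      using f' has_derivative_at_withinI by blast
    show "onorm (blinfun_apply (f' x)) \<le> max 0 C" if "x \<in> X" for x
      using C[OF that] by (simp add: norm_blinfun.rep_eq)
  qed (use assms in auto)
  then show ?thesis by (rule that)
qed

text \<open>Gronwall's inequality in both directions of time: the derivative of the squared distance of two
solutions is at most \<open>2 L\<close> times the squared distance in modulus. The upper bound gives continuous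
dependence on the initial value, the lower bound injectivity of the flow and a Lipschitz inverse.\<close>

lemma solutions_distance_bounds:
  fixes x y :: "real \<Rightarrow> 'a::euclidean_space"
  assumes "0 \<le> t"
    and x: "\<And>s. 0 \<le> s \<Longrightarrow> s \<le> t \<Longrightarrow> (x has_vector_derivative f (x s)) (at s within {0..})"
    and y: "\<And>s. 0 \<le> s \<Longrightarrow> s \<le> t \<Longrightarrow> (y has_vector_derivative f (y s)) (at s within {0..})"
    and X: "\<And>s. 0 \<le> s \<Longrightarrow> s \<le> t \<Longrightarrow> x s \<in> X \<and> y s \<in> X"
    and lip: "L-lipschitz_on X f"
  shows "norm (x t - y t) \<le> exp (L * t) * norm (x 0 - y 0)"
    and "norm (x 0 - y 0) \<le> exp (L * t) * norm (x t - y t)"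
proof -
  define h where "h s = (x s - y s) \<bullet> (x s - y s)" for s
  define h' where "h' s = 2 * ((x s - y s) \<bullet> (f (x s) - f (y s)))" for s
  have dz: "((\<lambda>s. x s - y s) has_vector_derivative f (x s) - f (y s)) (at s within {0..})"
    if "0 \<le> s" "s \<le> t" for s
    using x[OF that] y[OF that] by (rule has_vector_derivative_diff)
  have dh: "(h has_real_derivative h' s) (at s within {0..})" if "0 \<le> s" "s \<le> t" for s
  proof -
    have "(h has_derivative (\<lambda>r. (x s - y s) \<bullet> (r *\<^sub>R (f (x s) - f (y s)))
        + (r *\<^sub>R (f (x s) - f (y s))) \<bullet> (x s - y s))) (at s within {0..})"
      unfolding h_def
      by (intro has_derivative_inner dz[OF that, unfolded has_vector_derivative_def])
    moreover have "(\<lambda>r. (x s - y s) \<bullet> (r *\<^sub>R (f (x s) - f (y s)))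
        + (r *\<^sub>R (f (x s) - f (y s))) \<bullet> (x s - y s)) = (*) (h' s)"
      unfolding h'_def by (auto simp: inner_commute)
    ultimately show ?thesis unfolding has_field_derivative_def by simp
  qed
  have dh_in: "(h has_real_derivative h' s) (at s)" if "0 < s" "s < t" for s
    using dh[of s] that at_within_interior[of s "{0..}"] by (simp add: interior_Ici[of "-1"])
  have conth: "continuous_on {0..t} h"
    by (rule DERIV_continuous_on[where D = h'], rule DERIV_subset[OF dh]) auto
  have h'_le: "\<bar>h' s\<bar> \<le> 2 * L * h s" if "0 \<le> s" "s \<le> t" for s
  proof -
    have "\<bar>(x s - y s) \<bullet> (f (x s) - f (y s))\<bar> \<le> norm (x s - y s) * norm (f (x s) - f (y s))"
      by (rule Cauchy_Schwarz_ineq2)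
    also have "\<dots> \<le> norm (x s - y s) * (L * norm (x s - y s))"
      using lipschitz_onD[OF lip] X[OF that] by (intro mult_left_mono) (auto simp: dist_norm)
    finally show ?thesis
      unfolding h'_def h_def dot_square_norm by (simp add: power2_eq_square abs_mult algebra_simps)
  qed
  have h0: "h s = (norm (x s - y s))\<^sup>2" for s
    unfolding h_def by (simp add: dot_square_norm)
  have "h t * exp (- 2 * L * t) \<le> h 0 * exp (- 2 * L * 0)"
  proof (rule DERIV_nonpos_imp_decreasing_open[OF \<open>0 \<le> t\<close>])
    fix s assume s: "0 < s" "s < t"
    have "((\<lambda>s. h s * exp (- 2 * L * s)) has_real_derivative (h' s - 2 * L * h s) * exp (- 2 * L * s)) (at s)"
      by (auto intro!: derivative_eq_intros dh_in s simp: algebra_simps)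
    moreover have "(h' s - 2 * L * h s) * exp (- 2 * L * s) \<le> 0"
      using h'_le[of s] s by (intro mult_nonpos_nonneg) auto
    ultimately show "\<exists>d. ((\<lambda>s. h s * exp (- 2 * L * s)) has_real_derivative d) (at s) \<and> d \<le> 0"
      by blast
  qed (intro continuous_intros conth)
  then have "h t \<le> (exp (L * t))\<^sup>2 * h 0"
    by (simp add: exp_minus field_simps exp_of_nat_mult[symmetric] power2_eq_square exp_add[symmetric])
  then show "norm (x t - y t) \<le> exp (L * t) * norm (x 0 - y 0)"
    unfolding h0 power_mult_distrib[symmetric] by (rule power2_le_imp_le) simp
  have "- (h t * exp (2 * L * t)) \<le> - (h 0 * exp (2 * L * 0))"
  proof (rule DERIV_nonpos_imp_decreasing_open[OF \<open>0 \<le> t\<close>])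
    fix s assume s: "0 < s" "s < t"
    have "((\<lambda>s. - (h s * exp (2 * L * s))) has_real_derivative - (h' s + 2 * L * h s) * exp (2 * L * s)) (at s)"
      by (auto intro!: derivative_eq_intros dh_in s simp: algebra_simps)
    moreover have "- (h' s + 2 * L * h s) * exp (2 * L * s) \<le> 0"
      using h'_le[of s] s by (intro mult_nonpos_nonneg) auto
    ultimately show "\<exists>d. ((\<lambda>s. - (h s * exp (2 * L * s))) has_real_derivative d) (at s) \<and> d \<le> 0"
      by blast
  qed (intro continuous_intros conth)
  then have "h 0 \<le> (exp (L * t))\<^sup>2 * h t"
    by (simp add: algebra_simps power2_eq_square exp_add[symmetric])
  then show "norm (x 0 - y 0) \<le> exp (L * t) * norm (x t - y t)"
    unfolding h0 power_mult_distrib[symmetric] by (rule power2_le_imp_le) simp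
qed

lemma
  assumes "is_flow f \<Omega> \<Phi>" "z \<in> closure \<Omega>"
  shows is_flow_0: "\<Phi> 0 z = z"
    and is_flow_deriv: "0 \<le> t \<Longrightarrow> ((\<lambda>s. \<Phi> s z) has_vector_derivative f (\<Phi> t z)) (at t within {0..})"
  using assms unfolding is_flow_def by auto

lemma is_flow_continuous_on_time:
  assumes "is_flow f \<Omega> \<Phi>" "z \<in> closure \<Omega>"
  shows "continuous_on {0..} (\<lambda>s. \<Phi> s z)"
  by (rule continuous_on_vector_derivative) (use is_flow_deriv[OF assms] in auto)

text \<open>The field is only locally Lipschitz and trajectories are not yet known to be bounded uniformly in
their starting point. A trajectory that starts close enough to \<open>z\<close> cannot leave the tube of radius 1
around the trajectory of \<open>z\<close> before time \<open>t\<close>, because up to the first exit Gronwall's inequality keeps the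
two trajectories at distance less than 1.\<close>

lemma flow_continuous_on:
  fixes f :: "'a::euclidean_space \<Rightarrow> 'a"
  assumes f: "C1_map f" and flow: "is_flow f \<Omega> \<Phi>" and t: "0 \<le> t"
  shows "continuous_on (closure \<Omega>) (\<Phi> t)"
  unfolding continuous_on_iff
proof (intro ballI allI impI)
  fix z and e :: real
  assume z: "z \<in> closure \<Omega>" and e: "0 < e"
  have contz: "continuous_on {0..t} (\<lambda>s. \<Phi> s y)" if "y \<in> closure \<Omega>" for y
    using is_flow_continuous_on_time[OF flow that] by (rule continuous_on_subset) auto
  have "compact ((\<lambda>s. \<Phi> s z) ` {0..t})"
    using contz[OF z] by (rule compact_continuous_image) simp
  then obtain R where R: "\<And>s. 0 \<le> s \<Longrightarrow> s \<le> t \<Longrightarrow> norm (\<Phi> s z) \<le> R"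
    using compact_imp_bounded bounded_iff by (metis atLeastAtMost_iff imageI)
  obtain L where lip: "L-lipschitz_on (cball 0 (R + 1)) f"
    by (rule C1_map_imp_lipschitz_on[OF f, of "cball 0 (R + 1)"]) auto
  have L: "0 \<le> L" using lip by (rule lipschitz_on_nonneg)
  \<comment> \<open>Gronwall's inequality keeps trajectories starting within this distance both inside the
    tube and within the required accuracy.\<close>
  define d where "d = min 1 e / exp (L * t)"
  show "\<exists>d>0. \<forall>y\<in>closure \<Omega>. dist y z < d \<longrightarrow> dist (\<Phi> t y) (\<Phi> t z) < e"
  proof (intro exI conjI ballI impI)
    show "0 < d" unfolding d_def using e by simp
    fix y assume y: "y \<in> closure \<Omega>" "dist y z < d"
    define u where "u s = norm (\<Phi> s y - \<Phi> s z)" for s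
    have contu: "continuous_on {0..t} u"
      unfolding u_def by (intro continuous_intros contz z y(1))
    have u0: "u 0 = dist y z"
      unfolding u_def using is_flow_0[OF flow] z y by (simp add: dist_norm)
    have step: "u s < min 1 e" if s: "0 \<le> s" "s \<le> t" and le: "\<And>r. 0 \<le> r \<Longrightarrow> r \<le> s \<Longrightarrow> u r \<le> 1" for s
    proof -
      have inX: "\<Phi> r y \<in> cball 0 (R + 1) \<and> \<Phi> r z \<in> cball 0 (R + 1)" if "0 \<le> r" "r \<le> s" for r
        using R[of r] le[of r] that s norm_triangle_sub[of "\<Phi> r y" "\<Phi> r z"] by (auto simp: u_def)
      have "u s \<le> exp (L * s) * u 0"
        unfolding u_def
        by (rule solutions_distance_bounds(1)[where f = f and X = "cball 0 (R + 1)"])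
          (use is_flow_deriv[OF flow] y z s lip inX in auto)
      also have "\<dots> \<le> exp (L * t) * u 0"
        using s L by (intro mult_right_mono) (auto simp: u_def mult_left_mono)
      also have "\<dots> < min 1 e"
        using y(2) unfolding u0 d_def by (simp add: field_simps)
      finally show ?thesis .
    qed
    have le1: "u s \<le> 1" if s: "0 \<le> s" "s \<le> t" for s
    proof (rule ccontr)
      assume "\<not> u s \<le> 1"
      define A where "A = {r \<in> {0..t}. 1 \<le> u r}"
      have "closed A"
        unfolding A_def using contu by (intro continuous_closed_preimage_constant continuous_on_closed_Collect_le continuous_intros) auto
      moreover have "A \<noteq> {}"
        using \<open>\<not> u s \<le> 1\<close> s unfolding A_def by auto
      moreover have "bounded A"
        by (rule bounded_subset[of "{0..t}"]) (auto simp: A_def)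
      \<comment> \<open>The first exit time from the tube.\<close>
      ultimately obtain r where r: "r \<in> A" "\<And>q. q \<in> A \<Longrightarrow> r \<le> q"
        using compact_attains_inf[of A] by (auto simp: compact_eq_bounded_closed)
      have r': "0 \<le> r" "r \<le> t" "1 \<le> u r" using r(1) unfolding A_def by auto
      have "u 0 \<le> 1" 
      proof -
        have "d \<le> 1"
          unfolding d_def using L t by (simp add: divide_le_eq) (meson min.coboundedI1 mult_nonneg_nonneg one_le_exp_iff)
        then show ?thesis using y(2) u0 by simp
      qed
      obtain q where q: "0 \<le> q" "q \<le> r" "u q = 1"
        using IVT'[of u 0 1 r] \<open>u 0 \<le> 1\<close> r' continuous_on_subset[OF contu] by auto
      then have "q = r" using r(2)[of q] r' unfolding A_def by auto
      have "u p \<le> 1" if "0 \<le> p" "p \<le> r" for p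
        using r(2)[of p] that r' q \<open>q = r\<close> unfolding A_def by (cases "p = r") force+
      then have "u r < 1" using step[of r] r' by auto
      then show False using r' by simp
    qed
    show "dist (\<Phi> t y) (\<Phi> t z) < e"
      using step[of t] le1 t by (auto simp: u_def dist_norm)
  qed
qed

text \<open>In a chart at a boundary point \<open>p\<close> the domain lies above a graph and the points strictly below the
graph have a neighbourhood disjoint from it. Moving from \<open>p\<close> downwards therefore leaves the closure
at once.\<close>

lemma interior_closure_C1_boundary:
  fixes \<Omega> :: "'a::euclidean_space set"
  assumes "open \<Omega>" "C1_boundary \<Omega>"
  shows "interior (closure \<Omega>) = \<Omega>"
proof (rule antisym)
  show "\<Omega> \<subseteq> interior (closure \<Omega>)"
    using assms(1) by (simp add: closure_subset interior_maximal)
  show "interior (closure \<Omega>) \<subseteq> \<Omega>"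
  proof (rule subsetI, rule ccontr)
    fix p assume p: "p \<in> interior (closure \<Omega>)" "p \<notin> \<Omega>"
    then have "p \<in> frontier \<Omega>"
      using assms(1) interior_subset by (auto simp: frontier_def interior_open)
    then obtain e r \<gamma> D\<gamma> where ch: "boundary_chart \<Omega> p e r \<gamma> D\<gamma>"
      using assms(2) unfolding C1_boundary_def by blast
    then have e: "norm e = 1" and r: "0 < r" and D: "\<And>y. GDERIV \<gamma> y :> D\<gamma> y"
      and eq: "\<Omega> \<inter> ball p r = {x \<in> ball p r. \<gamma> (x - (x \<bullet> e) *\<^sub>R e) < x \<bullet> e}"
      unfolding boundary_chart_def by auto
    have cont: "continuous_on UNIV \<gamma>"
      using D by (metis GDERIV_DERIV_compose continuous_at_imp_continuous_on gderiv_def has_derivative_continuous)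
    define F where "F x = \<gamma> (x - (x \<bullet> e) *\<^sub>R e) - x \<bullet> e" for x
    have "continuous_on UNIV F"
      unfolding F_def by (intro continuous_intros continuous_on_compose2[OF cont]) auto
    then have opF: "open {x. 0 < F x}"
      by (intro open_Collect_less) (auto intro!: continuous_intros)
    have disj: "{x. 0 < F x} \<inter> ball p r \<inter> \<Omega> = {}"
    proof -
      have "\<not> 0 < F x" if "x \<in> ball p r" "x \<in> \<Omega>" for x
      proof -
        have "x \<in> {x \<in> ball p r. \<gamma> (x - (x \<bullet> e) *\<^sub>R e) < x \<bullet> e}"
          using that unfolding eq[symmetric] by blast
        then show ?thesis unfolding F_def by simp
      qed
      then show ?thesis by blast
    qed
    have "0 \<le> F p" using p(2) eq r unfolding F_def by (force simp: not_less)
    obtain q where q: "0 < q" "ball p q \<subseteq> closure \<Omega>"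
      using p(1) mem_interior by blast
    \<comment> \<open>A step along \<open>- e\<close> that stays both in the chart and in the supposed ball around \<open>p\<close>.\<close>
    define d where "d = min q r / 2"
    have d: "0 < d" "d < q" "d < r" using q r unfolding d_def by auto
    have ee: "e \<bullet> e = 1" using e by (simp add: dot_square_norm)
    have "F (p - d *\<^sub>R e) = F p + d"
      unfolding F_def by (simp add: inner_diff_left ee algebra_simps)
    then have "p - d *\<^sub>R e \<in> {x. 0 < F x} \<inter> ball p r"
      using \<open>0 \<le> F p\<close> d e by (simp add: dist_norm)
    moreover have "p - d *\<^sub>R e \<in> closure \<Omega>"
      using q d e by (auto simp: dist_norm subset_iff)
    ultimately show False
      using open_Int_closure_eq_empty[of "{x. 0 < F x} \<inter> ball p r" \<Omega>] opF disj
      by (metis IntI empty_iff open_Int open_ball)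
  qed
qed

lemma flow_distance_bounds:
  assumes flow: "is_flow f \<Omega> \<Phi>" and lip: "L-lipschitz_on X f" and t: "0 \<le> t"
    and y: "y \<in> closure \<Omega>" "\<And>s. 0 \<le> s \<Longrightarrow> s \<le> t \<Longrightarrow> \<Phi> s y \<in> X"
    and z: "z \<in> closure \<Omega>" "\<And>s. 0 \<le> s \<Longrightarrow> s \<le> t \<Longrightarrow> \<Phi> s z \<in> X"
  shows "norm (\<Phi> t y - \<Phi> t z) \<le> exp (L * t) * norm (y - z)"
    and "norm (y - z) \<le> exp (L * t) * norm (\<Phi> t y - \<Phi> t z)"
proof -
  note bounds = solutions_distance_bounds[of t "\<lambda>s. \<Phi> s y" f "\<lambda>s. \<Phi> s z" X L,
      OF t is_flow_deriv[OF flow y(1)] is_flow_deriv[OF flow z(1)]]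
  show "norm (\<Phi> t y - \<Phi> t z) \<le> exp (L * t) * norm (y - z)"
    "norm (y - z) \<le> exp (L * t) * norm (\<Phi> t y - \<Phi> t z)"
    using bounds lip y z by (auto simp: is_flow_0[OF flow])
qed

text \<open>Only invariance of the closure has to be known beforehand: the image of the domain is open by
invariance of domain, hence contained in the interior of the closure.\<close>

lemma flow_stays_in_domain:
  fixes f :: "'a::euclidean_space \<Rightarrow> 'a"
  assumes f: "C1_map f" and flow: "is_flow f \<Omega> \<Phi>"
    and "open \<Omega>" "bounded \<Omega>" "C1_boundary \<Omega>"
    and closed_inv: "\<And>t x. 0 \<le> t \<Longrightarrow> x \<in> \<Omega> \<Longrightarrow> \<Phi> t x \<in> closure \<Omega>"
    and t: "0 \<le> t" and x: "x \<in> \<Omega>"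
  shows "\<Phi> t x \<in> \<Omega>"
proof -
  obtain R where R: "closure \<Omega> \<subseteq> cball 0 R"
    using \<open>bounded \<Omega>\<close> by (metis bounded_closure bounded_iff mem_cball_0 subsetI)
  obtain L where lip: "L-lipschitz_on (cball 0 R) f"
    by (rule C1_map_imp_lipschitz_on[OF f, of "cball 0 R"]) auto
  have "inj_on (\<Phi> t) \<Omega>"
  proof (rule inj_onI)
    fix y z assume yz: "y \<in> \<Omega>" "z \<in> \<Omega>" "\<Phi> t y = \<Phi> t z"
    have "norm (y - z) \<le> exp (L * t) * norm (\<Phi> t y - \<Phi> t z)"
      using yz closed_inv R closure_subset[of \<Omega>]
      by (intro flow_distance_bounds(2)[OF flow lip t]) blast+
    then show "y = z" using yz(3) by simp
  qed
  moreover have "continuous_on \<Omega> (\<Phi> t)"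
    using flow_continuous_on[OF f flow t] closure_subset by (rule continuous_on_subset)
  ultimately have "open (\<Phi> t ` \<Omega>)"
    using \<open>open \<Omega>\<close> by (intro invariance_of_domain)
  then have "\<Phi> t ` \<Omega> \<subseteq> interior (closure \<Omega>)"
    using closed_inv t by (intro interior_maximal) auto
  then show ?thesis
    using x interior_closure_C1_boundary assms by auto
qed

section \<open>Volume of preimages under expanding maps\<close>

lemma emeasure_UN_countable_le:
  assumes C: "countable C" and Y: "\<And>i. i \<in> C \<Longrightarrow> Y i \<in> sets M"
  shows "emeasure M (\<Union>i\<in>C. Y i) \<le> (\<integral>\<^sup>+i. emeasure M (Y i) \<partial>count_space C)"
proof -
  have "emeasure M (\<Union>i\<in>C. Y i) = (\<integral>\<^sup>+x. indicator (\<Union>i\<in>C. Y i) x \<partial>M)"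
    using assms by (intro nn_integral_indicator[symmetric] sets.countable_UN'')
  also have "\<dots> \<le> (\<integral>\<^sup>+x. \<integral>\<^sup>+i. indicator (Y i) x \<partial>count_space C \<partial>M)"
  proof (rule nn_integral_mono)
    fix x
    show "indicator (\<Union>i\<in>C. Y i) x \<le> (\<integral>\<^sup>+i. indicator (Y i) x \<partial>count_space C :: ennreal)"
    proof (cases "x \<in> (\<Union>i\<in>C. Y i)")
      case True
      then obtain i where "i \<in> C" "x \<in> Y i" by blast
      then show ?thesis
        using nn_integral_ge_point[of i C "\<lambda>i. indicator (Y i) x"] by (auto simp: indicator_def)
    qed simp
  qed
  also have "\<dots> = (\<integral>\<^sup>+i. \<integral>\<^sup>+x. indicator (Y i) x \<partial>M \<partial>count_space C)"
    using assms by (intro nn_integral_count_space_nn_integral) auto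
  also have "\<dots> = (\<integral>\<^sup>+i. emeasure M (Y i) \<partial>count_space C)"
    using Y by (intro nn_integral_cong) simp
  finally show ?thesis .
qed

text \<open>On its range an expanding map has a Lipschitz inverse, and Lipschitz maps preserve negligible sets.\<close>

lemma expanding_preimage_negligible:
  fixes T :: "'a::euclidean_space \<Rightarrow> 'a"
  assumes exp: "\<And>x y. x \<in> \<Omega> \<Longrightarrow> y \<in> \<Omega> \<Longrightarrow> norm (x - y) \<le> K * norm (T x - T y)"
    and N: "negligible N"
  shows "negligible {x \<in> \<Omega>. T x \<in> N}"
proof -
  have inj: "inj_on T \<Omega>"
    by (rule inj_onI) (use exp in fastforce)
  have "negligible (inv_into \<Omega> T ` (N \<inter> T ` \<Omega>))"
  proof (rule negligible_locally_Lipschitz_image)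
    show "negligible (N \<inter> T ` \<Omega>)" using N by (rule negligible_subset) auto
    show "\<exists>U B. open U \<and> x \<in> U \<and> (\<forall>y\<in>N \<inter> T ` \<Omega> \<inter> U.
        norm (inv_into \<Omega> T y - inv_into \<Omega> T x) \<le> B * norm (y - x))"
      if "x \<in> N \<inter> T ` \<Omega>" for x
      using that exp inj by (intro exI[of _ UNIV] exI[of _ K]) (auto simp: inv_into_f_f)
  qed simp
  moreover have "{x \<in> \<Omega>. T x \<in> N} \<subseteq> inv_into \<Omega> T ` (N \<inter> T ` \<Omega>)"
    using inj by (force simp: inv_into_f_f)
  ultimately show ?thesis by (rule negligible_subset)
qed

lemma expanding_preimage_measurable:
  fixes T :: "'a::euclidean_space \<Rightarrow> 'a"
  assumes exp: "\<And>x y. x \<in> \<Omega> \<Longrightarrow> y \<in> \<Omega> \<Longrightarrow> norm (x - y) \<le> K * norm (T x - T y)"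
    and cont: "continuous_on \<Omega> T" and \<Omega>: "open \<Omega>"
    and A: "A \<in> sets lebesgue"
  shows "{x \<in> \<Omega>. T x \<in> A} \<in> sets lebesgue"
proof -
  obtain B N N' where B: "A = B \<union> N" "N \<subseteq> N'" "N' \<in> null_sets lborel" "B \<in> sets borel"
    using A by (auto elim: sets_completionE)
  have "negligible N"
    using B by (meson negligible_iff_null_sets negligible_subset null_sets_completionI)
  then have "{x \<in> \<Omega>. T x \<in> N} \<in> sets lebesgue"
    using expanding_preimage_negligible[OF exp] negligible_imp_sets by blast
  moreover have "T -` B \<inter> space (restrict_space borel \<Omega>) \<in> sets (restrict_space borel \<Omega>)"
    using borel_measurable_continuous_on_restrict[OF cont] B(4) by (rule measurable_sets)
  then have "{x \<in> \<Omega>. T x \<in> B} \<in> sets borel"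
    using \<Omega> by (auto simp: space_restrict_space sets_restrict_space_iff vimage_def Int_def conj_commute)
  then have "{x \<in> \<Omega>. T x \<in> B} \<in> sets lebesgue" by simp
  moreover have "{x \<in> \<Omega>. T x \<in> A} = {x \<in> \<Omega>. T x \<in> B} \<union> {x \<in> \<Omega>. T x \<in> N}"
    using B(1) by auto
  ultimately show ?thesis by auto
qed

text \<open>The sharp constant \<open>K\<^sup>d\<close> matters, since it has to tend to 1 with \<open>K\<close>. It comes from a Vitali covering of
\<open>A\<close> by disjoint balls inside a slightly larger open set: the preimage of each ball lies in a ball whose
radius is larger by the factor \<open>K\<close>, and the part of \<open>A\<close> missed by the covering has a negligible
preimage.\<close>

lemma expanding_preimage_emeasure_le:
  fixes T :: "'a::euclidean_space \<Rightarrow> 'a"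
  assumes exp: "\<And>x y. x \<in> \<Omega> \<Longrightarrow> y \<in> \<Omega> \<Longrightarrow> norm (x - y) \<le> K * norm (T x - T y)"
    and K: "0 < K" and A: "A \<in> sets lebesgue"
  shows "emeasure lebesgue {x \<in> \<Omega>. T x \<in> A} \<le> ennreal (K ^ DIM('a)) * emeasure lebesgue A"
proof -
  define P where "P = {x \<in> \<Omega>. T x \<in> A}"
  define \<mu> where "\<mu> = (emeasure lebesgue :: 'a set \<Rightarrow> ennreal)"
  have open_bound: "\<mu> P \<le> ennreal (K ^ DIM('a)) * \<mu> U" if U: "open U" "A \<subseteq> U" for U
  proof -
    define I where "I = {(a, r). a \<in> A \<inter> T ` \<Omega> \<and> 0 < r \<and> ball a r \<subseteq> U}"
    obtain C where C: "countable C" "C \<subseteq> I"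
      and disj: "pairwise (\<lambda>i j. disjnt (ball (fst i) (snd i)) (ball (fst j) (snd j))) C"
      and negl: "negligible (A \<inter> T ` \<Omega> - (\<Union>i\<in>C. ball (fst i) (snd i)))"
    proof (rule Vitali_covering_theorem_balls[of "A \<inter> T ` \<Omega>" I fst snd])
      fix a and d :: real assume a: "a \<in> A \<inter> T ` \<Omega>" "0 < d"
      obtain r where r: "0 < r" "ball a r \<subseteq> U"
        using U a by (meson IntD1 openE subsetD)
      then have "(a, min r (d / 2)) \<in> I"
        using a unfolding I_def by auto
      then show "\<exists>i. i \<in> I \<and> a \<in> ball (fst i) (snd i) \<and> snd i < d"
        using a r by (intro exI[of _ "(a, min r (d / 2))"]) auto
    qed blast
    define g where "g = inv_into \<Omega> T"
    define X where "X i = ball (fst i) (snd i)" for i :: "'a \<times> real"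
    define Y where "Y i = cball (g (fst i)) (K * snd i)" for i :: "'a \<times> real"
    define N where "N = {x \<in> \<Omega>. T x \<in> A \<inter> T ` \<Omega> - (\<Union>i\<in>C. X i)}"
    have N: "N \<in> null_sets lebesgue"
      using expanding_preimage_negligible[OF exp negl] unfolding N_def X_def negligible_iff_null_sets .
    have snd_pos: "0 < snd i" if "i \<in> C" for i
      using that C(2) unfolding I_def by auto
    have "P \<subseteq> (\<Union>i\<in>C. Y i) \<union> N"
    proof
      fix x assume x: "x \<in> P"
      show "x \<in> (\<Union>i\<in>C. Y i) \<union> N"
      proof (cases "x \<in> N")
        case False
        then obtain i where i: "i \<in> C" "T x \<in> X i"
          using x unfolding N_def P_def by auto
        have "fst i \<in> T ` \<Omega>" using i C(2) unfolding I_def by auto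
        then have g: "g (fst i) \<in> \<Omega>" "T (g (fst i)) = fst i"
          unfolding g_def by (auto simp: inv_into_into f_inv_into_f)
        have "norm (g (fst i) - x) \<le> K * norm (fst i - T x)"
          using exp[OF g(1), of x] g(2) x unfolding P_def by auto
        also have "\<dots> \<le> K * snd i"
          using i(2) K unfolding X_def by (auto simp: dist_norm)
        finally show ?thesis using i(1) unfolding Y_def by (auto simp: dist_norm)
      qed simp
    qed
    then have "\<mu> P \<le> \<mu> ((\<Union>i\<in>C. Y i) \<union> N)"
      unfolding \<mu>_def using N C(1) by (intro emeasure_mono sets.Un sets.countable_UN'') (auto simp: Y_def)
    also have "\<dots> = \<mu> (\<Union>i\<in>C. Y i)"
      unfolding \<mu>_def using N C(1) by (intro emeasure_Un_null_set sets.countable_UN'') (auto simp: Y_def)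
    also have "\<dots> \<le> (\<integral>\<^sup>+i. \<mu> (Y i) \<partial>count_space C)"
      unfolding \<mu>_def using C(1) by (intro emeasure_UN_countable_le) (auto simp: Y_def)
    also have "\<dots> = (\<integral>\<^sup>+i. ennreal (K ^ DIM('a)) * \<mu> (X i) \<partial>count_space C)"
    proof (rule nn_integral_cong)
      fix i assume "i \<in> space (count_space C)"
      then have "0 < snd i" using snd_pos by simp
      then show "\<mu> (Y i) = ennreal (K ^ DIM('a)) * \<mu> (X i)"
        using K by (simp add: Y_def X_def \<mu>_def emeasure_cball emeasure_ball power_mult_distrib
            ennreal_mult[symmetric] mult_ac)
    qed
    also have "\<dots> = ennreal (K ^ DIM('a)) * (\<integral>\<^sup>+i. \<mu> (X i) \<partial>count_space C)"
      by (rule nn_integral_cmult) simp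
    also have "(\<integral>\<^sup>+i. \<mu> (X i) \<partial>count_space C) = \<mu> (\<Union>i\<in>C. X i)"
      unfolding \<mu>_def using C(1) disj
      by (intro emeasure_UN_countable[symmetric])
        (auto simp: X_def disjoint_family_on_def pairwise_def disjnt_def)
    also have "\<dots> \<le> \<mu> U"
    proof -
      have "X i \<subseteq> U" if "i \<in> C" for i
        using that C(2) unfolding I_def X_def by force
      then show ?thesis unfolding \<mu>_def using U(1) by (intro emeasure_mono) auto
    qed
    finally show ?thesis by (simp add: mult_left_mono)
  qed
  have "\<mu> P \<le> ennreal (K ^ DIM('a)) * \<mu> A"
  proof (rule ennreal_le_epsilon)
    fix e :: real assume e: "0 < e"
    \<comment> \<open>The excess volume of the open set, chosen so that it contributes \<open>e\<close> after scaling.\<close>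
    define e' where "e' = e / K ^ DIM('a)"
    have e': "0 < e'" unfolding e'_def using e K by simp
    obtain U where U: "open U" "A \<subseteq> U" "U - A \<in> lmeasurable" "emeasure lebesgue (U - A) < ennreal e'"
      using sets_lebesgue_outer_open[OF A e'] by blast
    have "\<mu> U = \<mu> (A \<union> (U - A))" using U(2) by (simp add: Un_absorb1)
    also have "\<dots> \<le> \<mu> A + \<mu> (U - A)"
      unfolding \<mu>_def using A U by (intro emeasure_subadditive) auto
    also have "\<dots> \<le> \<mu> A + ennreal e'"
      using U(4) unfolding \<mu>_def by (intro add_left_mono) auto
    finally have "ennreal (K ^ DIM('a)) * \<mu> U \<le> ennreal (K ^ DIM('a)) * (\<mu> A + ennreal e')"
      by (rule mult_left_mono) simp
    also have "\<dots> = ennreal (K ^ DIM('a)) * \<mu> A + ennreal e"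
      using e K unfolding e'_def by (simp add: distrib_left ennreal_mult[symmetric])
    finally show "\<mu> P \<le> ennreal (K ^ DIM('a)) * \<mu> A + ennreal e"
      using open_bound[OF U(1,2)] by (rule order_trans[rotated])
  qed
  then show ?thesis unfolding P_def \<mu>_def .
qed

section \<open>A smooth bump kernel\<close>

text \<open>The family is closed under differentiation up to linear combinations and consists of functions that
are flat at 0. The member with index 0 is the classical smooth function vanishing on the negative
half line.\<close>

definition flat_exp :: "nat \<Rightarrow> real \<Rightarrow> real" where
  "flat_exp k s = (if 0 < s then exp (- 1 / s) / s ^ k else 0)"

lemma flat_exp_nonneg: "0 \<le> flat_exp k s"
  by (simp add: flat_exp_def)

text \<open>This is what makes every member of the family differentiable at 0 with derivative 0. It follows from
the term of order \<open>k + 2\<close> of the exponential series at \<open>1 / s\<close>.\<close>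

lemma flat_exp_le_quadratic: "flat_exp k s \<le> fact (k + 2) * s\<^sup>2"
proof (cases "0 < s")
  case True
  define t where "t = 1 / s"
  have t: "0 < t" using True by (simp add: t_def)
  have "(\<Sum>i\<in>{k + 2}. inverse (fact i) *\<^sub>R t ^ i) \<le> (\<Sum>i. inverse (fact i) *\<^sub>R t ^ i)"
    using t by (intro sum_le_suminf summable_exp_generic) auto
  then have "t ^ (k + 2) / fact (k + 2) \<le> exp t"
    unfolding exp_def by (simp only: sum.insert finite.emptyI sum.empty empty_iff not_False_eq_True
        add_0_right real_scaleR_def divide_inverse mult.commute)
  then have "t ^ (k + 2) \<le> fact (k + 2) * exp t"
    by (subst (asm) pos_divide_le_eq[OF fact_gt_zero]) (simp only: mult.commute)
  then have "t ^ (k + 2) * (exp (- t) * s\<^sup>2) \<le> fact (k + 2) * exp t * (exp (- t) * s\<^sup>2)"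
    by (rule mult_right_mono) simp
  moreover have "t ^ (k + 2) * (exp (- t) * s\<^sup>2) = flat_exp k s"
    using True by (simp add: flat_exp_def t_def power_add power2_eq_square field_simps)
  moreover have "fact (k + 2) * exp t * (exp (- t) * s\<^sup>2) = fact (k + 2) * (s\<^sup>2 * (exp t * exp (- t)))"
    by (simp only: mult_ac)
  ultimately show ?thesis by (simp only: exp_minus_inverse mult_1_right)
qed (simp add: flat_exp_def)

lemma DERIV_flat_exp:
  "(flat_exp k has_real_derivative - real k * flat_exp (k + 1) s + flat_exp (k + 2) s) (at s)"
proof (cases s "0 :: real" rule: linorder_cases)
  case less
  have "((\<lambda>s. 0) has_real_derivative 0) (at s)" by simp
  moreover have "eventually (\<lambda>x. x < 0) (nhds s)"
    using less by (intro eventually_nhds_in_open[of "{..<0}", simplified]) auto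
  then have "eventually (\<lambda>x. flat_exp k x = 0) (nhds s)"
    by eventually_elim (simp add: flat_exp_def)
  ultimately have "(flat_exp k has_real_derivative 0) (at s)"
    by (subst DERIV_cong_ev[where g = "\<lambda>_. 0" and y = s]) auto
  then show ?thesis using less by (simp add: flat_exp_def)
next
  case greater
  have "eventually (\<lambda>x. 0 < x) (nhds s)"
    using greater by (intro eventually_nhds_in_open[of "{0<..}", simplified]) auto
  then have "eventually (\<lambda>x. flat_exp k x = exp (- 1 / x) * inverse (x ^ k)) (nhds s)"
    by eventually_elim (simp add: flat_exp_def divide_inverse)
  moreover have "((\<lambda>x. exp (- 1 / x) * inverse (x ^ k)) has_real_derivative
      - real k * flat_exp (k + 1) s + flat_exp (k + 2) s) (at s)"
  proof -
    have "((\<lambda>x. inverse x ^ k) has_real_derivative - real k * inverse s ^ (k + 1)) (at s)"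
    proof (cases k)
      case (Suc n)
      then show ?thesis
        using DERIV_power[OF DERIV_inverse[of s UNIV], of k] greater by (simp add: algebra_simps)
    qed simp
    then have "((\<lambda>x. inverse (x ^ k)) has_real_derivative - real k * inverse s ^ (k + 1)) (at s)"
      by (simp add: power_inverse)
    moreover have "((\<lambda>x. exp (- 1 / x)) has_real_derivative exp (- 1 / s) * inverse s ^ 2) (at s)"
      using greater by (auto intro!: derivative_eq_intros simp: divide_inverse power2_eq_square)
    ultimately have "((\<lambda>x. exp (- 1 / x) * inverse (x ^ k)) has_real_derivative
        exp (- 1 / s) * inverse s ^ 2 * inverse (s ^ k) + - real k * inverse s ^ (k + 1) * exp (- 1 / s)) (at s)"
      by (rule DERIV_mult[rotated])
    moreover have "exp (- 1 / s) * inverse s ^ 2 * inverse (s ^ k) + - real k * inverse s ^ (k + 1) * exp (- 1 / s)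
        = - real k * flat_exp (k + 1) s + flat_exp (k + 2) s"
      using greater by (simp add: flat_exp_def divide_inverse power_inverse power_add power2_eq_square mult_ac)
    ultimately show ?thesis by simp
  qed
  ultimately show ?thesis
    by (subst DERIV_cong_ev[where g = "\<lambda>x. exp (- 1 / x) * inverse (x ^ k)" and y = s]) auto
next
  case equal
  have "((\<lambda>h. (flat_exp k (0 + h) - flat_exp k 0) / h) \<longlongrightarrow> 0) (at 0)"
  proof (rule Lim_null_comparison)
    show "eventually (\<lambda>h. norm ((flat_exp k (0 + h) - flat_exp k 0) / h) \<le> fact (k + 2) * \<bar>h\<bar>) (at 0)"
    proof (intro always_eventually allI)
      fix h :: real
      have "flat_exp k h \<le> fact (k + 2) * \<bar>h\<bar> * \<bar>h\<bar>"
        using flat_exp_le_quadratic[of k h] by (simp add: power2_eq_square mult.assoc)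
      then show "norm ((flat_exp k (0 + h) - flat_exp k 0) / h) \<le> fact (k + 2) * \<bar>h\<bar>"
        using flat_exp_nonneg[of k h] by (cases "h = 0") (simp_all add: flat_exp_def[of k 0] divide_le_eq del: fact_Suc)
    qed
    show "((\<lambda>h. fact (k + 2) * \<bar>h\<bar>) \<longlongrightarrow> (0 :: real)) (at 0)"
      by (intro tendsto_eq_intros) auto
  qed
  then show ?thesis using equal by (simp add: DERIV_def flat_exp_def[of _ 0])
qed

text \<open>A class of functions that contains the bump and is closed under partial derivatives; membership
alone then yields derivatives of all orders.\<close>

inductive bump_algebra :: "real \<Rightarrow> 'a::euclidean_space \<Rightarrow> ('a \<Rightarrow> real) \<Rightarrow> bool" for a p where
  const: "bump_algebra a p (\<lambda>z. c)"
| coord: "bump_algebra a p (\<lambda>z. (z - p) \<bullet> v)"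
| bump: "bump_algebra a p (\<lambda>z. flat_exp k (1 - a * ((z - p) \<bullet> (z - p))))"
| add: "bump_algebra a p \<phi> \<Longrightarrow> bump_algebra a p \<psi> \<Longrightarrow> bump_algebra a p (\<lambda>z. \<phi> z + \<psi> z)"
| mult: "bump_algebra a p \<phi> \<Longrightarrow> bump_algebra a p \<psi> \<Longrightarrow> bump_algebra a p (\<lambda>z. \<phi> z * \<psi> z)"

lemma has_derivative_flat_exp_ball:
  fixes p :: "'a::euclidean_space"
  shows "((\<lambda>z. flat_exp k (1 - a * ((z - p) \<bullet> (z - p)))) has_derivative
    (\<lambda>v. (- real k * flat_exp (k + 1) (1 - a * ((z - p) \<bullet> (z - p)))
        + flat_exp (k + 2) (1 - a * ((z - p) \<bullet> (z - p)))) * (- 2 * a * ((z - p) \<bullet> v)))) (at z)"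
proof -
  have "((\<lambda>z. 1 - a * ((z - p) \<bullet> (z - p))) has_derivative (\<lambda>v. - 2 * a * ((z - p) \<bullet> v))) (at z)"
    by (auto intro!: derivative_eq_intros simp: inner_commute algebra_simps)
  from has_derivative_compose[OF this DERIV_flat_exp[unfolded has_field_derivative_def]]
  show ?thesis .
qed

lemma bump_algebra_has_derivative:
  assumes "bump_algebra a p \<phi>"
  shows "\<exists>\<phi>'. (\<forall>z. (\<phi> has_derivative \<phi>' z) (at z)) \<and> (\<forall>v. bump_algebra a p (\<lambda>z. \<phi>' z v))"
  using assms
proof induction
  case (const c)
  show ?case
    by (rule exI[of _ "\<lambda>_ _. 0"]) (auto intro: bump_algebra.const)
next
  case (coord v)
  show ?case
    by (rule exI[of _ "\<lambda>_ u. u \<bullet> v"]) (auto intro!: derivative_eq_intros bump_algebra.const)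
next
  case (bump k)
  show ?case
    by (rule exI, intro conjI allI, rule has_derivative_flat_exp_ball)
      (intro bump_algebra.intros)
next
  case (add \<phi> \<psi>)
  then obtain \<phi>' \<psi>' where *: "\<And>z. (\<phi> has_derivative \<phi>' z) (at z)" "\<And>v. bump_algebra a p (\<lambda>z. \<phi>' z v)"
    "\<And>z. (\<psi> has_derivative \<psi>' z) (at z)" "\<And>v. bump_algebra a p (\<lambda>z. \<psi>' z v)" by blast
  show ?case
    by (rule exI[of _ "\<lambda>z v. \<phi>' z v + \<psi>' z v"])
      (intro conjI allI has_derivative_add * bump_algebra.intros)
next
  case (mult \<phi> \<psi>)
  then obtain \<phi>' \<psi>' where *: "\<And>z. (\<phi> has_derivative \<phi>' z) (at z)" "\<And>v. bump_algebra a p (\<lambda>z. \<phi>' z v)"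
    "\<And>z. (\<psi> has_derivative \<psi>' z) (at z)" "\<And>v. bump_algebra a p (\<lambda>z. \<psi>' z v)" by blast
  show ?case
    by (rule exI[of _ "\<lambda>z v. \<phi> z * \<psi>' z v + \<phi>' z v * \<psi> z"])
      (intro conjI allI has_derivative_mult * bump_algebra.intros mult.hyps)
qed

lemma bump_algebra_Ck_fun:
  assumes "bump_algebra a p \<phi>"
  shows "Ck_fun k \<phi>"
  using assms
proof (induction k arbitrary: \<phi>)
  case 0
  obtain \<phi>' where "\<And>z. (\<phi> has_derivative \<phi>' z) (at z)"
    using bump_algebra_has_derivative[OF 0] by blast
  then show ?case
    by (auto intro!: continuous_at_imp_continuous_on has_derivative_continuous)
next
  case (Suc k)
  obtain \<phi>' where d: "\<And>z. (\<phi> has_derivative \<phi>' z) (at z)" and b: "\<And>v. bump_algebra a p (\<lambda>z. \<phi>' z v)"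
    using bump_algebra_has_derivative[OF Suc.prems] by blast
  have "(\<lambda>z. frechet_derivative \<phi> (at z) v) = (\<lambda>z. \<phi>' z v)" for v
    using frechet_derivative_at[OF d] by auto
  then show ?case
    using Suc.IH[OF b] d by (auto simp: differentiable_def)
qed

definition bump_kernel :: "real \<Rightarrow> 'a::euclidean_space \<Rightarrow> real" where
  "bump_kernel r v = flat_exp 0 (1 - (1 / r\<^sup>2) * (v \<bullet> v))"

definition bump_kernel_grad :: "real \<Rightarrow> 'a::euclidean_space \<Rightarrow> 'a" where
  "bump_kernel_grad r v = (flat_exp 2 (1 - (1 / r\<^sup>2) * (v \<bullet> v)) * (- 2 * (1 / r\<^sup>2))) *\<^sub>R v"

lemma bump_kernel_nonneg: "0 \<le> bump_kernel r v"
  by (simp add: bump_kernel_def flat_exp_nonneg)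

lemma bump_kernel_le_1: "bump_kernel r v \<le> 1"
  by (simp add: bump_kernel_def flat_exp_def)

lemma bump_kernel_nonzero_iff: "0 < r \<Longrightarrow> bump_kernel r v \<noteq> 0 \<longleftrightarrow> norm v < r"
proof -
  assume r: "0 < r"
  have "bump_kernel r v \<noteq> 0 \<longleftrightarrow> (norm v)\<^sup>2 < r\<^sup>2"
    using r by (simp add: bump_kernel_def flat_exp_def dot_square_norm field_simps)
  also have "\<dots> \<longleftrightarrow> norm v < r" using r by (simp add: power_mono_iff flip: not_le)
  finally show ?thesis .
qed

lemma bump_kernel_ge:
  assumes "0 < r" "norm v \<le> r / 2"
  shows "exp (- 4 / 3) \<le> bump_kernel r v"
proof -
  have "(norm v)\<^sup>2 \<le> (r / 2)\<^sup>2" using assms by (intro power_mono) auto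
  then have *: "3 / 4 \<le> 1 - (1 / r\<^sup>2) * (v \<bullet> v)"
    using assms by (simp add: dot_square_norm field_simps)
  moreover have "- 4 / 3 \<le> - 1 / (1 - (1 / r\<^sup>2) * (v \<bullet> v))"
  proof -
    have "- 4 / 3 \<le> - 1 / q" if "3 / 4 \<le> q" for q :: real
      using that by (simp add: field_simps)
    from this[OF *] show ?thesis .
  qed
  moreover have "0 < 1 - (1 / r\<^sup>2) * (v \<bullet> v)"
    using * by linarith
  ultimately show ?thesis unfolding bump_kernel_def flat_exp_def by simp
qed

lemma GDERIV_bump_kernel: "GDERIV (bump_kernel r) v :> bump_kernel_grad r v"
  using has_derivative_flat_exp_ball[of 0 "1 / r\<^sup>2" 0 v]
  unfolding gderiv_def bump_kernel_def[abs_def] bump_kernel_grad_def by (simp add: mult_ac inner_commute numeral_2_eq_2)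

lemma continuous_on_flat_exp: "continuous_on A (flat_exp k)"
  using DERIV_flat_exp by (meson DERIV_isCont continuous_at_imp_continuous_on)

lemma continuous_on_bump_kernel: "continuous_on A (bump_kernel r)"
  unfolding bump_kernel_def by (intro continuous_on_compose2[OF continuous_on_flat_exp] continuous_intros) auto

lemma continuous_on_bump_kernel_grad: "continuous_on A (bump_kernel_grad r)"
  unfolding bump_kernel_grad_def
  by (intro continuous_intros continuous_on_compose2[OF continuous_on_flat_exp]) auto

lemma bump_kernel_grad_bounded:
  assumes "0 < r" 
  obtains B where "\<And>v::'a::euclidean_space. norm (bump_kernel_grad r v) \<le> B"
proof -
  have "compact (bump_kernel_grad r ` cball (0::'a) r)"
    by (intro compact_continuous_image continuous_on_bump_kernel_grad) simp
  then obtain B where B: "\<And>v. v \<in> cball (0::'a) r \<Longrightarrow> norm (bump_kernel_grad r v) \<le> B"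
    using compact_imp_bounded bounded_iff by (metis imageI)
  have "norm (bump_kernel_grad r v) \<le> max 0 B" for v :: 'a
  proof (cases "norm v \<le> r")
    case True
    then show ?thesis using B[of v] by auto
  next
    case False
    then have "r\<^sup>2 \<le> v \<bullet> v" using assms unfolding dot_square_norm by (intro power_mono) auto
    then have "flat_exp 2 (1 - (1 / r\<^sup>2) * (v \<bullet> v)) = 0" using assms by (simp add: flat_exp_def field_simps)
    then show ?thesis by (simp add: bump_kernel_grad_def)
  qed
  then show ?thesis by (rule that)
qed

lemma bump_kernel_lipschitz:
  assumes "0 < r"
  obtains B where "0 \<le> B" "\<And>u v::'a::euclidean_space. \<bar>bump_kernel r u - bump_kernel r v\<bar> \<le> B * norm (u - v)"
proof -
  obtain B where B: "\<And>v::'a. norm (bump_kernel_grad r v) \<le> B"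
    using bump_kernel_grad_bounded[OF assms, where ?'a = 'a] by blast
  have "norm (bump_kernel r u - bump_kernel r v) \<le> B * norm (u - v)" for u v :: 'a
  proof (rule differentiable_bound[of UNIV "bump_kernel r" "\<lambda>v h. h \<bullet> bump_kernel_grad r v"])
    show "(bump_kernel r has_derivative (\<lambda>h. h \<bullet> bump_kernel_grad r x)) (at x within UNIV)" for x :: 'a
      using GDERIV_bump_kernel[of r x] by (simp add: gderiv_def)
    show "onorm (\<lambda>h. h \<bullet> bump_kernel_grad r x) \<le> B" for x :: 'a
    proof (rule onorm_bound)
      show "0 \<le> B" using B norm_ge_zero order_trans by blast
      fix h :: 'a
      have "\<bar>h \<bullet> bump_kernel_grad r x\<bar> \<le> norm h * norm (bump_kernel_grad r x)"
        by (rule Cauchy_Schwarz_ineq2)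
      also have "\<dots> \<le> norm h * B" using B by (intro mult_left_mono) auto
      finally show "norm (h \<bullet> bump_kernel_grad r x) \<le> B * norm h" by (simp add: mult.commute)
    qed
  qed auto
  moreover have "0 \<le> B" using B norm_ge_zero order_trans by blast
  ultimately show ?thesis by (intro that[of B]) auto
qed

text \<open>The closed support is contained in the closed ball, which also makes it compact.\<close>

lemma bump_kernel_test_function:
  fixes p :: "'a::euclidean_space"
  assumes r: "0 < r" and sub: "cball p r \<subseteq> \<Omega>"
  shows "test_function \<Omega> (\<lambda>z. bump_kernel r (z - p))"
proof -
  have supp: "closure {z. bump_kernel r (z - p) \<noteq> 0} \<subseteq> cball p r"
    using r by (intro closure_minimal) (auto simp: bump_kernel_nonzero_iff dist_norm norm_minus_commute)
  then have "compact (closure {z. bump_kernel r (z - p) \<noteq> 0})"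
    by (meson bounded_cball bounded_subset closed_closure compact_eq_bounded_closed)
  moreover have "Ck_fun k (\<lambda>z. bump_kernel r (z - p))" for k
    unfolding bump_kernel_def by (rule bump_algebra_Ck_fun[OF bump_algebra.bump])
  ultimately show ?thesis
    unfolding test_function_def using supp sub by blast
qed

lemma partial_deriv_bump_kernel:
  "partial_deriv b (\<lambda>z. bump_kernel r (z - p)) z = bump_kernel_grad r (z - p) \<bullet> b"
proof -
  have "((\<lambda>z. z - p) has_derivative (\<lambda>h. h)) (at z)"
    by (auto intro!: derivative_eq_intros)
  from has_derivative_compose[OF this GDERIV_bump_kernel[unfolded gderiv_def]]
  have "((\<lambda>z. bump_kernel r (z - p)) has_derivative (\<lambda>h. h \<bullet> bump_kernel_grad r (z - p))) (at z)" .
  from frechet_derivative_at[OF this]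
  have "frechet_derivative (\<lambda>z. bump_kernel r (z - p)) (at z) b = b \<bullet> bump_kernel_grad r (z - p)"
    by (rule fun_cong[OF sym])
  then show ?thesis by (simp only: inner_commute)
qed

section \<open>Mollifying a function with a weak gradient\<close>

lemma borel_measurable_lebesgue_on_continuous:
  fixes h :: "'a::euclidean_space \<Rightarrow> 'b::euclidean_space"
  assumes "open \<Omega>" "continuous_on \<Omega> h"
  shows "h \<in> borel_measurable (lebesgue_on \<Omega>)"
  using assms by (intro continuous_imp_measurable_on_sets_lebesgue) auto

lemma borel_measurable_bump_kernel_shift:
  assumes "open \<Omega>"
  shows "(\<lambda>z. bump_kernel r (z - p)) \<in> borel_measurable (lebesgue_on \<Omega>)"
  by (intro borel_measurable_lebesgue_on_continuous[OF assms]
      continuous_on_compose2[OF continuous_on_bump_kernel[of UNIV]] continuous_intros) auto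

lemma borel_measurable_bump_kernel_grad_shift:
  assumes "open \<Omega>"
  shows "(\<lambda>z. bump_kernel_grad r (z - p) \<bullet> v) \<in> borel_measurable (lebesgue_on \<Omega>)"
  by (intro borel_measurable_lebesgue_on_continuous[OF assms] continuous_on_inner
      continuous_on_compose2[OF continuous_on_bump_kernel_grad[of UNIV]] continuous_intros) auto

lemma integrable_mult_bounded:
  fixes g h :: "'a \<Rightarrow> real"
  assumes "integrable M g" "h \<in> borel_measurable M" "\<And>x. \<bar>h x\<bar> \<le> C"
  shows "integrable M (\<lambda>x. g x * h x)"
proof (rule Bochner_Integration.integrable_bound[of M "\<lambda>x. C * g x"])
  show "AE x in M. norm (g x * h x) \<le> norm (C * g x)"
  proof (rule AE_I2)
    fix x
    have "\<bar>g x\<bar> * \<bar>h x\<bar> \<le> \<bar>g x\<bar> * \<bar>C\<bar>"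
      using assms(3)[of x] by (intro mult_left_mono) auto
    then show "norm (g x * h x) \<le> norm (C * g x)" by (simp add: abs_mult mult.commute)
  qed
qed (use assms in auto)

text \<open>Differentiation under the integral sign in the centre of the kernel. The difference quotients of the
kernel are bounded by its Lipschitz constant, so dominated convergence applies although \<open>g\<close> is merely
integrable.\<close>

lemma mollification_has_derivative:
  fixes g :: "'a::euclidean_space \<Rightarrow> real"
  assumes \<Omega>: "open \<Omega>" and g: "integrable (lebesgue_on \<Omega>) g" and r: "0 < r"
  shows "((\<lambda>p. LINT z|lebesgue_on \<Omega>. g z * bump_kernel r (z - p)) has_derivative
    (\<lambda>v. - (LINT z|lebesgue_on \<Omega>. g z * (bump_kernel_grad r (z - p) \<bullet> v)))) (at p)"
proof -
  let ?M = "lebesgue_on \<Omega>"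
  let ?K = "bump_kernel r :: 'a \<Rightarrow> real" and ?G = "bump_kernel_grad r :: 'a \<Rightarrow> 'a"
  obtain B where B: "\<And>v. norm (?G v) \<le> B"
    using bump_kernel_grad_bounded[OF r, where ?'a = 'a] by blast
  obtain C where C: "0 \<le> C" "\<And>u v. \<bar>?K u - ?K v\<bar> \<le> C * norm (u - v)"
    using bump_kernel_lipschitz[OF r, where ?'a = 'a] by blast
  have B0: "0 \<le> B" using B norm_ge_zero order_trans by blast
  have Gv: "\<bar>?G u \<bullet> v\<bar> \<le> B * norm v" for u v
    using Cauchy_Schwarz_ineq2[of "?G u" v] B[of u] by (meson mult_right_mono norm_ge_zero order_trans)
  have intK: "integrable ?M (\<lambda>z. g z * ?K (z - q))" for q
    by (rule integrable_mult_bounded[OF g borel_measurable_bump_kernel_shift[OF \<Omega>], where C = 1])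
      (simp add: bump_kernel_nonneg bump_kernel_le_1)
  have intG: "integrable ?M (\<lambda>z. g z * (?G (z - q) \<bullet> v))" for q v
    by (rule integrable_mult_bounded[OF g borel_measurable_bump_kernel_grad_shift[OF \<Omega>] Gv])
  define D where "D v = - (LINT z|?M. g z * (?G (z - p) \<bullet> v))" for v
  have lin: "bounded_linear D"
  proof (rule bounded_linear_intro)
    show "D (u + v) = D u + D v" for u v
      unfolding D_def by (simp add: inner_add_right distrib_left intG)
    show "D (c *\<^sub>R v) = c *\<^sub>R D v" for c v
      unfolding D_def by (simp add: mult.left_commute)
    show "norm (D v) \<le> norm v * (B * (LINT z|?M. \<bar>g z\<bar>))" for v
    proof -
      have "norm (D v) \<le> (LINT z|?M. \<bar>g z * (?G (z - p) \<bullet> v)\<bar>)"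
        unfolding D_def using integral_norm_bound[of ?M "\<lambda>z. g z * (?G (z - p) \<bullet> v)"] by simp
      also have "\<dots> \<le> (LINT z|?M. \<bar>g z\<bar> * (B * norm v))"
      proof (rule integral_mono)
        show "\<bar>g z * (?G (z - p) \<bullet> v)\<bar> \<le> \<bar>g z\<bar> * (B * norm v)" for z
          using Gv[of "z - p" v] by (simp add: abs_mult mult_left_mono)
      qed (use integrable_abs[OF intG] g in auto)
      finally show ?thesis by (simp add: mult_ac)
    qed
  qed
  define U where "U q = (LINT z|?M. g z * ?K (z - q))" for q
  have "((\<lambda>h. norm (U (p + h) - U p - D h) / norm h) \<longlongrightarrow> 0) (at 0)"
    unfolding tendsto_at_iff_sequentially
  proof (intro allI impI)
    fix H :: "nat \<Rightarrow> 'a" assume H0: "\<forall>i. H i \<in> UNIV - {0}" and H: "H \<longlonglongrightarrow> 0"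
    define R where "R i z = (?K (z - p - H i) - ?K (z - p) + ?G (z - p) \<bullet> H i) / norm (H i)" for i z
    have Rb: "\<bar>R i z\<bar> \<le> C + B" for i z
    proof -
      have "\<bar>?K (z - p - H i) - ?K (z - p) + ?G (z - p) \<bullet> H i\<bar> \<le> C * norm (H i) + B * norm (H i)"
        using C(2)[of "z - p - H i" "z - p"] Gv[of "z - p" "H i"] by (simp add: norm_minus_commute)
      then show ?thesis using H0 by (simp add: R_def divide_le_eq algebra_simps)
    qed
    have Rmeas: "R i \<in> borel_measurable ?M" for i
      unfolding R_def diff_diff_eq
      by (intro borel_measurable_divide borel_measurable_add borel_measurable_diff
          borel_measurable_bump_kernel_shift borel_measurable_bump_kernel_grad_shift \<Omega>) auto
    have Rlim: "(\<lambda>i. R i z) \<longlonglongrightarrow> 0" for z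
    proof -
      have "((\<lambda>h. norm (?K (z - p + h) - ?K (z - p) - h \<bullet> ?G (z - p)) / norm h) \<longlongrightarrow> 0) (at 0)"
        using GDERIV_bump_kernel[of r "z - p"] unfolding gderiv_def has_derivative_at by blast
      moreover have "(\<lambda>i. - H i) \<longlonglongrightarrow> 0" using tendsto_minus[OF H] by simp
      ultimately have "(\<lambda>i. norm (?K (z - p + - H i) - ?K (z - p) - (- H i) \<bullet> ?G (z - p)) / norm (- H i)) \<longlonglongrightarrow> 0"
        using H0 unfolding tendsto_at_iff_sequentially comp_def by (auto elim!: allE[of _ "\<lambda>i. - H i"])
      then show ?thesis
        by (subst tendsto_rabs_zero_iff[symmetric]) (simp add: R_def inner_commute)
    qed
    have int: "integrable ?M (\<lambda>z. g z * R i z)" for i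
      by (rule integrable_mult_bounded[OF g Rmeas Rb])
    have "(\<lambda>i. LINT z|?M. g z * R i z) \<longlonglongrightarrow> (LINT z|?M. 0)"
    proof (rule integral_dominated_convergence[where w = "\<lambda>z. \<bar>g z\<bar> * (C + B)"])
      show "AE z in ?M. (\<lambda>i. g z * R i z) \<longlonglongrightarrow> 0"
        by (intro AE_I2 tendsto_mult_right_zero Rlim)
      show "AE z in ?M. norm (g z * R i z) \<le> \<bar>g z\<bar> * (C + B)" for i
        by (intro AE_I2) (auto simp: abs_mult intro!: mult_left_mono Rb)
    qed (use g int in auto)
    moreover have "(LINT z|?M. g z * R i z) = (U (p + H i) - U p - D (H i)) / norm (H i)" for i
    proof -
      have "(U (p + H i) - U p - D (H i)) / norm (H i) =
        (LINT z|?M. (g z * ?K (z - (p + H i)) - g z * ?K (z - p) + g z * (?G (z - p) \<bullet> H i)) / norm (H i))"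
        unfolding U_def D_def by (simp add: intK intG)
      also have "\<dots> = (LINT z|?M. g z * R i z)"
        by (rule Bochner_Integration.integral_cong) (simp_all add: R_def algebra_simps diff_diff_eq)
      finally show ?thesis ..
    qed
    ultimately have "(\<lambda>i. \<bar>(U (p + H i) - U p - D (H i)) / norm (H i)\<bar>) \<longlonglongrightarrow> 0"
      by (intro tendsto_rabs_zero) simp
    then show "((\<lambda>h. norm (U (p + h) - U p - D h) / norm h) \<circ> H) \<longlonglongrightarrow> 0"
      by (simp add: comp_def abs_divide)
  qed
  then show ?thesis
    using lin unfolding has_derivative_at U_def D_def by blast
qed

text \<open>The definition of the weak gradient for the kernel as test function, extended from basis directions
to all directions by linearity.\<close>

lemma weak_gradient_bump_kernel:
  fixes g :: "'a::euclidean_space \<Rightarrow> real"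
  assumes \<Omega>: "open \<Omega>" and wg: "has_weak_gradient \<Omega> g G"
    and g: "integrable (lebesgue_on \<Omega>) g"
    and G: "integrable (lebesgue_on \<Omega>) G"
    and r: "0 < r" and sub: "cball p r \<subseteq> \<Omega>"
  shows "- (LINT z|lebesgue_on \<Omega>. g z * (bump_kernel_grad r (z - p) \<bullet> v))
    = (LINT z|lebesgue_on \<Omega>. (G z \<bullet> v) * bump_kernel r (z - p))"
proof -
  let ?M = "lebesgue_on \<Omega>"
  obtain B where B: "\<And>v::'a. norm (bump_kernel_grad r v) \<le> B"
    using bump_kernel_grad_bounded[OF r, where ?'a = 'a] by blast
  have Gv: "\<bar>bump_kernel_grad r u \<bullet> b\<bar> \<le> B" if "b \<in> Basis" for u b :: 'a
    using Basis_le_norm[OF that, of "bump_kernel_grad r u"] B[of u] by simp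
  have int1: "integrable ?M (\<lambda>z. g z * (bump_kernel_grad r (z - p) \<bullet> b))" if "b \<in> Basis" for b
    by (rule integrable_mult_bounded[OF g borel_measurable_bump_kernel_grad_shift[OF \<Omega>] Gv[OF that]])
  have int2: "integrable ?M (\<lambda>z. (G z \<bullet> b) * bump_kernel r (z - p))" for b
    by (rule integrable_mult_bounded[OF _ borel_measurable_bump_kernel_shift[OF \<Omega>], where C = 1])
      (use G in \<open>auto simp: bump_kernel_nonneg bump_kernel_le_1\<close>)
  have basis: "(LINT z|?M. g z * (bump_kernel_grad r (z - p) \<bullet> b)) = - (LINT z|?M. (G z \<bullet> b) * bump_kernel r (z - p))"
    if "b \<in> Basis" for b
  proof -
    have "\<forall>b\<in>Basis. (LINT z|?M. g z * partial_deriv b (\<lambda>z. bump_kernel r (z - p)) z)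
        = - (LINT z|?M. (G z \<bullet> b) * bump_kernel r (z - p))"
      using wg bump_kernel_test_function[OF r sub] unfolding has_weak_gradient_def by blast
    then show ?thesis using that unfolding partial_deriv_bump_kernel by blast
  qed
  have "(LINT z|?M. g z * (bump_kernel_grad r (z - p) \<bullet> v))
    = (LINT z|?M. (\<Sum>b\<in>Basis. (v \<bullet> b) * (g z * (bump_kernel_grad r (z - p) \<bullet> b))))"
    by (rule Bochner_Integration.integral_cong)
      (simp_all add: euclidean_inner[of _ v] sum_distrib_left mult_ac)
  also have "\<dots> = (\<Sum>b\<in>Basis. (v \<bullet> b) * (LINT z|?M. g z * (bump_kernel_grad r (z - p) \<bullet> b)))"
    using int1 by (subst Bochner_Integration.integral_sum) auto
  also have "\<dots> = (\<Sum>b\<in>Basis. - ((v \<bullet> b) * (LINT z|?M. (G z \<bullet> b) * bump_kernel r (z - p))))"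
    using basis by (intro sum.cong) auto
  also have "\<dots> = - (LINT z|?M. (\<Sum>b\<in>Basis. (v \<bullet> b) * ((G z \<bullet> b) * bump_kernel r (z - p))))"
    using int2 by (subst Bochner_Integration.integral_sum) (auto simp: sum_negf)
  also have "(LINT z|?M. (\<Sum>b\<in>Basis. (v \<bullet> b) * ((G z \<bullet> b) * bump_kernel r (z - p))))
     = (LINT z|?M. (G z \<bullet> v) * bump_kernel r (z - p))"
    by (rule Bochner_Integration.integral_cong)
      (simp_all add: euclidean_inner[of _ v] sum_distrib_left mult_ac)
  finally show ?thesis by simp
qed

text \<open>The type argument fixes the space on which the kernel lives, as the value does not show it.\<close>

definition bump_mass :: "'a::euclidean_space itself \<Rightarrow> real \<Rightarrow> real" where
  "bump_mass _ r = (LINT z|lebesgue. bump_kernel r (z::'a))"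

lemma bump_kernel_integral_shift:
  fixes p :: "'a::euclidean_space"
  assumes r: "0 < r"
  shows "integrable lebesgue (\<lambda>z. bump_kernel r (z - p))"
    and "(LINT z|lebesgue. bump_kernel r (z - p)) = bump_mass TYPE('a) r"
proof -
  have meas: "(\<lambda>z::'a. bump_kernel r (z - q)) \<in> borel_measurable borel" for q
    by (intro borel_measurable_continuous_onI continuous_on_compose2[OF continuous_on_bump_kernel[of UNIV]] continuous_intros) auto
  have "integrable lborel (indicator (cball p r) :: 'a \<Rightarrow> real)"
    by (simp add: integrable_indicator_iff emeasure_cball r less_imp_le)
  then have "integrable lborel (\<lambda>z. bump_kernel r (z - p))"
  proof (rule Bochner_Integration.integrable_bound)
    show "AE z in lborel. norm (bump_kernel r (z - p)) \<le> norm (indicator (cball p r) z :: real)"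
    proof (rule AE_I2)
      fix z :: 'a
      show "norm (bump_kernel r (z - p)) \<le> norm (indicator (cball p r) z :: real)"
        using bump_kernel_nonzero_iff[OF r, of "z - p"] bump_kernel_nonneg[of r "z - p"] bump_kernel_le_1[of r "z - p"]
        by (auto simp: indicator_def dist_norm norm_minus_commute)
    qed
  qed (use meas in simp)
  then show "integrable lebesgue (\<lambda>z. bump_kernel r (z - p))"
    by (simp add: integrable_completion meas)
  have "(LINT z|lebesgue. bump_kernel r (z - p)) = (LINT z|lborel. bump_kernel r (z - p))"
    using meas[of p] by (intro integral_completion) simp
  also have "\<dots> = (LINT z|distr lborel borel ((+) p). bump_kernel r (z - p))"
    by (simp add: lborel_distr_plus)
  also have "\<dots> = (LINT z|lborel. bump_kernel r ((p + z) - p))"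
    using meas[of p] by (intro integral_distr) simp_all
  also have "\<dots> = (LINT z|lebesgue. bump_kernel r (z :: 'a))"
    using meas[of 0] by (subst integral_completion) simp_all
  finally show "(LINT z|lebesgue. bump_kernel r (z - p)) = bump_mass TYPE('a) r"
    unfolding bump_mass_def .
qed

lemma bump_mass_ge:
  assumes r: "0 < r"
  shows "exp (- 4 / 3) * (unit_ball_vol DIM('a) * (r / 2) ^ DIM('a)) \<le> bump_mass TYPE('a::euclidean_space) r"
proof -
  have "exp (- 4 / 3) * (unit_ball_vol DIM('a) * (r / 2) ^ DIM('a))
      = (LINT z|lebesgue. exp (- 4 / 3) * indicator (cball (0::'a) (r / 2)) z)"
    using r by (simp add: content_cball)
  also have "\<dots> \<le> (LINT z|lebesgue. bump_kernel r (z::'a))"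
  proof (rule integral_mono)
    show "integrable lebesgue (\<lambda>z. exp (- 4 / 3) * indicator (cball (0::'a) (r / 2)) z :: real)"
      using r by (simp add: integrable_indicator_iff emeasure_cball)
    show "integrable lebesgue (\<lambda>z::'a. bump_kernel r z)"
      using bump_kernel_integral_shift(1)[OF r, of 0] by simp
    show "exp (- 4 / 3) * indicator (cball (0::'a) (r / 2)) z \<le> bump_kernel r z" for z :: 'a
      using bump_kernel_ge[OF r, of z] bump_kernel_nonneg[of r z] by (simp add: indicator_def)
  qed
  finally show ?thesis unfolding bump_mass_def .
qed

lemma bump_mass_pos: "0 < r \<Longrightarrow> 0 < bump_mass TYPE('a::euclidean_space) r"
  using bump_mass_ge[where ?'a = 'a, of r] by (rule less_le_trans[rotated]) simp_all

lemma integral_bump_kernel_on: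
  fixes p :: "'a::euclidean_space"
  assumes \<Omega>: "open \<Omega>" and r: "0 < r" and sub: "cball p r \<subseteq> \<Omega>"
  shows "(LINT z|lebesgue_on \<Omega>. bump_kernel r (z - p)) = bump_mass TYPE('a) r"
proof -
  have "(LINT z|lebesgue_on \<Omega>. bump_kernel r (z - p)) = (LINT z|lebesgue. indicator \<Omega> z * bump_kernel r (z - p))"
    using \<Omega> by (simp add: integral_restrict_space)
  also have "\<dots> = (LINT z|lebesgue. bump_kernel r (z - p))"
  proof (rule Bochner_Integration.integral_cong)
    fix z
    have "z \<notin> \<Omega> \<Longrightarrow> bump_kernel r (z - p) = 0"
      using bump_kernel_nonzero_iff[OF r, of "z - p"] sub by (auto simp: subset_iff dist_norm norm_minus_commute)
    then show "indicator \<Omega> z * bump_kernel r (z - p) = bump_kernel r (z - p)" by (auto simp: indicator_def)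
  qed simp
  finally show ?thesis using bump_kernel_integral_shift(2)[OF r] by simp
qed

text \<open>The derivative of the mollification along the solution is the integral of \<open>G z \<bullet> f (y s)\<close> against the
kernel, whereas the hypothesis controls \<open>G z \<bullet> f z\<close>. The kernel lives within distance
\<open>r + norm q\<close> of \<open>y s\<close>, so the discrepancy is at most \<open>L * M * (r + norm q)\<close> times the mass, and the resulting
linear differential inequality is integrated. The offset \<open>q\<close> allows kernels that are not centred at the
solution.\<close>

lemma mollified_growth_along_solution:
  fixes g :: "'a::euclidean_space \<Rightarrow> real" and y :: "real \<Rightarrow> 'a"
  assumes \<Omega>: "open \<Omega>" and f: "L-lipschitz_on \<Omega> f"
    and wg: "has_weak_gradient \<Omega> g G"
    and g: "integrable (lebesgue_on \<Omega>) g" and G: "integrable (lebesgue_on \<Omega>) G"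
    and M: "0 \<le> M" and Gb: "AE z in lebesgue_on \<Omega>. norm (G z) \<le> M"
    and dec: "AE z in lebesgue_on \<Omega>. f z \<bullet> G z \<le> \<omega> * g z" and \<omega>: "\<omega> \<le> 0"
    and t: "0 \<le> t"
    and y: "\<And>s. 0 \<le> s \<Longrightarrow> s \<le> t \<Longrightarrow> (y has_vector_derivative f (y s)) (at s within {0..})"
    and y_in: "\<And>s. 0 \<le> s \<Longrightarrow> s \<le> t \<Longrightarrow> y s \<in> \<Omega>"
    and r: "0 < r" and sub: "\<And>s. 0 \<le> s \<Longrightarrow> s \<le> t \<Longrightarrow> cball (y s + q) r \<subseteq> \<Omega>"
  shows "(LINT z|lebesgue_on \<Omega>. g z * bump_kernel r (z - (y t + q)))
    \<le> exp (\<omega> * t) * (LINT z|lebesgue_on \<Omega>. g z * bump_kernel r (z - (y 0 + q)))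
      + t * (L * M * (r + norm q) * bump_mass TYPE('a) r)"
proof -
  let ?M = "lebesgue_on \<Omega>"
  define U where "U p = (LINT z|?M. g z * bump_kernel r (z - p))" for p
  define u where "u s = U (y s + q)" for s
  define u' where "u' s = (LINT z|?M. (G z \<bullet> f (y s)) * bump_kernel r (z - (y s + q)))" for s
  define \<kappa> where "\<kappa> = L * M * (r + norm q) * bump_mass TYPE('a) r"
  have L: "0 \<le> L" using f by (rule lipschitz_on_nonneg)
  have dU: "(U has_derivative (\<lambda>v. LINT z|?M. (G z \<bullet> v) * bump_kernel r (z - p))) (at p)"
    if "cball p r \<subseteq> \<Omega>" for p
    using mollification_has_derivative[OF \<Omega> g r, of p] weak_gradient_bump_kernel[OF \<Omega> wg g G r that]
    unfolding U_def by simp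
  have du: "(u has_real_derivative u' s) (at s within {0..})" if s: "0 \<le> s" "s \<le> t" for s
  proof -
    have "((\<lambda>s. y s + q) has_derivative (\<lambda>h. h *\<^sub>R f (y s))) (at s within {0..})"
      using y[OF s] unfolding has_vector_derivative_def by (auto intro!: derivative_eq_intros)
    from has_derivative_compose[OF this dU[OF sub[OF s]]]
    have "(u has_derivative (\<lambda>h. LINT z|?M. (G z \<bullet> (h *\<^sub>R f (y s))) * bump_kernel r (z - (y s + q)))) (at s within {0..})"
      unfolding u_def[abs_def] .
    moreover have "(\<lambda>h. LINT z|?M. (G z \<bullet> (h *\<^sub>R f (y s))) * bump_kernel r (z - (y s + q))) = (*) (u' s)"
      unfolding u'_def by (rule ext) (simp add: mult.assoc mult.commute[of _ "_ :: real"] flip: integral_mult_right_zero)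
    ultimately show ?thesis unfolding has_field_derivative_def by simp
  qed
  have u'_le: "u' s \<le> \<omega> * u s + \<kappa>" if s: "0 \<le> s" "s \<le> t" for s
  proof -
    let ?K = "\<lambda>z. bump_kernel r (z - (y s + q))"
    have intK: "integrable ?M (\<lambda>z. h z * ?K z)" if "integrable ?M h" for h
      by (rule integrable_mult_bounded[OF that borel_measurable_bump_kernel_shift[OF \<Omega>], where C = 1])
        (simp add: bump_kernel_nonneg bump_kernel_le_1)
    have intK1: "integrable ?M ?K"
      using integrable_mult_indicator[OF _ bump_kernel_integral_shift(1)[OF r], of \<Omega>] \<Omega>
      by (simp add: integrable_restrict_space)
    have ae: "AE z in ?M. (G z \<bullet> f (y s)) * ?K z \<le> \<omega> * (g z * ?K z) + L * M * (r + norm q) * ?K z"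
      using Gb dec AE_space
    proof eventually_elim
      case (elim z)
      have z: "z \<in> \<Omega>" using elim by simp
      show ?case
      proof (cases "?K z = 0")
        case False
        then have "norm (z - (y s + q)) < r" using bump_kernel_nonzero_iff[OF r] by blast
        then have d: "norm (y s - z) \<le> r + norm q"
          using norm_triangle_ineq[of "z - (y s + q)" q] by (simp add: norm_minus_commute)
        have "G z \<bullet> f (y s) = f z \<bullet> G z + G z \<bullet> (f (y s) - f z)"
          by (simp add: inner_diff_right inner_commute)
        also have "G z \<bullet> (f (y s) - f z) \<le> norm (G z) * norm (f (y s) - f z)"
          by (rule norm_cauchy_schwarz)
        also have "\<dots> \<le> M * (L * (r + norm q))"
        proof (rule mult_mono)
          have "norm (f (y s) - f z) \<le> L * norm (y s - z)"
            using lipschitz_onD[OF f y_in[OF s] z] by (simp add: dist_norm)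
          also have "\<dots> \<le> L * (r + norm q)" using d L by (rule mult_left_mono)
          finally show "norm (f (y s) - f z) \<le> L * (r + norm q)" .
        qed (use elim M in auto)
        finally have "G z \<bullet> f (y s) \<le> \<omega> * g z + L * M * (r + norm q)"
          using elim by (simp add: mult_ac)
        then have "(G z \<bullet> f (y s)) * ?K z \<le> (\<omega> * g z + L * M * (r + norm q)) * ?K z"
          by (rule mult_right_mono) (rule bump_kernel_nonneg)
        then show ?thesis by (simp add: distrib_right mult.assoc)
      qed simp
    qed
    have "u' s \<le> (LINT z|?M. \<omega> * (g z * ?K z) + L * M * (r + norm q) * ?K z)"
      unfolding u'_def using G intK1 intK g by (intro integral_mono_AE ae Bochner_Integration.integrable_add integrable_mult_right) auto
    also have "\<dots> = \<omega> * u s + \<kappa>"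
      using intK[OF g] intK1 integral_bump_kernel_on[OF \<Omega> r sub[OF s]]
      unfolding u_def U_def \<kappa>_def by simp
    finally show ?thesis .
  qed
  have \<kappa>: "0 \<le> \<kappa>"
    unfolding \<kappa>_def using L M r bump_mass_pos[OF r, where ?'a = 'a] by simp
  have contu: "continuous_on {0..t} u"
    by (rule DERIV_continuous_on[where D = u'], rule DERIV_subset[OF du]) auto
  \<comment> \<open>With the integrating factor \<open>exp (- \<omega> s)\<close> the inequality \<open>u' \<le> \<omega> u + \<kappa>\<close> says that this
    difference decreases; as \<open>\<omega> \<le> 0\<close>, the factor is at most \<open>exp (- \<omega> t)\<close>.\<close>
  have "u t * exp (- \<omega> * t) - \<kappa> * exp (- \<omega> * t) * t \<le> u 0 * exp (- \<omega> * 0) - \<kappa> * exp (- \<omega> * t) * 0"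
  proof (rule DERIV_nonpos_imp_decreasing_open[OF t])
    fix s assume s: "0 < s" "s < t"
    have dus: "(u has_real_derivative u' s) (at s)"
      using du[of s] s at_within_interior[of s "{0..}"] by (simp add: interior_Ici[of "-1"])
    have "((\<lambda>s. u s * exp (- \<omega> * s) - \<kappa> * exp (- \<omega> * t) * s) has_real_derivative
        (u' s - \<omega> * u s) * exp (- \<omega> * s) - \<kappa> * exp (- \<omega> * t)) (at s)"
      by (auto intro!: derivative_eq_intros dus simp: algebra_simps)
    moreover have "(u' s - \<omega> * u s) * exp (- \<omega> * s) \<le> \<kappa> * exp (- \<omega> * t)"
    proof (rule mult_mono)
      show "exp (- \<omega> * s) \<le> exp (- \<omega> * t)" using s \<omega> by (simp add: mult_left_mono_neg)
    qed (use u'_le[of s] s \<kappa> in auto)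
    ultimately show "\<exists>d. ((\<lambda>s. u s * exp (- \<omega> * s) - \<kappa> * exp (- \<omega> * t) * s) has_real_derivative d) (at s) \<and> d \<le> 0"
      by (metis diff_le_0_iff_le)
  qed (intro continuous_intros contu)
  then have "(u t * exp (- \<omega> * t)) * exp (\<omega> * t) \<le> (u 0 + \<kappa> * exp (- \<omega> * t) * t) * exp (\<omega> * t)"
    by (intro mult_right_mono) auto
  moreover have "exp (- \<omega> * t) * exp (\<omega> * t) = 1"
    by (simp flip: exp_add)
  then have "(u t * exp (- \<omega> * t)) * exp (\<omega> * t) = u t"
    "(u 0 + \<kappa> * exp (- \<omega> * t) * t) * exp (\<omega> * t) = exp (\<omega> * t) * u 0 + t * \<kappa>"
    by algebra+
  ultimately have "u t \<le> exp (\<omega> * t) * u 0 + t * \<kappa>" by (simp only:)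
  then show ?thesis unfolding u_def U_def \<kappa>_def .
qed

section \<open>Lebesgue points\<close>

text \<open>Lebesgue's differentiation theorem for boxes with corner \<open>x\<close>, applied to \<open>\<bar>h - c\<bar>\<close> for all rational \<open>c\<close>;
at points where it holds for every such \<open>c\<close>, approximating the value \<open>h x\<close> by rational numbers suffices.\<close>

lemma AE_lebesgue_point:
  fixes h :: "'a::euclidean_space \<Rightarrow> real"
  assumes h: "\<And>a b. h absolutely_integrable_on cbox a b"
  obtains N where "negligible N"
    "\<And>x e. x \<notin> N \<Longrightarrow> 0 < e \<Longrightarrow> \<exists>d>0. \<forall>\<rho>. 0 < \<rho> \<and> \<rho> < d \<longrightarrow>
       integral (cbox x (x + \<rho> *\<^sub>R One)) (\<lambda>z. \<bar>h z - h x\<bar>) \<le> e * \<rho> ^ DIM('a)"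
proof -
  have int: "(\<lambda>z. \<bar>h z - c\<bar>) integrable_on cbox a b" for c a b
  proof -
    have "(\<lambda>z. h z - c) absolutely_integrable_on cbox a b"
      using h by (intro set_integral_diff) (auto simp: absolutely_integrable_on_def)
    then show ?thesis
      unfolding absolutely_integrable_on_def by simp
  qed
  define good where "good c N \<longleftrightarrow> negligible N \<and> (\<forall>x e. x \<notin> N \<longrightarrow> 0 < e \<longrightarrow>
     (\<exists>d>0. \<forall>\<rho>. 0 < \<rho> \<and> \<rho> < d \<longrightarrow>
        norm (integral (cbox x (x + \<rho> *\<^sub>R One)) (\<lambda>z. \<bar>h z - c\<bar>) /\<^sub>R \<rho> ^ DIM('a) - \<bar>h x - c\<bar>) < e))" for c and N :: "'a set"
  have "\<exists>N. good c N" for c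
    using integrable_ccontinuous_explicit[of "\<lambda>z. \<bar>h z - c\<bar>", OF int] unfolding good_def by metis
  then obtain N where N: "\<And>c. good c (N c)" by metis
  show ?thesis
  proof (rule that)
    show "negligible (\<Union>c\<in>\<rat>. N c)"
      using N countable_rat unfolding good_def by (intro negligible_countable_Union) auto
    fix x and e :: real assume x: "x \<notin> (\<Union>c\<in>\<rat>. N c)" and e: "0 < e"
    obtain c where c0: "c \<in> \<rat>" "h x - e / 3 < c" "c < h x + e / 3"
      using Rats_dense_in_real[of "h x - e / 3" "h x + e / 3"] e by auto
    then have c: "c \<in> \<rat>" "\<bar>h x - c\<bar> < e / 3" by linarith+
    then obtain d where d: "0 < d" "\<And>\<rho>. 0 < \<rho> \<Longrightarrow> \<rho> < d \<Longrightarrow>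
        norm (integral (cbox x (x + \<rho> *\<^sub>R One)) (\<lambda>z. \<bar>h z - c\<bar>) /\<^sub>R \<rho> ^ DIM('a) - \<bar>h x - c\<bar>) < e / 3"
      using N[of c] x e unfolding good_def by (metis UN_I divide_pos_pos zero_less_numeral)
    show "\<exists>d>0. \<forall>\<rho>. 0 < \<rho> \<and> \<rho> < d \<longrightarrow>
       integral (cbox x (x + \<rho> *\<^sub>R One)) (\<lambda>z. \<bar>h z - h x\<bar>) \<le> e * \<rho> ^ DIM('a)"
    proof (intro exI[of _ d] conjI allI impI d(1))
      fix \<rho> assume \<rho>: "0 < \<rho> \<and> \<rho> < d"
      let ?Q = "cbox x (x + \<rho> *\<^sub>R One)"
      have vol: "measure lborel ?Q = \<rho> ^ DIM('a)"
        using \<rho> by (subst content_cbox) (auto simp: inner_add_left)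
      have "integral ?Q (\<lambda>z. \<bar>h z - h x\<bar>) \<le> integral ?Q (\<lambda>z. \<bar>h z - c\<bar> + \<bar>h x - c\<bar>)"
        by (intro integral_le int integrable_add integrable_const) auto
      also have "\<dots> = integral ?Q (\<lambda>z. \<bar>h z - c\<bar>) + \<rho> ^ DIM('a) * \<bar>h x - c\<bar>"
        by (subst Henstock_Kurzweil_Integration.integral_add) (auto simp: int vol)
      also have "integral ?Q (\<lambda>z. \<bar>h z - c\<bar>) \<le> \<rho> ^ DIM('a) * (\<bar>h x - c\<bar> + e / 3)"
      proof -
        have "integral ?Q (\<lambda>z. \<bar>h z - c\<bar>) / \<rho> ^ DIM('a) \<le> \<bar>h x - c\<bar> + e / 3"
        proof -
          have "norm (integral ?Q (\<lambda>z. \<bar>h z - c\<bar>) /\<^sub>R \<rho> ^ DIM('a) - \<bar>h x - c\<bar>) < e / 3"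
            using \<rho> by (intro d(2)) auto
          moreover have "integral ?Q (\<lambda>z. \<bar>h z - c\<bar>) /\<^sub>R \<rho> ^ DIM('a) = integral ?Q (\<lambda>z. \<bar>h z - c\<bar>) / \<rho> ^ DIM('a)"
            by (simp add: divide_inverse mult.commute)
          ultimately show ?thesis by (simp only: real_norm_def)
        qed
        then show ?thesis using \<rho> by (subst (asm) pos_divide_le_eq) (auto simp: mult.commute)
      qed
      finally have "integral ?Q (\<lambda>z. \<bar>h z - h x\<bar>) \<le> \<rho> ^ DIM('a) * (2 * \<bar>h x - c\<bar> + e / 3)"
        by (simp add: algebra_simps)
      also have "\<dots> \<le> \<rho> ^ DIM('a) * e"
        using c(2) \<rho> by (intro mult_left_mono) auto
      finally show "integral ?Q (\<lambda>z. \<bar>h z - h x\<bar>) \<le> e * \<rho> ^ DIM('a)" by (simp add: mult.commute)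
    qed
  qed
qed

text \<open>The kernel of radius \<open>r\<close> is shifted by \<open>r\<close> in every coordinate, so that its support lies in the box
with corner \<open>x\<close> and side \<open>2 r\<close>. It is bounded by 1 and its mass is at least a fixed fraction of the
volume of this box, so the error is controlled by the mean oscillation over the box, which vanishes
in the limit at a Lebesgue point.\<close>

lemma mollification_tendsto:
  fixes g :: "'a::euclidean_space \<Rightarrow> real"
  assumes \<Omega>: "open \<Omega>" and g: "integrable (lebesgue_on \<Omega>) g"
  obtains N where "negligible N"
    "\<And>x. x \<in> \<Omega> - N \<Longrightarrow>
      ((\<lambda>r. (LINT z|lebesgue_on \<Omega>. g z * bump_kernel r (z - (x + r *\<^sub>R One))) / bump_mass TYPE('a) r)
        \<longlongrightarrow> g x) (at_right 0)"
proof -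
  define h where "h z = indicator \<Omega> z * g z" for z
  have h: "integrable lebesgue h"
    using g \<Omega> unfolding h_def by (simp add: integrable_restrict_space)
  have h_cbox: "h absolutely_integrable_on cbox a b" for a b
    using integrable_mult_indicator[OF _ h, of "cbox a b"] unfolding set_integrable_def by simp
  obtain N where N: "negligible N"
    "\<And>x e. x \<notin> N \<Longrightarrow> 0 < e \<Longrightarrow> \<exists>d>0. \<forall>\<rho>. 0 < \<rho> \<and> \<rho> < d \<longrightarrow>
       integral (cbox x (x + \<rho> *\<^sub>R One)) (\<lambda>z. \<bar>h z - h x\<bar>) \<le> e * \<rho> ^ DIM('a)"
    using AE_lebesgue_point[of h, OF h_cbox] by metis
  \<comment> \<open>A lower bound for the ratio of the mass of the kernel to the volume of the box.\<close>
  define V where "V = exp (- 4 / 3) * (unit_ball_vol DIM('a) * (1 / 4) ^ DIM('a))"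
  have V: "0 < V" unfolding V_def by simp
  show ?thesis
  proof (rule that[OF N(1)])
    fix x assume x: "x \<in> \<Omega> - N"
    define m where "m r = (LINT z|lebesgue_on \<Omega>. g z * bump_kernel r (z - (x + r *\<^sub>R One)))" for r
    have est: "\<bar>m r / bump_mass TYPE('a) r - g x\<bar> \<le> e / V"
      if r: "0 < r" and bound: "integral (cbox x (x + (2 * r) *\<^sub>R One)) (\<lambda>z. \<bar>h z - h x\<bar>) \<le> e * (2 * r) ^ DIM('a)" for r e
    proof -
      let ?Q = "cbox x (x + (2 * r) *\<^sub>R One)"
      let ?K = "\<lambda>z. bump_kernel r (z - (x + r *\<^sub>R One))"
      have supp: "z \<in> ?Q" if "?K z \<noteq> 0" for z
      proof -
        have "norm (z - (x + r *\<^sub>R One)) < r" using that bump_kernel_nonzero_iff[OF r] by blast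
        then have "\<bar>(z - (x + r *\<^sub>R One)) \<bullet> b\<bar> < r" if "b \<in> Basis" for b
          using Basis_le_norm[OF that] by (meson le_less_trans)
        then have "x \<bullet> b \<le> z \<bullet> b \<and> z \<bullet> b \<le> (x + (2 * r) *\<^sub>R One) \<bullet> b" if "b \<in> Basis" for b
          using that by (fastforce simp: inner_diff_left inner_add_left abs_less_iff)
        then show ?thesis unfolding mem_box by blast
      qed
      have intK: "integrable lebesgue ?K" and massK: "(LINT z|lebesgue. ?K z) = bump_mass TYPE('a) r"
        using bump_kernel_integral_shift[OF r] by blast+
      have inthK: "integrable lebesgue (\<lambda>z. h z * ?K z)"
        by (rule integrable_mult_bounded[OF h _, where C = 1])
          (use intK in \<open>auto simp: bump_kernel_nonneg bump_kernel_le_1\<close>)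
      have "m r = (LINT z|lebesgue. h z * ?K z)"
        using \<Omega> unfolding m_def h_def by (simp add: integral_restrict_space mult.assoc)
      then have "m r - h x * bump_mass TYPE('a) r = (LINT z|lebesgue. (h z - h x) * ?K z)"
        using inthK intK by (simp add: left_diff_distrib massK)
      also have "\<bar>\<dots>\<bar> \<le> (LINT z|lebesgue. \<bar>(h z - h x) * ?K z\<bar>)"
        by (rule integral_abs_bound)
      also have "\<dots> \<le> (LINT z|lebesgue. indicator ?Q z * \<bar>h z - h x\<bar>)"
      proof (rule integral_mono)
        show "integrable lebesgue (\<lambda>z. \<bar>(h z - h x) * ?K z\<bar>)"
          using inthK intK by (intro integrable_abs) (simp add: left_diff_distrib)
        have "(\<lambda>z. h z - h x) absolutely_integrable_on ?Q"
          using h_cbox by (intro set_integral_diff) (auto simp: absolutely_integrable_on_def)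
        then show "integrable lebesgue (\<lambda>z. indicator ?Q z * \<bar>h z - h x\<bar>)"
          unfolding set_integrable_def by (drule_tac integrable_abs) (simp add: abs_mult)
        show "\<bar>(h z - h x) * ?K z\<bar> \<le> indicator ?Q z * \<bar>h z - h x\<bar>" for z
          using supp[of z] bump_kernel_nonneg[of r "z - (x + r *\<^sub>R One)"] bump_kernel_le_1[of r "z - (x + r *\<^sub>R One)"]
          by (cases "?K z = 0") (auto simp: abs_mult mult_left_le)
      qed
      also have "\<dots> = integral ?Q (\<lambda>z. \<bar>h z - h x\<bar>)"
      proof -
        have "(\<lambda>z. h z - h x) absolutely_integrable_on ?Q"
          using h_cbox by (intro set_integral_diff) (auto simp: absolutely_integrable_on_def)
        then have "(\<lambda>z. \<bar>h z - h x\<bar>) absolutely_integrable_on ?Q"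
          by (simp add: absolutely_integrable_on_def)
        then show ?thesis
          using set_lebesgue_integral_eq_integral(2) unfolding set_lebesgue_integral_def by fastforce
      qed
      also note bound
      finally have num: "\<bar>m r - h x * bump_mass TYPE('a) r\<bar> \<le> e * (2 * r) ^ DIM('a)" .
      have mass: "V * (2 * r) ^ DIM('a) \<le> bump_mass TYPE('a) r"
      proof -
        have "(1 / 4) ^ DIM('a) * (2 * r) ^ DIM('a) = (r / 2) ^ DIM('a)"
          unfolding power_mult_distrib[symmetric] by simp
        then show ?thesis using bump_mass_ge[OF r, where ?'a = 'a] unfolding V_def by (simp add: mult.assoc)
      qed
      have pos: "0 < bump_mass TYPE('a) r" "0 < (2 * r) ^ DIM('a)" using bump_mass_pos[OF r] r by auto
      have e: "0 \<le> e"
        using num pos(2) by (metis abs_ge_zero mult_less_0_iff not_less order_trans)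
      have "\<bar>m r / bump_mass TYPE('a) r - h x\<bar> = \<bar>m r - h x * bump_mass TYPE('a) r\<bar> / bump_mass TYPE('a) r"
        using pos(1) by (simp add: field_simps)
      also have "\<dots> \<le> (e * (2 * r) ^ DIM('a)) / (V * (2 * r) ^ DIM('a))"
        using num mass pos V e by (intro frac_le) auto
      also have "\<dots> = e / V" using r by simp
      finally show ?thesis using x by (simp add: h_def)
    qed
    have "((\<lambda>r. m r / bump_mass TYPE('a) r) \<longlongrightarrow> g x) (at_right 0)"
      unfolding tendsto_iff
    proof (intro allI impI)
      fix e :: real assume e: "0 < e"
      define e' where "e' = e * V / 2"
      have e': "0 < e'" "e' / V < e" using e V by (auto simp: e'_def)
      obtain d where d: "0 < d" "\<And>\<rho>. 0 < \<rho> \<Longrightarrow> \<rho> < d \<Longrightarrow>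
          integral (cbox x (x + \<rho> *\<^sub>R One)) (\<lambda>z. \<bar>h z - h x\<bar>) \<le> e' * \<rho> ^ DIM('a)"
        using N(2)[of x e'] x e' by blast
      have "\<forall>\<^sub>F r in at_right 0. r \<in> {0<..<d / 2}"
        using d(1) by (intro eventually_at_right_real) simp
      then show "\<forall>\<^sub>F r in at_right 0. dist (m r / bump_mass TYPE('a) r) (g x) < e"
      proof eventually_elim
        case (elim r)
        then show ?case using est[of r e'] d(2)[of "2 * r"] e' by (auto simp: dist_real_def)
      qed
    qed
    then show "((\<lambda>r. (LINT z|lebesgue_on \<Omega>. g z * bump_kernel r (z - (x + r *\<^sub>R One))) / bump_mass TYPE('a) r)
        \<longlongrightarrow> g x) (at_right 0)"
      unfolding m_def .
  qed
qed

section \<open>Growth bounds along the flow\<close>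

text \<open>The estimate for mollifications passes to the limit at every \<open>x\<close> for which both \<open>x\<close> and \<open>\<Phi> t x\<close> are points
of convergence. The exceptional set is negligible because the flow is expanding up to a factor.\<close>

lemma AE_le_along_flow:
  fixes g :: "'a::euclidean_space \<Rightarrow> real"
  assumes \<Omega>: "open \<Omega>" and f: "L-lipschitz_on \<Omega> f" and flow: "is_flow f \<Omega> \<Phi>"
    and inv: "\<And>s x. 0 \<le> s \<Longrightarrow> x \<in> \<Omega> \<Longrightarrow> \<Phi> s x \<in> \<Omega>"
    and wg: "has_weak_gradient \<Omega> g G"
    and g: "integrable (lebesgue_on \<Omega>) g" and G: "integrable (lebesgue_on \<Omega>) G"
    and M: "0 \<le> M" and Gb: "AE z in lebesgue_on \<Omega>. norm (G z) \<le> M"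
    and dec: "AE z in lebesgue_on \<Omega>. f z \<bullet> G z \<le> \<omega> * g z" and \<omega>: "\<omega> \<le> 0"
    and t: "0 \<le> t"
  shows "AE x in lebesgue_on \<Omega>. g (\<Phi> t x) \<le> exp (\<omega> * t) * g x"
proof -
  have cl: "x \<in> closure \<Omega>" if "x \<in> \<Omega>" for x using that closure_subset by blast
  obtain N where N: "negligible N" and lim: "\<And>x. x \<in> \<Omega> - N \<Longrightarrow>
      ((\<lambda>r. (LINT z|lebesgue_on \<Omega>. g z * bump_kernel r (z - (x + r *\<^sub>R One))) / bump_mass TYPE('a) r)
        \<longlongrightarrow> g x) (at_right 0)"
  proof (rule mollification_tendsto[OF \<Omega> g])
    fix N assume "negligible N" "\<And>x. x \<in> \<Omega> - N \<Longrightarrow>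
      ((\<lambda>r. (LINT z|lebesgue_on \<Omega>. g z * bump_kernel r (z - (x + r *\<^sub>R One))) / bump_mass TYPE('a) r)
        \<longlongrightarrow> g x) (at_right 0)"
    then show thesis by (rule that)
  qed
  have N': "negligible {x \<in> \<Omega>. \<Phi> t x \<in> N}"
  proof (rule expanding_preimage_negligible[OF _ N])
    show "norm (x - y) \<le> exp (L * t) * norm (\<Phi> t x - \<Phi> t y)" if "x \<in> \<Omega>" "y \<in> \<Omega>" for x y
      using that inv cl by (intro flow_distance_bounds(2)[OF flow f t]) auto
  qed
  have main: "g (\<Phi> t x) \<le> exp (\<omega> * t) * g x" if x: "x \<in> \<Omega>" "x \<notin> N" "\<Phi> t x \<notin> N" for x
  proof -
    let ?m = "\<lambda>r x. (LINT z|lebesgue_on \<Omega>. g z * bump_kernel r (z - (x + r *\<^sub>R One))) / bump_mass TYPE('a) r"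
    have "compact ((\<lambda>s. \<Phi> s x) ` {0..t})"
      using is_flow_continuous_on_time[OF flow cl[OF x(1)]]
      by (intro compact_continuous_image) (auto intro: continuous_on_subset)
    moreover have "(\<lambda>s. \<Phi> s x) ` {0..t} \<subseteq> \<Omega>" using inv x(1) by auto
    ultimately obtain \<delta> where \<delta>: "0 < \<delta>" "(\<Union>y\<in>(\<lambda>s. \<Phi> s x) ` {0..t}. cball y \<delta>) \<subseteq> \<Omega>"
      using compact_subset_open_imp_cball_epsilon_subset[of "(\<lambda>s. \<Phi> s x) ` {0..t}" \<Omega>] \<Omega> by blast
    define A :: real where "A = norm (One :: 'a)"
    have A: "0 \<le> A" unfolding A_def by simp
    have ineq: "?m r (\<Phi> t x) \<le> exp (\<omega> * t) * ?m r x + t * (L * M * (r + r * A))"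
      if r: "0 < r" "r * (1 + A) \<le> \<delta>" for r
    proof -
      have mass: "0 < bump_mass TYPE('a) r" using r by (intro bump_mass_pos)
      have sub: "cball (\<Phi> s x + r *\<^sub>R One) r \<subseteq> \<Omega>" if "0 \<le> s" "s \<le> t" for s
      proof -
        have "cball (\<Phi> s x + r *\<^sub>R One) r \<subseteq> cball (\<Phi> s x) \<delta>"
        proof
          fix z assume "z \<in> cball (\<Phi> s x + r *\<^sub>R One) r"
          then have "norm (\<Phi> s x - z) \<le> r * A + r"
            using norm_triangle_ineq4[of "\<Phi> s x + r *\<^sub>R One - z" "r *\<^sub>R One"] r
            by (simp add: dist_norm A_def)
          then show "z \<in> cball (\<Phi> s x) \<delta>" using r by (simp add: dist_norm algebra_simps)
        qed
        moreover have "cball (\<Phi> s x) \<delta> \<subseteq> \<Omega>"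
          using \<delta>(2) that unfolding UN_subset_iff by auto
        ultimately show ?thesis by (rule order_trans)
      qed
      have "(LINT z|lebesgue_on \<Omega>. g z * bump_kernel r (z - (\<Phi> t x + r *\<^sub>R One)))
        \<le> exp (\<omega> * t) * (LINT z|lebesgue_on \<Omega>. g z * bump_kernel r (z - (\<Phi> 0 x + r *\<^sub>R One)))
          + t * (L * M * (r + norm (r *\<^sub>R One :: 'a)) * bump_mass TYPE('a) r)"
        by (rule mollified_growth_along_solution[OF \<Omega> f wg g G M Gb dec \<omega> t])
          (use is_flow_deriv[OF flow cl[OF x(1)]] inv x(1) r sub in auto)
      then have "(LINT z|lebesgue_on \<Omega>. g z * bump_kernel r (z - (\<Phi> t x + r *\<^sub>R One))) / bump_mass TYPE('a) r
        \<le> (exp (\<omega> * t) * (LINT z|lebesgue_on \<Omega>. g z * bump_kernel r (z - (x + r *\<^sub>R One)))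
          + t * (L * M * (r + r * A) * bump_mass TYPE('a) r)) / bump_mass TYPE('a) r"
        using mass r is_flow_0[OF flow cl[OF x(1)]] by (intro divide_right_mono) (auto simp: A_def)
      also have "\<dots> = exp (\<omega> * t) * ?m r x + t * (L * M * (r + r * A))"
        using mass by (simp add: add_divide_distrib)
      finally show ?thesis .
    qed
    show ?thesis
    proof (rule tendsto_le)
      show "((\<lambda>r. ?m r (\<Phi> t x)) \<longlongrightarrow> g (\<Phi> t x)) (at_right 0)"
        using x inv[OF t x(1)] by (intro lim) auto
      have "((\<lambda>r. exp (\<omega> * t) * ?m r x + t * (L * M * (r + r * A))) \<longlongrightarrow>
          exp (\<omega> * t) * g x + t * (L * M * (0 + 0 * A))) (at_right 0)"
        using x by (intro tendsto_intros lim) auto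
      then show "((\<lambda>r. exp (\<omega> * t) * ?m r x + t * (L * M * (r + r * A))) \<longlongrightarrow> exp (\<omega> * t) * g x) (at_right 0)"
        by simp
      have "\<forall>\<^sub>F r in at_right 0. r \<in> {0<..<\<delta> / (1 + A)}"
        using \<delta>(1) A by (intro eventually_at_right_real) auto
      then show "\<forall>\<^sub>F r in at_right 0. ?m r (\<Phi> t x) \<le> exp (\<omega> * t) * ?m r x + t * (L * M * (r + r * A))"
      proof eventually_elim
        case (elim r)
        then show ?case using A by (intro ineq) (auto simp: field_simps)
      qed
    qed simp
  qed
  have "N \<union> {x \<in> \<Omega>. \<Phi> t x \<in> N} \<in> null_sets lebesgue"
    using N N' by (simp add: negligible_iff_null_sets[symmetric])
  then have "AE x in lebesgue. x \<notin> N \<union> {x \<in> \<Omega>. \<Phi> t x \<in> N}"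
    by (rule AE_not_in)
  then have "AE x in lebesgue. x \<in> \<Omega> \<longrightarrow> g (\<Phi> t x) \<le> exp (\<omega> * t) * g x"
    by eventually_elim (use main in auto)
  then show ?thesis
    using \<Omega> by (simp add: AE_restrict_space_iff)
qed

section \<open>Duality and contraction\<close>

text \<open>The properties of the flow and the weight on which the functional analysis rests. With them
\<open>L\<^sup>1\<^sub>w\<close> and the composition operators can be treated without further reference to the differential
equation. The constant \<open>\<kappa>\<close> bounds the rate of volume distortion, \<open>\<omega>\<close> the growth of \<open>1 / w\<close>.\<close>

locale weighted_preadjoint =
  fixes \<Omega> :: "'a::euclidean_space set" and w :: "'a \<Rightarrow> real"
    and \<Phi> :: "real \<Rightarrow> 'a \<Rightarrow> 'a" and S :: "real \<Rightarrow> ('a \<Rightarrow> real) \<Rightarrow> ('a \<Rightarrow> real)"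
    and B \<kappa> \<omega> :: real
  assumes \<Omega>_open: "open \<Omega>" and \<Omega>_bounded: "bounded \<Omega>"
    and w_meas [measurable]: "w \<in> borel_measurable (lebesgue_on \<Omega>)"
    and w_pos: "AE x in lebesgue_on \<Omega>. 0 < w x"
    and w_inv_le: "AE x in lebesgue_on \<Omega>. inverse (w x) \<le> B"
    and flow_in: "\<And>t x. 0 \<le> t \<Longrightarrow> x \<in> \<Omega> \<Longrightarrow> \<Phi> t x \<in> \<Omega>"
    and flow_zero: "\<And>x. x \<in> \<Omega> \<Longrightarrow> \<Phi> 0 x = x"
    and flow_add: "\<And>s t x. 0 \<le> s \<Longrightarrow> 0 \<le> t \<Longrightarrow> x \<in> \<Omega> \<Longrightarrow> \<Phi> (s + t) x = \<Phi> s (\<Phi> t x)"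
    and flow_tendsto: "\<And>x. x \<in> \<Omega> \<Longrightarrow> ((\<lambda>t. \<Phi> t x) \<longlongrightarrow> x) (at_right 0)"
    and flow_meas: "\<And>t. 0 \<le> t \<Longrightarrow> \<Phi> t \<in> measurable (lebesgue_on \<Omega>) (lebesgue_on \<Omega>)"
    and flow_volume: "\<And>t A. 0 \<le> t \<Longrightarrow> A \<in> sets (lebesgue_on \<Omega>) \<Longrightarrow>
      emeasure (lebesgue_on \<Omega>) (\<Phi> t -` A \<inter> \<Omega>) \<le> ennreal (exp (\<kappa> * t)) * emeasure (lebesgue_on \<Omega>) A"
    and w_inv_decay: "\<And>t. 0 \<le> t \<Longrightarrow>
      AE x in lebesgue_on \<Omega>. inverse (w (\<Phi> t x)) \<le> exp (\<omega> * t) * inverse (w x)"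
    and \<omega>_nonpos: "\<omega> \<le> 0"
    and preadjoint: "\<And>t. 0 \<le> t \<Longrightarrow> is_preadjoint \<Omega> w (S t) (composition_operator \<Phi> t)"
begin

abbreviation M where "M \<equiv> lebesgue_on \<Omega>"

lemma space_M [simp]: "space M = \<Omega>"
  by (simp add: space_restrict_space)

lemma finite_M: "finite_measure M"
  using \<Omega>_bounded \<Omega>_open by (intro finite_measure_lebesgue_on) (simp add: bounded_set_imp_lmeasurable)

lemma integrable_bounded:
  fixes h :: "'a \<Rightarrow> real"
  assumes "h \<in> borel_measurable M" "AE x in M. \<bar>h x\<bar> \<le> C"
  shows "integrable M h"
  using finite_measure.integrable_const_bound[OF finite_M, of h C] assms by auto

text \<open>Trades the essential supremum for an almost everywhere bound by a multiple of \<open>1 / w\<close>, the form in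
which test functions are constructed and estimated below.\<close>

lemma Linfw_iff:
  "\<phi> \<in> Linfw \<Omega> w \<longleftrightarrow> \<phi> \<in> borel_measurable M \<and> (\<exists>C. AE x in M. \<bar>\<phi> x\<bar> \<le> C * inverse (w x))"
proof (intro iffI conjI)
  assume \<phi>: "\<phi> \<in> Linfw \<Omega> w"
  then show "\<phi> \<in> borel_measurable M" unfolding Linfw_def by simp
  have fin: "esssup M (\<lambda>x. ereal \<bar>\<phi> x * w x\<bar>) < \<infinity>" using \<phi> unfolding Linfw_def by simp
  then obtain C where C: "esssup M (\<lambda>x. ereal \<bar>\<phi> x * w x\<bar>) \<le> ereal C"
    by (cases "esssup M (\<lambda>x. ereal \<bar>\<phi> x * w x\<bar>)") auto
  have "AE x in M. \<bar>\<phi> x\<bar> \<le> C * inverse (w x)"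
    using esssup_AE[where M = M and f = "\<lambda>x. ereal \<bar>\<phi> x * w x\<bar>"] w_pos
  proof eventually_elim
    case (elim x)
    then have "\<bar>\<phi> x * w x\<bar> \<le> C" using C by (meson ereal_less_eq(3) order_trans)
    then show ?case using elim by (simp add: abs_mult field_simps)
  qed
  then show "\<exists>C. AE x in M. \<bar>\<phi> x\<bar> \<le> C * inverse (w x)" ..
next
  assume "\<phi> \<in> borel_measurable M \<and> (\<exists>C. AE x in M. \<bar>\<phi> x\<bar> \<le> C * inverse (w x))"
  then obtain C where [measurable]: "\<phi> \<in> borel_measurable M" and C: "AE x in M. \<bar>\<phi> x\<bar> \<le> C * inverse (w x)"
    by blast
  have "AE x in M. ereal \<bar>\<phi> x * w x\<bar> \<le> ereal C"
    using C w_pos by eventually_elim (simp add: abs_mult field_simps)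
  then have "esssup M (\<lambda>x. ereal \<bar>\<phi> x * w x\<bar>) \<le> ereal C"
    by (intro esssup_I) measurable
  then show "\<phi> \<in> Linfw \<Omega> w"
    unfolding Linfw_def by (auto intro: le_less_trans)
qed

lemma AE_flow:
  assumes t: "0 \<le> t" and P: "AE x in M. P x"
  shows "AE x in M. P (\<Phi> t x)"
proof -
  obtain N where N: "{x \<in> space M. \<not> P x} \<subseteq> N" "emeasure M N = 0" "N \<in> sets M"
    using P by (rule AE_E)
  have "emeasure M (\<Phi> t -` N \<inter> \<Omega>) = 0"
    using flow_volume[OF t N(3)] N(2) by simp
  moreover have "\<Phi> t -` N \<inter> \<Omega> \<in> sets M"
    using measurable_sets[OF flow_meas[OF t] N(3)] by simp
  ultimately show ?thesis
    using N(1) flow_in[OF t] by (intro AE_I[where N = "\<Phi> t -` N \<inter> \<Omega>"]) auto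
qed

lemma measurable_flow:
  assumes "0 \<le> t" "h \<in> borel_measurable M"
  shows "(\<lambda>x. h (\<Phi> t x)) \<in> borel_measurable M"
  using measurable_comp[OF flow_meas assms(2)] assms(1) by (simp add: comp_def)

text \<open>The bound on preimages says that the image measure is at most a multiple of Lebesgue measure.\<close>

lemma nn_integral_flow_le:
  assumes t: "0 \<le> t" and h: "h \<in> borel_measurable M"
  shows "(\<integral>\<^sup>+x. h (\<Phi> t x) \<partial>M) \<le> ennreal (exp (\<kappa> * t)) * (\<integral>\<^sup>+x. h x \<partial>M)"
proof -
  have "(\<integral>\<^sup>+x. h (\<Phi> t x) \<partial>M) = (\<integral>\<^sup>+x. h x \<partial>distr M M (\<Phi> t))"
    using flow_meas[OF t] h by (simp add: nn_integral_distr)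
  also have "\<dots> \<le> (\<integral>\<^sup>+x. h x \<partial>scale_measure (ennreal (exp (\<kappa> * t))) M)"
  proof (rule nn_integral_mono_measure)
    show "distr M M (\<Phi> t) \<le> scale_measure (ennreal (exp (\<kappa> * t))) M"
    proof (subst le_measure)
      show "\<forall>A\<in>sets (distr M M (\<Phi> t)). emeasure (distr M M (\<Phi> t)) A \<le> emeasure (scale_measure (ennreal (exp (\<kappa> * t))) M) A"
        using flow_volume[OF t] flow_meas[OF t] by (simp add: emeasure_distr)
    qed simp
  qed simp
  also have "\<dots> = ennreal (exp (\<kappa> * t)) * (\<integral>\<^sup>+x. h x \<partial>M)"
    using h by (rule nn_integral_scale_measure)
  finally show ?thesis .
qed

lemma integral_flow_le:
  fixes h :: "'a \<Rightarrow> real"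
  assumes t: "0 \<le> t" and h: "integrable M h" and nonneg: "\<And>x. 0 \<le> h x"
  shows "integrable M (\<lambda>x. h (\<Phi> t x))"
    and "(LINT x|M. h (\<Phi> t x)) \<le> exp (\<kappa> * t) * (LINT x|M. h x)"
proof -
  have le: "(\<integral>\<^sup>+x. ennreal (h (\<Phi> t x)) \<partial>M) \<le> ennreal (exp (\<kappa> * t) * (LINT x|M. h x))"
    using nn_integral_flow_le[OF t, of "\<lambda>x. ennreal (h x)"] h nonneg
    by (simp add: nn_integral_eq_integral ennreal_mult integral_nonneg_AE)
  have meas: "(\<lambda>x. h (\<Phi> t x)) \<in> borel_measurable M"
    using h by (intro measurable_flow[OF t]) auto
  show int: "integrable M (\<lambda>x. h (\<Phi> t x))"
    using le nonneg by (intro integrableI_bounded meas) (auto intro: le_less_trans simp: ennreal_less_top)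
  show "(LINT x|M. h (\<Phi> t x)) \<le> exp (\<kappa> * t) * (LINT x|M. h x)"
    using le nonneg int h by (simp add: nn_integral_eq_integral integral_nonneg_AE)
qed

lemma composition_Linfw:
  assumes t: "0 \<le> t" and \<phi>: "\<phi> \<in> Linfw \<Omega> w"
  shows "composition_operator \<Phi> t \<phi> \<in> Linfw \<Omega> w"
proof -
  obtain C where meas: "\<phi> \<in> borel_measurable M" and C: "AE x in M. \<bar>\<phi> x\<bar> \<le> C * inverse (w x)"
    using \<phi> unfolding Linfw_iff by blast
  have "AE x in M. \<bar>\<phi> (\<Phi> t x)\<bar> \<le> \<bar>C\<bar> * inverse (w x)"
    using AE_flow[OF t C] AE_flow[OF t w_pos] w_inv_decay[OF t] w_pos
  proof eventually_elim
    case (elim x)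
    have "\<bar>\<phi> (\<Phi> t x)\<bar> \<le> \<bar>C\<bar> * inverse (w (\<Phi> t x))"
      using elim by (meson abs_ge_self less_imp_le mult_right_mono order_trans positive_imp_inverse_positive)
    also have "\<dots> \<le> \<bar>C\<bar> * inverse (w x)"
    proof (rule mult_left_mono)
      have "exp (\<omega> * t) \<le> 1" using \<omega>_nonpos t by (simp add: mult_nonpos_nonneg)
      then have "exp (\<omega> * t) * inverse (w x) \<le> 1 * inverse (w x)"
        using elim by (intro mult_right_mono) auto
      then show "inverse (w (\<Phi> t x)) \<le> inverse (w x)" using elim by linarith
    qed simp
    finally show ?case .
  qed
  then show ?thesis
    unfolding Linfw_iff composition_operator_def using measurable_flow[OF t meas] by blast
qed

lemma L1w_D:
  assumes "\<rho> \<in> L1w \<Omega> w"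
  shows "\<rho> \<in> borel_measurable M" "integrable M (\<lambda>x. \<bar>\<rho> x\<bar> * w x)"
  using assms unfolding L1w_def by auto

lemma S_L1w: "0 \<le> t \<Longrightarrow> \<rho> \<in> L1w \<Omega> w \<Longrightarrow> S t \<rho> \<in> L1w \<Omega> w"
  using preadjoint unfolding is_preadjoint_def bounded_operator_L1w_def by blast

lemma pairing_S:
  "0 \<le> t \<Longrightarrow> \<rho> \<in> L1w \<Omega> w \<Longrightarrow> \<phi> \<in> Linfw \<Omega> w \<Longrightarrow>
    pairing \<Omega> w (S t \<rho>) \<phi> = pairing \<Omega> w \<rho> (\<lambda>x. \<phi> (\<Phi> t x))"
  using preadjoint unfolding is_preadjoint_def composition_operator_def by blast

lemma integrable_pairing:
  assumes \<rho>: "\<rho> \<in> L1w \<Omega> w" and \<phi>: "\<phi> \<in> Linfw \<Omega> w"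
  shows "integrable M (\<lambda>x. \<rho> x * \<phi> x * (w x)\<^sup>2)"
proof -
  obtain C where [measurable]: "\<phi> \<in> borel_measurable M" and C: "AE x in M. \<bar>\<phi> x\<bar> \<le> C * inverse (w x)"
    using \<phi> unfolding Linfw_iff by blast
  have [measurable]: "\<rho> \<in> borel_measurable M" using L1w_D[OF \<rho>] by blast
  show ?thesis
  proof (rule Bochner_Integration.integrable_bound)
    show "integrable M (\<lambda>x. C * (\<bar>\<rho> x\<bar> * w x))" using L1w_D[OF \<rho>] by simp
    show "AE x in M. norm (\<rho> x * \<phi> x * (w x)\<^sup>2) \<le> norm (C * (\<bar>\<rho> x\<bar> * w x))"
      using C w_pos
    proof eventually_elim
      case (elim x)
      have "\<bar>\<phi> x\<bar> * (w x)\<^sup>2 \<le> C * inverse (w x) * (w x)\<^sup>2"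
        using elim by (intro mult_right_mono) auto
      also have "\<dots> = C * w x" using elim by (simp add: power2_eq_square)
      also have "\<dots> \<le> \<bar>C\<bar> * w x" using elim by (intro mult_right_mono) auto
      finally have "\<bar>\<rho> x\<bar> * (\<bar>\<phi> x\<bar> * (w x)\<^sup>2) \<le> \<bar>\<rho> x\<bar> * (\<bar>C\<bar> * w x)"
        by (intro mult_left_mono) auto
      then show ?case using elim by (simp add: abs_mult mult_ac)
    qed
  qed measurable
qed

text \<open>The test function that attains the norm.\<close>

lemma pairing_sgn:
  assumes "\<rho> \<in> L1w \<Omega> w"
  shows "(\<lambda>x. sgn (\<rho> x) * inverse (w x)) \<in> Linfw \<Omega> w"
    and "pairing \<Omega> w \<rho> (\<lambda>x. sgn (\<rho> x) * inverse (w x)) = norm_L1w \<Omega> w \<rho>"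
proof -
  have [measurable]: "\<rho> \<in> borel_measurable M" using L1w_D[OF assms] by blast
  have "AE x in M. \<bar>sgn (\<rho> x) * inverse (w x)\<bar> \<le> 1 * inverse (w x)"
    using w_pos by eventually_elim (simp add: abs_mult abs_sgn_eq)
  then show "(\<lambda>x. sgn (\<rho> x) * inverse (w x)) \<in> Linfw \<Omega> w"
    unfolding Linfw_iff by (intro conjI exI[of _ 1]) measurable
  show "pairing \<Omega> w \<rho> (\<lambda>x. sgn (\<rho> x) * inverse (w x)) = norm_L1w \<Omega> w \<rho>"
    unfolding pairing_def norm_L1w_def
  proof (rule Bochner_Integration.integral_cong)
    fix x
    have "\<rho> x * (sgn (\<rho> x) * inverse (w x)) * (w x)\<^sup>2 = (\<rho> x * sgn (\<rho> x)) * (inverse (w x) * (w x)\<^sup>2)"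
      by (simp only: mult_ac)
    also have "\<dots> = \<bar>\<rho> x\<bar> * w x"
      by (cases "w x = 0") (simp_all add: abs_sgn power2_eq_square)
    finally show "\<rho> x * (sgn (\<rho> x) * inverse (w x)) * (w x)\<^sup>2 = \<bar>\<rho> x\<bar> * w x" .
  qed simp
qed

theorem norm_S_le:
  assumes t: "0 \<le> t" and \<rho>: "\<rho> \<in> L1w \<Omega> w"
  shows "norm_L1w \<Omega> w (S t \<rho>) \<le> exp (\<omega> * t) * norm_L1w \<Omega> w \<rho>"
proof -
  define \<phi> where "\<phi> x = sgn (S t \<rho> x) * inverse (w x)" for x
  have \<phi>: "\<phi> \<in> Linfw \<Omega> w" "pairing \<Omega> w (S t \<rho>) \<phi> = norm_L1w \<Omega> w (S t \<rho>)"
    using pairing_sgn[OF S_L1w[OF t \<rho>]] unfolding \<phi>_def by auto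
  have "norm_L1w \<Omega> w (S t \<rho>) = pairing \<Omega> w \<rho> (\<lambda>x. \<phi> (\<Phi> t x))"
    using pairing_S[OF t \<rho> \<phi>(1)] \<phi>(2) by simp
  also have "\<dots> \<le> (LINT x|M. exp (\<omega> * t) * (\<bar>\<rho> x\<bar> * w x))"
    unfolding pairing_def
  proof (rule integral_mono_AE)
    show "integrable M (\<lambda>x. \<rho> x * \<phi> (\<Phi> t x) * (w x)\<^sup>2)"
      using integrable_pairing[OF \<rho> composition_Linfw[OF t \<phi>(1)]] unfolding composition_operator_def .
    show "AE x in M. \<rho> x * \<phi> (\<Phi> t x) * (w x)\<^sup>2 \<le> exp (\<omega> * t) * (\<bar>\<rho> x\<bar> * w x)"
      using w_inv_decay[OF t] AE_flow[OF t w_pos] w_pos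
    proof eventually_elim
      case (elim x)
      have "\<bar>\<phi> (\<Phi> t x)\<bar> \<le> inverse (w (\<Phi> t x))"
        using elim unfolding \<phi>_def by (simp add: abs_mult abs_sgn_eq)
      then have "\<bar>\<rho> x\<bar> * \<bar>\<phi> (\<Phi> t x)\<bar> * (w x)\<^sup>2 \<le> \<bar>\<rho> x\<bar> * (exp (\<omega> * t) * inverse (w x)) * (w x)\<^sup>2"
        using elim by (intro mult_right_mono mult_left_mono) auto
      also have "\<dots> = exp (\<omega> * t) * (\<bar>\<rho> x\<bar> * w x)"
        using elim by (simp add: power2_eq_square)
      finally have "\<bar>\<rho> x * \<phi> (\<Phi> t x) * (w x)\<^sup>2\<bar> \<le> exp (\<omega> * t) * (\<bar>\<rho> x\<bar> * w x)"
        by (simp add: abs_mult)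
      then show ?case by linarith
    qed
  qed (use L1w_D[OF \<rho>] in simp)
  also have "\<dots> = exp (\<omega> * t) * norm_L1w \<Omega> w \<rho>"
    unfolding norm_L1w_def by simp
  finally show ?thesis .
qed

lemma L1w_combination:
  assumes "\<rho> \<in> L1w \<Omega> w" "\<sigma> \<in> L1w \<Omega> w"
  shows "(\<lambda>x. a * \<rho> x + b * \<sigma> x) \<in> L1w \<Omega> w"
proof -
  have [measurable]: "\<rho> \<in> borel_measurable M" "\<sigma> \<in> borel_measurable M" using assms L1w_D by blast+
  have "integrable M (\<lambda>x. \<bar>a * \<rho> x + b * \<sigma> x\<bar> * w x)"
  proof (rule Bochner_Integration.integrable_bound)
    show "integrable M (\<lambda>x. \<bar>a\<bar> * (\<bar>\<rho> x\<bar> * w x) + \<bar>b\<bar> * (\<bar>\<sigma> x\<bar> * w x))"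
      using L1w_D(2)[OF assms(1)] L1w_D(2)[OF assms(2)] by simp
    show "AE x in M. norm (\<bar>a * \<rho> x + b * \<sigma> x\<bar> * w x) \<le> norm (\<bar>a\<bar> * (\<bar>\<rho> x\<bar> * w x) + \<bar>b\<bar> * (\<bar>\<sigma> x\<bar> * w x))"
      using w_pos
    proof eventually_elim
      case (elim x)
      have "\<bar>a * \<rho> x + b * \<sigma> x\<bar> * w x \<le> (\<bar>a\<bar> * \<bar>\<rho> x\<bar> + \<bar>b\<bar> * \<bar>\<sigma> x\<bar>) * w x"
        using elim abs_triangle_ineq[of "a * \<rho> x" "b * \<sigma> x"] by (intro mult_right_mono) (auto simp: abs_mult)
      then show ?case using elim by (simp add: distrib_right mult.assoc abs_mult)
    qed
  qed measurable
  then show ?thesis unfolding L1w_def by simp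
qed

lemma L1w_diff:
  assumes "\<rho> \<in> L1w \<Omega> w" "\<sigma> \<in> L1w \<Omega> w"
  shows "(\<lambda>x. \<rho> x - \<sigma> x) \<in> L1w \<Omega> w"
  using L1w_combination[OF assms, of 1 "-1"] by simp

lemma norm_L1w_cong:
  "AE x in M. \<rho> x = \<sigma> x \<Longrightarrow> \<rho> \<in> L1w \<Omega> w \<Longrightarrow> \<sigma> \<in> L1w \<Omega> w \<Longrightarrow> norm_L1w \<Omega> w \<rho> = norm_L1w \<Omega> w \<sigma>"
  unfolding norm_L1w_def using L1w_D by (intro integral_cong_AE) auto

lemma norm_L1w_triangle:
  assumes "\<rho> \<in> L1w \<Omega> w" "\<sigma> \<in> L1w \<Omega> w" "\<tau> \<in> L1w \<Omega> w"
  shows "norm_L1w \<Omega> w (\<lambda>x. \<rho> x - \<tau> x) \<le> norm_L1w \<Omega> w (\<lambda>x. \<rho> x - \<sigma> x) + norm_L1w \<Omega> w (\<lambda>x. \<sigma> x - \<tau> x)"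
proof -
  note int = L1w_D(2)[OF L1w_diff]
  have "norm_L1w \<Omega> w (\<lambda>x. \<rho> x - \<tau> x) \<le> (LINT x|M. \<bar>\<rho> x - \<sigma> x\<bar> * w x + \<bar>\<sigma> x - \<tau> x\<bar> * w x)"
    unfolding norm_L1w_def
  proof (rule integral_mono_AE)
    show "AE x in M. \<bar>\<rho> x - \<tau> x\<bar> * w x \<le> \<bar>\<rho> x - \<sigma> x\<bar> * w x + \<bar>\<sigma> x - \<tau> x\<bar> * w x"
      using w_pos by eventually_elim (simp flip: distrib_right)
  qed (use int assms in auto)
  also have "\<dots> = norm_L1w \<Omega> w (\<lambda>x. \<rho> x - \<sigma> x) + norm_L1w \<Omega> w (\<lambda>x. \<sigma> x - \<tau> x)"
    unfolding norm_L1w_def using int assms by simp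
  finally show ?thesis .
qed

text \<open>The test functions separate points, since one of them attains the norm of the difference.\<close>

lemma AE_eq_if_pairing_eq:
  assumes \<rho>: "\<rho> \<in> L1w \<Omega> w" and \<sigma>: "\<sigma> \<in> L1w \<Omega> w"
    and eq: "\<And>\<phi>. \<phi> \<in> Linfw \<Omega> w \<Longrightarrow> pairing \<Omega> w \<rho> \<phi> = pairing \<Omega> w \<sigma> \<phi>"
  shows "AE x in M. \<rho> x = \<sigma> x"
proof -
  define \<phi> where "\<phi> x = sgn (\<rho> x - \<sigma> x) * inverse (w x)" for x
  have \<phi>: "\<phi> \<in> Linfw \<Omega> w" "pairing \<Omega> w (\<lambda>x. \<rho> x - \<sigma> x) \<phi> = norm_L1w \<Omega> w (\<lambda>x. \<rho> x - \<sigma> x)"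
    using pairing_sgn[OF L1w_diff[OF \<rho> \<sigma>]] unfolding \<phi>_def by auto
  have "pairing \<Omega> w (\<lambda>x. \<rho> x - \<sigma> x) \<phi> = pairing \<Omega> w \<rho> \<phi> - pairing \<Omega> w \<sigma> \<phi>"
    unfolding pairing_def using integrable_pairing[OF \<rho> \<phi>(1)] integrable_pairing[OF \<sigma> \<phi>(1)]
    by (simp add: left_diff_distrib)
  then have "(LINT x|M. \<bar>\<rho> x - \<sigma> x\<bar> * w x) = 0"
    using eq[OF \<phi>(1)] \<phi>(2) unfolding norm_L1w_def by simp
  moreover have "AE x in M. 0 \<le> \<bar>\<rho> x - \<sigma> x\<bar> * w x"
    using w_pos by eventually_elim simp
  ultimately have "AE x in M. \<bar>\<rho> x - \<sigma> x\<bar> * w x = 0"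
    using integral_nonneg_eq_0_iff_AE[OF L1w_D(2)[OF L1w_diff[OF \<rho> \<sigma>]]] by blast
  then show ?thesis using w_pos by eventually_elim auto
qed

lemma S_0:
  assumes "\<rho> \<in> L1w \<Omega> w"
  shows "AE x in M. S 0 \<rho> x = \<rho> x"
proof (rule AE_eq_if_pairing_eq)
  fix \<phi> assume "\<phi> \<in> Linfw \<Omega> w"
  then have "pairing \<Omega> w (S 0 \<rho>) \<phi> = pairing \<Omega> w \<rho> (\<lambda>x. \<phi> (\<Phi> 0 x))"
    using assms by (intro pairing_S) auto
  also have "\<dots> = pairing \<Omega> w \<rho> \<phi>"
    unfolding pairing_def by (rule Bochner_Integration.integral_cong) (simp_all add: flow_zero)
  finally show "pairing \<Omega> w (S 0 \<rho>) \<phi> = pairing \<Omega> w \<rho> \<phi>" .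
qed (use assms S_L1w in auto)

lemma S_add:
  assumes "0 \<le> s" "0 \<le> t" "\<rho> \<in> L1w \<Omega> w"
  shows "AE x in M. S (s + t) \<rho> x = S s (S t \<rho>) x"
proof (rule AE_eq_if_pairing_eq)
  fix \<phi> assume \<phi>: "\<phi> \<in> Linfw \<Omega> w"
  then have \<phi>s: "(\<lambda>x. \<phi> (\<Phi> s x)) \<in> Linfw \<Omega> w"
    using composition_Linfw[OF assms(1)] unfolding composition_operator_def by blast
  have "pairing \<Omega> w (S (s + t) \<rho>) \<phi> = pairing \<Omega> w \<rho> (\<lambda>x. \<phi> (\<Phi> (s + t) x))"
    using assms \<phi> by (intro pairing_S) auto
  also have "\<dots> = pairing \<Omega> w \<rho> (\<lambda>x. \<phi> (\<Phi> s (\<Phi> t x)))"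
    unfolding pairing_def by (rule Bochner_Integration.integral_cong) (simp_all add: flow_add assms)
  also have "\<dots> = pairing \<Omega> w (S t \<rho>) (\<lambda>x. \<phi> (\<Phi> s x))"
    using pairing_S[OF assms(2,3) \<phi>s] by simp
  also have "\<dots> = pairing \<Omega> w (S s (S t \<rho>)) \<phi>"
    using pairing_S[OF assms(1) S_L1w[OF assms(2,3)] \<phi>] by simp
  finally show "pairing \<Omega> w (S (s + t) \<rho>) \<phi> = pairing \<Omega> w (S s (S t \<rho>)) \<phi>" .
qed (use assms S_L1w in auto)

end

section \<open>Strong continuity\<close>

definition clip :: "real \<Rightarrow> real \<Rightarrow> real" where
  "clip a y = max (- a) (min a y)"

lemma clip_bounds:
  assumes "0 \<le> a"
  shows "\<bar>clip a y\<bar> \<le> a" "\<bar>clip a y\<bar> \<le> \<bar>y\<bar>" "\<bar>y - clip a y\<bar> \<le> \<bar>y\<bar>"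
  using assms by (auto simp: clip_def max_def min_def)

lemma clip_eq: "\<bar>y\<bar> \<le> a \<Longrightarrow> clip a y = y"
  by (auto simp: clip_def max_def min_def)

lemma clip_square_le:
  assumes "0 \<le> a"
  shows "(clip a y)\<^sup>2 \<le> y * clip a y"
proof -
  have "0 \<le> (y - clip a y) * clip a y"
    using assms by (auto simp: clip_def max_def min_def mult_nonneg_nonneg mult_nonpos_nonpos mult_nonpos_nonneg)
  then show ?thesis by (simp add: power2_eq_square algebra_simps)
qed

lemma borel_measurable_clip [measurable (raw)]:
  "a \<in> borel_measurable M \<Longrightarrow> h \<in> borel_measurable M \<Longrightarrow> (\<lambda>x. clip (a x) (h x)) \<in> borel_measurable M"
  unfolding clip_def
  by (intro borel_measurable_max borel_measurable_min borel_measurable_uminus)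

context weighted_preadjoint
begin

text \<open>A dense class of \<open>\<rho>\<close>: the transported density \<open>\<rho> w\<^sup>2\<close> is bounded, so it belongs to \<open>L\<^sup>2\<close>, and it is
dominated by a multiple of \<open>1 / w\<close>, so it may itself serve as a test function.\<close>

definition tame :: "real \<Rightarrow> ('a \<Rightarrow> real) \<Rightarrow> bool" where
  "tame n \<rho> \<longleftrightarrow> \<rho> \<in> L1w \<Omega> w \<and>
     (AE x in M. \<bar>\<rho> x * (w x)\<^sup>2\<bar> \<le> n \<and> \<bar>\<rho> x * (w x)\<^sup>2\<bar> \<le> n * inverse (w x))"

lemma tame_integrable_square:
  assumes "tame n \<rho>"
  shows "integrable M (\<lambda>x. (\<rho> x * (w x)\<^sup>2)\<^sup>2)"
proof (rule integrable_bounded)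
  have [measurable]: "\<rho> \<in> borel_measurable M" using assms L1w_D unfolding tame_def by blast
  show "(\<lambda>x. (\<rho> x * (w x)\<^sup>2)\<^sup>2) \<in> borel_measurable M" by measurable
  show "AE x in M. \<bar>(\<rho> x * (w x)\<^sup>2)\<^sup>2\<bar> \<le> n\<^sup>2"
    using assms unfolding tame_def
    by (auto elim!: eventually_mono simp del: power_mult_distrib intro!: abs_le_square_iff[THEN iffD1])
qed

text \<open>Formally \<open>\<parallel>m'\<parallel>\<^sup>2 = \<langle>m, m' \<circ> \<Phi>\<^sup>t\<rangle> \<le> \<parallel>m\<parallel> \<parallel>m' \<circ> \<Phi>\<^sup>t\<parallel> \<le> K\<^sup>1\<^sup>/\<^sup>2 \<parallel>m\<parallel> \<parallel>m'\<parallel>\<close> for the transported density \<open>m'\<close>.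
As \<open>m'\<close> need not be an admissible test function, it is truncated at multiples of \<open>1 / w\<close>, and
the truncation is removed by Fatou's lemma.\<close>

lemma S_tame_L2_bound:
  assumes t: "0 \<le> t" and tame: "tame n \<rho>"
  shows "integrable M (\<lambda>x. (S t \<rho> x * (w x)\<^sup>2)\<^sup>2)"
    and "(LINT x|M. (S t \<rho> x * (w x)\<^sup>2)\<^sup>2) \<le> exp (\<kappa> * t) * (LINT x|M. (\<rho> x * (w x)\<^sup>2)\<^sup>2)"
proof -
  define K where "K = exp (\<kappa> * t)"
  have K: "0 < K" unfolding K_def by simp
  define m where "m x = \<rho> x * (w x)\<^sup>2" for x
  define m' where "m' x = S t \<rho> x * (w x)\<^sup>2" for x
  have \<rho>: "\<rho> \<in> L1w \<Omega> w" using tame unfolding tame_def by blast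
  have S\<rho>: "S t \<rho> \<in> L1w \<Omega> w" by (rule S_L1w[OF t \<rho>])
  have [measurable]: "\<rho> \<in> borel_measurable M" "S t \<rho> \<in> borel_measurable M"
    using L1w_D \<rho> S\<rho> by blast+
  have [measurable]: "m \<in> borel_measurable M" "m' \<in> borel_measurable M"
    unfolding m_def[abs_def] m'_def[abs_def] by measurable
  have m2: "integrable M (\<lambda>x. (m x)\<^sup>2)" using tame_integrable_square[OF tame] unfolding m_def .
  \<comment> \<open>The modulus only ensures a nonnegative threshold at the null set where \<open>w\<close> is not positive.\<close>
  define \<phi> where "\<phi> j x = clip (real j * inverse \<bar>w x\<bar>) (m' x)" for j :: nat and x
  have [measurable]: "\<phi> j \<in> borel_measurable M" for j unfolding \<phi>_def[abs_def] by measurable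
  have \<phi>_le: "AE x in M. \<bar>\<phi> j x\<bar> \<le> real j * inverse (w x)" for j
    using w_pos
  proof eventually_elim
    case (elim x)
    then show ?case using clip_bounds(1)[of "real j * inverse \<bar>w x\<bar>" "m' x"] unfolding \<phi>_def by simp
  qed
  then have \<phi>_Linfw: "\<phi> j \<in> Linfw \<Omega> w" for j
    unfolding Linfw_iff by (auto intro!: exI[of _ "real j"])
  have sq_le: "(\<phi> j x)\<^sup>2 \<le> m' x * \<phi> j x" for j x
    unfolding \<phi>_def by (rule clip_square_le) simp
  then have nonneg: "0 \<le> m' x * \<phi> j x" for j x by (meson order_trans zero_le_power2)
  have int: "integrable M (\<lambda>x. m' x * \<phi> j x)" for j
    using integrable_pairing[OF S\<rho> \<phi>_Linfw] unfolding m'_def by (simp add: mult_ac)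
  have int_sq: "integrable M (\<lambda>x. (\<phi> j x)\<^sup>2)" for j
    by (rule Bochner_Integration.integrable_bound[OF int[of j]]) (use sq_le nonneg in auto)
  define I where "I j = (LINT x|M. m' x * \<phi> j x)" for j
  have I_le: "I j \<le> K * (LINT x|M. (m x)\<^sup>2)" for j
  proof -
    have \<psi>: "integrable M (\<lambda>x. (\<phi> j (\<Phi> t x))\<^sup>2)" "(LINT x|M. (\<phi> j (\<Phi> t x))\<^sup>2) \<le> K * (LINT x|M. (\<phi> j x)\<^sup>2)"
      using integral_flow_le[OF t int_sq[of j]] unfolding K_def by auto
    have intm: "integrable M (\<lambda>x. m x * \<phi> j (\<Phi> t x))"
      using integrable_pairing[OF \<rho> composition_Linfw[OF t \<phi>_Linfw]]
      unfolding m_def composition_operator_def by (simp add: mult_ac)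
    have "I j = pairing \<Omega> w (S t \<rho>) (\<phi> j)"
      unfolding I_def pairing_def m'_def by (simp add: mult_ac)
    also have "\<dots> = (LINT x|M. m x * \<phi> j (\<Phi> t x))"
      unfolding pairing_S[OF t \<rho> \<phi>_Linfw] unfolding pairing_def m_def by (simp add: mult_ac)
    \<comment> \<open>Young's inequality with weight \<open>K\<close>, so that the last term is absorbed by \<open>I j\<close> itself.\<close>
    also have "\<dots> \<le> (LINT x|M. K / 2 * (m x)\<^sup>2 + 1 / (2 * K) * (\<phi> j (\<Phi> t x))\<^sup>2)"
    proof (rule integral_mono)
      fix x
      have "0 \<le> (K * m x - \<phi> j (\<Phi> t x))\<^sup>2" by simp
      then show "m x * \<phi> j (\<Phi> t x) \<le> K / 2 * (m x)\<^sup>2 + 1 / (2 * K) * (\<phi> j (\<Phi> t x))\<^sup>2"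
        using K by (simp add: power2_diff field_simps power2_eq_square)
    qed (use intm m2 \<psi> in auto)
    also have "\<dots> = K / 2 * (LINT x|M. (m x)\<^sup>2) + 1 / (2 * K) * (LINT x|M. (\<phi> j (\<Phi> t x))\<^sup>2)"
      using m2 \<psi> by simp
    also have "1 / (2 * K) * (LINT x|M. (\<phi> j (\<Phi> t x))\<^sup>2) \<le> 1 / (2 * K) * (K * I j)"
    proof -
      have "(LINT x|M. (\<phi> j x)\<^sup>2) \<le> I j"
        unfolding I_def using sq_le int int_sq by (intro integral_mono) auto
      then have "(LINT x|M. (\<phi> j (\<Phi> t x))\<^sup>2) \<le> K * I j"
        using \<psi>(2) K by (meson mult_left_mono less_imp_le order_trans)
      then show ?thesis using K by (intro mult_left_mono) auto
    qed
    also have "\<dots> = I j / 2" using K by simp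
    finally show ?thesis by simp
  qed
  have "(\<integral>\<^sup>+x. ennreal ((m' x)\<^sup>2) \<partial>M) = (\<integral>\<^sup>+x. liminf (\<lambda>j. ennreal (m' x * \<phi> j x)) \<partial>M)"
  proof (rule nn_integral_cong_AE)
    show "AE x in M. ennreal ((m' x)\<^sup>2) = liminf (\<lambda>j. ennreal (m' x * \<phi> j x))"
      using w_pos
    proof eventually_elim
      case (elim x)
      obtain j0 :: nat where j0: "\<bar>m' x\<bar> * w x \<le> real j0" using real_arch_simple by blast
      have "\<phi> j x = m' x" if "j0 \<le> j" for j
        unfolding \<phi>_def
      proof (rule clip_eq)
        have "\<bar>m' x\<bar> * w x \<le> real j" using j0 that by linarith
        then show "\<bar>m' x\<bar> \<le> real j * inverse \<bar>w x\<bar>" using elim by (simp add: field_simps)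
      qed
      then have "(\<lambda>j. ennreal (m' x * \<phi> j x)) \<longlonglongrightarrow> ennreal ((m' x)\<^sup>2)"
        by (intro tendsto_eventually) (auto simp: power2_eq_square eventually_sequentially intro!: exI[of _ j0])
      then show ?case by (metis lim_imp_Liminf trivial_limit_sequentially)
    qed
  qed
  also have "\<dots> \<le> liminf (\<lambda>j. \<integral>\<^sup>+x. ennreal (m' x * \<phi> j x) \<partial>M)"
    by (rule nn_integral_liminf) measurable
  also have "\<dots> \<le> ennreal (K * (LINT x|M. (m x)\<^sup>2))"
  proof (rule Liminf_le)
    show "\<forall>\<^sub>F j in sequentially. (\<integral>\<^sup>+x. ennreal (m' x * \<phi> j x) \<partial>M) \<le> ennreal (K * (LINT x|M. (m x)\<^sup>2))"
      using I_le nonneg int by (intro always_eventually allI) (simp add: nn_integral_eq_integral I_def ennreal_leI)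
  qed simp
  finally have le: "(\<integral>\<^sup>+x. ennreal ((m' x)\<^sup>2) \<partial>M) \<le> ennreal (K * (LINT x|M. (m x)\<^sup>2))" .
  have intm': "integrable M (\<lambda>x. (m' x)\<^sup>2)"
    using le by (intro integrableI_bounded) (auto intro: le_less_trans simp: ennreal_less_top)
  then show "integrable M (\<lambda>x. (S t \<rho> x * (w x)\<^sup>2)\<^sup>2)" unfolding m'_def .
  show "(LINT x|M. (S t \<rho> x * (w x)\<^sup>2)\<^sup>2) \<le> exp (\<kappa> * t) * (LINT x|M. (\<rho> x * (w x)\<^sup>2)\<^sup>2)"
    using le intm' K unfolding K_def[symmetric] m_def[symmetric] m'_def[symmetric]
    by (simp add: nn_integral_eq_integral integral_nonneg_AE)
qed

text \<open>For bounded continuous functions this is dominated convergence. A bounded measurable function is an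
\<open>L\<^sup>1\<close> limit of such functions, and the bound on volume distortion makes the approximation uniform in
small times.\<close>

lemma composition_tendsto_L1:
  fixes m :: "'a \<Rightarrow> real"
  assumes [measurable]: "m \<in> borel_measurable M" and n: "0 \<le> n" and m_le: "AE x in M. \<bar>m x\<bar> \<le> n"
    and \<tau>: "\<And>i. 0 < \<tau> i" "\<tau> \<longlonglongrightarrow> 0"
  shows "(\<lambda>i. LINT x|M. \<bar>m (\<Phi> (\<tau> i) x) - m x\<bar>) \<longlonglongrightarrow> 0"
proof -
  have \<tau>0: "0 \<le> \<tau> i" for i using \<tau>(1)[of i] by simp
  have meas_flow [measurable]: "(\<lambda>x. h (\<Phi> (\<tau> i) x)) \<in> borel_measurable M"
    if "h \<in> borel_measurable M" for h :: "'a \<Rightarrow> real" and i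
    using that by (rule measurable_flow[OF \<tau>0])
  have "m measurable_on \<Omega>"
    using measurable_on_iff_borel_measurable[of \<Omega> m] \<Omega>_open assms(1) by simp
  then obtain N c0 where N: "negligible N" and c0: "\<And>k. continuous_on UNIV (c0 k)"
    and lim0: "\<And>x. x \<notin> N \<Longrightarrow> (\<lambda>k. c0 k x) \<longlonglongrightarrow> (if x \<in> \<Omega> then m x else 0)"
    unfolding measurable_on_def by blast
  define c where "c k x = clip n (c0 k x)" for k :: nat and x
  have cont: "continuous_on UNIV (c k)" for k
    unfolding c_def clip_def by (intro continuous_intros c0)
  have [measurable]: "c k \<in> borel_measurable M" for k
    using \<Omega>_open cont by (intro continuous_imp_measurable_on_sets_lebesgue) (auto intro: continuous_on_subset)
  have c_le: "\<bar>c k x\<bar> \<le> n" for k x unfolding c_def by (rule clip_bounds(1)[OF n])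
  have "AE x in lebesgue. x \<notin> N" using N by (simp add: AE_not_in negligible_iff_null_sets)
  then have "AE x in M. x \<notin> N" using \<Omega>_open by (auto simp: AE_restrict_space_iff elim: eventually_mono)
  then have lim: "AE x in M. (\<lambda>k. c k x) \<longlonglongrightarrow> m x"
    using m_le AE_space
  proof eventually_elim
    case (elim x)
    have "(\<lambda>k. clip n (c0 k x)) \<longlonglongrightarrow> clip n (m x)"
      using lim0[of x] elim unfolding clip_def by (intro tendsto_intros) auto
    then show ?case using elim clip_eq[of "m x" n] unfolding c_def by simp
  qed
  have c_m_le: "AE x in M. \<bar>c k x - m x\<bar> \<le> 2 * n" for k
    using m_le
  proof eventually_elim
    case (elim x)
    then show ?case using c_le[of k x] by linarith
  qed
  have c_c_le: "\<bar>c k x - c k y\<bar> \<le> 2 * n" for k x y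
    using c_le[of k x] c_le[of k y] by linarith
  have int_c: "integrable M (\<lambda>x. \<bar>c k x - m x\<bar>)" for k
    using c_m_le[of k] by (intro integrable_bounded[where C = "2 * n"]) auto
  have L1: "(\<lambda>k. LINT x|M. \<bar>c k x - m x\<bar>) \<longlonglongrightarrow> (LINT x|M. 0)"
  proof (rule integral_dominated_convergence[where w = "\<lambda>_. 2 * n"])
    show "AE x in M. (\<lambda>k. \<bar>c k x - m x\<bar>) \<longlonglongrightarrow> 0"
      using lim by eventually_elim (intro tendsto_rabs_zero LIM_zero)
    show "AE x in M. norm \<bar>c k x - m x\<bar> \<le> 2 * n" for k
      using c_m_le[of k] by simp
  qed (use finite_measure.integrable_const[OF finite_M] in auto)
  have mid: "(\<lambda>i. LINT x|M. \<bar>c k (\<Phi> (\<tau> i) x) - c k x\<bar>) \<longlonglongrightarrow> (LINT x|M. 0)" for k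
  proof (rule integral_dominated_convergence[where w = "\<lambda>_. 2 * n"])
    show "AE x in M. (\<lambda>i. \<bar>c k (\<Phi> (\<tau> i) x) - c k x\<bar>) \<longlonglongrightarrow> 0"
      using AE_space
    proof eventually_elim
      case (elim x)
      then have "x \<in> \<Omega>" by simp
      have "filterlim \<tau> (at_right 0) sequentially"
        using \<tau>(2) less_imp_neq[OF \<tau>(1), symmetric] \<tau>(1) by (simp add: filterlim_at)
      then have "(\<lambda>i. \<Phi> (\<tau> i) x) \<longlonglongrightarrow> x"
        by (rule filterlim_compose[OF flow_tendsto[OF \<open>x \<in> \<Omega>\<close>]])
      then have "(\<lambda>i. c k (\<Phi> (\<tau> i) x)) \<longlonglongrightarrow> c k x"
        using cont[of k] by (intro isCont_tendsto_compose[of x "c k"]) (auto simp: continuous_on_eq_continuous_at)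
      then show ?case by (intro tendsto_rabs_zero LIM_zero)
    qed
    show "AE x in M. norm \<bar>c k (\<Phi> (\<tau> i) x) - c k x\<bar> \<le> 2 * n" for i
      using c_c_le[of k] by simp
  qed (use finite_measure.integrable_const[OF finite_M] in auto)
  show ?thesis
  proof (rule LIMSEQ_I)
    fix e :: real assume e: "0 < e"
    \<comment> \<open>A bound for the volume distortion at all times up to 1.\<close>
    define E where "E = exp \<bar>\<kappa>\<bar>"
    have E: "0 < E" unfolding E_def by simp
    \<comment> \<open>The three error terms below add up to at most \<open>E * \<delta> + e / 2 + \<delta> = e\<close>.\<close>
    define \<delta> where "\<delta> = e / (2 * (E + 1))"
    have \<delta>: "0 < \<delta>" unfolding \<delta>_def using e E by simp
    have "\<forall>\<^sub>F k in sequentially. (LINT x|M. \<bar>c k x - m x\<bar>) < \<delta>"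
      using L1 \<delta> by (intro order_tendstoD(2)) auto
    then obtain k where k: "(LINT x|M. \<bar>c k x - m x\<bar>) < \<delta>"
      unfolding eventually_sequentially by blast
    have "\<forall>\<^sub>F i in sequentially. (LINT x|M. \<bar>c k (\<Phi> (\<tau> i) x) - c k x\<bar>) < e / 2"
      using mid[of k] e by (intro order_tendstoD(2)) auto
    moreover have "\<forall>\<^sub>F i in sequentially. \<tau> i < 1"
      using \<tau>(2) by (intro order_tendstoD(2)) auto
    ultimately have "\<forall>\<^sub>F i in sequentially. norm ((LINT x|M. \<bar>m (\<Phi> (\<tau> i) x) - m x\<bar>) - 0) < e"
    proof eventually_elim
      case (elim i)
      note flow = integral_flow_le[OF \<tau>0[of i] int_c[of k]]
      have int_mid: "integrable M (\<lambda>x. \<bar>c k (\<Phi> (\<tau> i) x) - c k x\<bar>)"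
        using c_c_le[of k] by (intro integrable_bounded[where C = "2 * n"] AE_I2) auto
      have "(LINT x|M. \<bar>m (\<Phi> (\<tau> i) x) - m x\<bar>) \<le>
          (LINT x|M. \<bar>c k (\<Phi> (\<tau> i) x) - m (\<Phi> (\<tau> i) x)\<bar> + (\<bar>c k (\<Phi> (\<tau> i) x) - c k x\<bar> + \<bar>c k x - m x\<bar>))"
      proof (rule integral_mono_AE)
        show "integrable M (\<lambda>x. \<bar>m (\<Phi> (\<tau> i) x) - m x\<bar>)"
        proof (rule integrable_bounded)
          show "AE x in M. \<bar>\<bar>m (\<Phi> (\<tau> i) x) - m x\<bar>\<bar> \<le> 2 * n"
            using m_le AE_flow[OF \<tau>0[of i] m_le] by eventually_elim linarith
        qed measurable
      qed (use flow(1) int_mid int_c in auto)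
      also have "\<dots> = (LINT x|M. \<bar>c k (\<Phi> (\<tau> i) x) - m (\<Phi> (\<tau> i) x)\<bar>)
          + ((LINT x|M. \<bar>c k (\<Phi> (\<tau> i) x) - c k x\<bar>) + (LINT x|M. \<bar>c k x - m x\<bar>))"
        using flow(1) int_mid int_c by simp
      also have "(LINT x|M. \<bar>c k (\<Phi> (\<tau> i) x) - m (\<Phi> (\<tau> i) x)\<bar>) \<le> E * \<delta>"
      proof -
        have "exp (\<kappa> * \<tau> i) \<le> E"
          unfolding E_def using elim \<tau>0[of i] by (simp) (smt (verit) mult_left_le abs_ge_self mult_right_mono abs_ge_zero)
        then have "exp (\<kappa> * \<tau> i) * (LINT x|M. \<bar>c k x - m x\<bar>) \<le> E * \<delta>"
          using k by (intro mult_mono) (auto simp: E_def)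
        then show ?thesis using flow(2) by simp
      qed
      finally have "(LINT x|M. \<bar>m (\<Phi> (\<tau> i) x) - m x\<bar>) < E * \<delta> + (e / 2 + \<delta>)"
        using elim k by simp
      also have "\<dots> = e"
      proof -
        have "2 * (E + 1) * \<delta> = e" unfolding \<delta>_def using E by simp
        then show ?thesis by (simp add: algebra_simps)
      qed
      finally show ?case by (simp add: integral_nonneg_AE)
    qed
    then show "\<exists>no. \<forall>i\<ge>no. norm ((LINT x|M. \<bar>m (\<Phi> (\<tau> i) x) - m x\<bar>) - 0) < e"
      unfolding eventually_sequentially .
  qed
qed

text \<open>Expanding the square, \<open>\<parallel>m' - m\<parallel>\<^sup>2 \<le> (K + 1) \<parallel>m\<parallel>\<^sup>2 - 2 \<langle>m', m\<rangle>\<close> with \<open>K \<rightarrow> 1\<close>, and \<open>\<langle>m', m\<rangle> = \<langle>m, m \<circ> \<Phi>\<^sup>t\<rangle>\<close>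
tends to \<open>\<parallel>m\<parallel>\<^sup>2\<close>. Convergence in \<open>L\<^sup>2\<close> implies convergence in \<open>L\<^sup>1\<^sub>w\<close>, because \<open>\<Omega>\<close> has finite measure
and \<open>1 / w\<close> is bounded.\<close>

lemma S_tame_tendsto:
  assumes tame: "tame n \<rho>" and n: "0 \<le> n"
    and \<tau>: "\<And>i. 0 < \<tau> i" "\<tau> \<longlonglongrightarrow> 0"
  shows "(\<lambda>i. norm_L1w \<Omega> w (\<lambda>x. S (\<tau> i) \<rho> x - \<rho> x)) \<longlonglongrightarrow> 0"
proof -
  have \<tau>0: "0 \<le> \<tau> i" for i using \<tau>(1)[of i] by simp
  have \<rho>: "\<rho> \<in> L1w \<Omega> w" using tame unfolding tame_def by blast
  have S\<rho>: "S (\<tau> i) \<rho> \<in> L1w \<Omega> w" for i by (rule S_L1w[OF \<tau>0 \<rho>])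
  have [measurable]: "\<rho> \<in> borel_measurable M" "S (\<tau> i) \<rho> \<in> borel_measurable M" for i
    using L1w_D \<rho> S\<rho> by blast+
  define m where "m x = \<rho> x * (w x)\<^sup>2" for x
  define m' where "m' i x = S (\<tau> i) \<rho> x * (w x)\<^sup>2" for i x
  have [measurable]: "m \<in> borel_measurable M" "m' i \<in> borel_measurable M" for i
    unfolding m_def[abs_def] m'_def[abs_def] by measurable
  have m_le: "AE x in M. \<bar>m x\<bar> \<le> n" and m_le_w: "AE x in M. \<bar>m x\<bar> \<le> n * inverse (w x)"
    using tame unfolding tame_def m_def by (auto elim: eventually_mono)
  have m_Linfw: "m \<in> Linfw \<Omega> w" unfolding Linfw_iff using m_le_w by auto
  have m2: "integrable M (\<lambda>x. (m x)\<^sup>2)"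
    using tame_integrable_square[OF tame] unfolding m_def .
  have m'2: "integrable M (\<lambda>x. (m' i x)\<^sup>2)" "(LINT x|M. (m' i x)\<^sup>2) \<le> exp (\<kappa> * \<tau> i) * (LINT x|M. (m x)\<^sup>2)" for i
    using S_tame_L2_bound[OF \<tau>0 tame] unfolding m_def m'_def by auto
  have cross_int: "integrable M (\<lambda>x. m' i x * m x)" for i
    using integrable_pairing[OF S\<rho> m_Linfw] unfolding m'_def by (simp add: mult_ac)
  define osc where "osc i = (LINT x|M. \<bar>m (\<Phi> (\<tau> i) x) - m x\<bar>)" for i
  have osc: "osc \<longlonglongrightarrow> 0"
    unfolding osc_def using n m_le \<tau> by (intro composition_tendsto_L1) auto
  have cross: "(LINT x|M. (m x)\<^sup>2) - n * osc i \<le> (LINT x|M. m' i x * m x)" for i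
  proof -
    have meas: "(\<lambda>x. m (\<Phi> (\<tau> i) x)) \<in> borel_measurable M"
      by (rule measurable_flow[OF \<tau>0]) measurable
    have int_osc: "integrable M (\<lambda>x. \<bar>m (\<Phi> (\<tau> i) x) - m x\<bar>)"
    proof (rule integrable_bounded)
      show "AE x in M. \<bar>\<bar>m (\<Phi> (\<tau> i) x) - m x\<bar>\<bar> \<le> 2 * n"
        using m_le AE_flow[OF \<tau>0[of i] m_le] by eventually_elim linarith
    qed (use meas in measurable)
    have "(LINT x|M. (m x)\<^sup>2) - n * osc i = (LINT x|M. (m x)\<^sup>2 - n * \<bar>m (\<Phi> (\<tau> i) x) - m x\<bar>)"
      unfolding osc_def using m2 int_osc by simp
    also have "\<dots> \<le> (LINT x|M. m x * m (\<Phi> (\<tau> i) x))"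
    proof (rule integral_mono_AE)
      show "integrable M (\<lambda>x. m x * m (\<Phi> (\<tau> i) x))"
        using integrable_pairing[OF \<rho> composition_Linfw[OF \<tau>0 m_Linfw]]
        unfolding m_def composition_operator_def by (simp add: mult_ac)
      show "AE x in M. (m x)\<^sup>2 - n * \<bar>m (\<Phi> (\<tau> i) x) - m x\<bar> \<le> m x * m (\<Phi> (\<tau> i) x)"
        using m_le
      proof eventually_elim
        case (elim x)
        have "- (m x * (m (\<Phi> (\<tau> i) x) - m x)) \<le> \<bar>m x * (m (\<Phi> (\<tau> i) x) - m x)\<bar>" by linarith
        also have "\<dots> \<le> n * \<bar>m (\<Phi> (\<tau> i) x) - m x\<bar>"
          using elim unfolding abs_mult by (intro mult_right_mono) auto
        finally show ?case by (simp add: power2_eq_square algebra_simps)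
      qed
    qed (use m2 int_osc in auto)
    also have "\<dots> = pairing \<Omega> w \<rho> (\<lambda>x. m (\<Phi> (\<tau> i) x))"
      unfolding pairing_def by (rule Bochner_Integration.integral_cong) (simp_all add: m_def[of "_ :: 'a"] mult_ac)
    also have "\<dots> = pairing \<Omega> w (S (\<tau> i) \<rho>) m"
      by (rule pairing_S[OF \<tau>0 \<rho> m_Linfw, symmetric])
    also have "\<dots> = (LINT x|M. m' i x * m x)"
      unfolding pairing_def m'_def by (simp add: mult_ac)
    finally show ?thesis .
  qed
  define R where "R i = (exp (\<kappa> * \<tau> i) - 1) * (LINT x|M. (m x)\<^sup>2) + 2 * n * osc i" for i
  have "R \<longlonglongrightarrow> (exp (\<kappa> * 0) - 1) * (LINT x|M. (m x)\<^sup>2) + 2 * n * 0"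
    unfolding R_def by (intro tendsto_intros \<tau> osc)
  then have R: "R \<longlonglongrightarrow> 0" by simp
  have sq_int: "integrable M (\<lambda>x. (m' i x - m x)\<^sup>2)" for i
    using m'2(1)[of i] m2 cross_int[of i] by (simp add: power2_diff mult.assoc)
  have sq_le: "(LINT x|M. (m' i x - m x)\<^sup>2) \<le> R i" for i
  proof -
    have "(LINT x|M. (m' i x - m x)\<^sup>2) = (LINT x|M. (m' i x)\<^sup>2) + (LINT x|M. (m x)\<^sup>2) - 2 * (LINT x|M. m' i x * m x)"
      using m'2(1)[of i] m2 cross_int[of i] by (simp add: power2_diff mult.assoc)
    also have "\<dots> \<le> R i"
      using m'2(2)[of i] cross[of i] unfolding R_def by (simp add: algebra_simps)
    finally show ?thesis .
  qed
  \<comment> \<open>Young's inequality \<open>y \<le> \<delta> / 2 + y\<^sup>2 / (2 \<delta>)\<close> compares the \<open>L\<^sup>1\<close> norm with the \<open>L\<^sup>2\<close> norm.\<close>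
  have norm_le: "norm_L1w \<Omega> w (\<lambda>x. S (\<tau> i) \<rho> x - \<rho> x) \<le> \<bar>B\<bar> * (\<delta> / 2 * measure M \<Omega> + R i / (2 * \<delta>))"
    if \<delta>: "0 < \<delta>" for \<delta> i
  proof -
    have "norm_L1w \<Omega> w (\<lambda>x. S (\<tau> i) \<rho> x - \<rho> x) \<le> (LINT x|M. \<bar>B\<bar> * (\<delta> / 2 + (m' i x - m x)\<^sup>2 / (2 * \<delta>)))"
      unfolding norm_L1w_def
    proof (rule integral_mono_AE)
      show "AE x in M. \<bar>S (\<tau> i) \<rho> x - \<rho> x\<bar> * w x \<le> \<bar>B\<bar> * (\<delta> / 2 + (m' i x - m x)\<^sup>2 / (2 * \<delta>))"
        using w_pos w_inv_le
      proof eventually_elim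
        case (elim x)
        define y where "y = \<bar>m' i x - m x\<bar>"
        have "\<bar>S (\<tau> i) \<rho> x - \<rho> x\<bar> * w x = y * inverse (w x)"
        proof -
          have "m' i x - m x = (S (\<tau> i) \<rho> x - \<rho> x) * (w x)\<^sup>2" unfolding m'_def m_def by (simp add: left_diff_distrib)
          then show ?thesis using elim unfolding y_def by (simp add: abs_mult power2_eq_square)
        qed
        also have "\<dots> \<le> y * \<bar>B\<bar>" using elim unfolding y_def by (intro mult_left_mono) auto
        also have "\<dots> \<le> (\<delta> / 2 + y\<^sup>2 / (2 * \<delta>)) * \<bar>B\<bar>"
        proof (rule mult_right_mono)
          have "0 \<le> (y - \<delta>)\<^sup>2" by simp
          then show "y \<le> \<delta> / 2 + y\<^sup>2 / (2 * \<delta>)"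
            using \<delta> by (simp add: power2_diff field_simps power2_eq_square)
        qed simp
        finally show ?case unfolding y_def by (simp add: mult.commute)
      qed
      show "integrable M (\<lambda>x. \<bar>B\<bar> * (\<delta> / 2 + (m' i x - m x)\<^sup>2 / (2 * \<delta>)))"
        by (intro integrable_mult_right Bochner_Integration.integrable_add integrable_divide
            finite_measure.integrable_const[OF finite_M] sq_int)
    qed (use L1w_D(2)[OF L1w_diff[OF S\<rho> \<rho>]] in simp)
    also have "\<dots> = \<bar>B\<bar> * (\<delta> / 2 * measure M \<Omega> + (LINT x|M. (m' i x - m x)\<^sup>2) / (2 * \<delta>))"
    proof -
      have "(LINT x|M. \<delta> / 2 + (m' i x - m x)\<^sup>2 / (2 * \<delta>))
          = (LINT x|M. \<delta> / 2) + (LINT x|M. (m' i x - m x)\<^sup>2 / (2 * \<delta>))"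
        by (intro Bochner_Integration.integral_add integrable_divide
            finite_measure.integrable_const[OF finite_M] sq_int)
      then show ?thesis by simp
    qed
    also have "\<dots> \<le> \<bar>B\<bar> * (\<delta> / 2 * measure M \<Omega> + R i / (2 * \<delta>))"
      using sq_le[of i] \<delta> by (intro mult_left_mono add_left_mono divide_right_mono) auto
    finally show ?thesis .
  qed
  have norm_nonneg: "0 \<le> norm_L1w \<Omega> w (\<lambda>x. S (\<tau> i) \<rho> x - \<rho> x)" for i
    unfolding norm_L1w_def using w_pos by (intro integral_nonneg_AE) (auto elim: eventually_mono)
  show ?thesis
  proof (rule LIMSEQ_I)
    fix e :: real assume e: "0 < e"
    define A where "A = \<bar>B\<bar> * measure M \<Omega> + 1"
    have A: "0 < A" unfolding A_def by (simp add: add_nonneg_pos)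
    define \<delta> where "\<delta> = e / A"
    have \<delta>: "0 < \<delta>" unfolding \<delta>_def using e A by simp
    have "(\<lambda>i. \<bar>B\<bar> * (R i / (2 * \<delta>))) \<longlonglongrightarrow> \<bar>B\<bar> * (0 / (2 * \<delta>))"
      using \<delta> by (intro tendsto_intros R) auto
    then have "\<forall>\<^sub>F i in sequentially. \<bar>B\<bar> * (R i / (2 * \<delta>)) < e / 2"
      using e by (intro order_tendstoD(2)) auto
    then have "\<forall>\<^sub>F i in sequentially. norm (norm_L1w \<Omega> w (\<lambda>x. S (\<tau> i) \<rho> x - \<rho> x) - 0) < e"
    proof eventually_elim
      case (elim i)
      have "\<bar>B\<bar> * (\<delta> / 2 * measure M \<Omega>) = (\<bar>B\<bar> * measure M \<Omega>) * \<delta> / 2" by simp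
      also have "\<dots> \<le> A * \<delta> / 2" using \<delta> unfolding A_def by (intro divide_right_mono mult_right_mono) auto
      also have "\<dots> = e / 2" unfolding \<delta>_def using A by simp
      finally show ?case
        using norm_le[OF \<delta>, of i] elim norm_nonneg[of i] by (simp add: distrib_left)
    qed
    then show "\<exists>no. \<forall>i\<ge>no. norm (norm_L1w \<Omega> w (\<lambda>x. S (\<tau> i) \<rho> x - \<rho> x) - 0) < e"
      unfolding eventually_sequentially .
  qed
qed

lemma tame_dense:
  assumes \<rho>: "\<rho> \<in> L1w \<Omega> w" and e: "0 < e"
  obtains n \<sigma> where "0 \<le> n" "tame n \<sigma>" "norm_L1w \<Omega> w (\<lambda>x. \<rho> x - \<sigma> x) < e"
proof -
  have [measurable]: "\<rho> \<in> borel_measurable M" using L1w_D \<rho> by blast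
  \<comment> \<open>Truncation at this threshold makes the density bounded and admissible as a test function.\<close>
  define b where "b j x = min (real j) (real j * inverse \<bar>w x\<bar>)" for j :: nat and x
  have b: "0 \<le> b j x" for j x unfolding b_def by simp
  define \<sigma> where "\<sigma> j x = clip (b j x) (\<rho> x * (w x)\<^sup>2) * (inverse (w x))\<^sup>2" for j x
  have [measurable]: "\<sigma> j \<in> borel_measurable M" for j
    unfolding \<sigma>_def[abs_def] b_def by measurable
  have \<sigma>_w: "AE x in M. \<sigma> j x * (w x)\<^sup>2 = clip (b j x) (\<rho> x * (w x)\<^sup>2)" for j
    using w_pos
  proof eventually_elim
    case (elim x)
    then have "(inverse (w x))\<^sup>2 * (w x)\<^sup>2 = 1" by (simp flip: power_mult_distrib)
    then show ?case by (simp add: \<sigma>_def mult.assoc)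
  qed
  have \<sigma>_le: "AE x in M. \<bar>\<sigma> j x\<bar> * w x \<le> \<bar>\<rho> x\<bar> * w x \<and> \<bar>\<rho> x - \<sigma> j x\<bar> * w x \<le> \<bar>\<rho> x\<bar> * w x" for j
    using \<sigma>_w[of j] w_pos
  proof eventually_elim
    case (elim x)
    have "\<bar>\<sigma> j x\<bar> * (w x)\<^sup>2 \<le> \<bar>\<rho> x\<bar> * (w x)\<^sup>2"
      using clip_bounds(2)[OF b, of j x "\<rho> x * (w x)\<^sup>2"] elim(1)[symmetric] by (simp add: abs_mult)
    moreover have "\<bar>\<rho> x - \<sigma> j x\<bar> * (w x)\<^sup>2 \<le> \<bar>\<rho> x\<bar> * (w x)\<^sup>2"
    proof -
      have "\<bar>(\<rho> x - \<sigma> j x) * (w x)\<^sup>2\<bar> \<le> \<bar>\<rho> x * (w x)\<^sup>2\<bar>"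
        using clip_bounds(3)[OF b, of "\<rho> x * (w x)\<^sup>2" j x] elim(1) by (simp add: left_diff_distrib)
      then show ?thesis by (simp add: abs_mult)
    qed
    ultimately show ?case using elim by simp
  qed
  have \<sigma>_L1w: "\<sigma> j \<in> L1w \<Omega> w" for j
  proof -
    have "integrable M (\<lambda>x. \<bar>\<sigma> j x\<bar> * w x)"
    proof (rule Bochner_Integration.integrable_bound[OF L1w_D(2)[OF \<rho>]])
      show "AE x in M. norm (\<bar>\<sigma> j x\<bar> * w x) \<le> norm (\<bar>\<rho> x\<bar> * w x)"
        using \<sigma>_le[of j] w_pos by eventually_elim simp
    qed measurable
    then show ?thesis unfolding L1w_def by simp
  qed
  have tame: "tame (real j) (\<sigma> j)" for j
    unfolding tame_def
  proof (intro conjI \<sigma>_L1w)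
    show "AE x in M. \<bar>\<sigma> j x * (w x)\<^sup>2\<bar> \<le> real j \<and> \<bar>\<sigma> j x * (w x)\<^sup>2\<bar> \<le> real j * inverse (w x)"
      using \<sigma>_w[of j] w_pos
    proof eventually_elim
      case (elim x)
      have "\<bar>\<sigma> j x * (w x)\<^sup>2\<bar> \<le> b j x" unfolding elim(1) by (rule clip_bounds(1)[OF b])
      then show ?case using elim(2) unfolding b_def by simp
    qed
  qed
  have "(\<lambda>j. LINT x|M. \<bar>\<rho> x - \<sigma> j x\<bar> * w x) \<longlonglongrightarrow> (LINT x|M. 0)"
  proof (rule integral_dominated_convergence[OF _ _ L1w_D(2)[OF \<rho>]])
    show "AE x in M. (\<lambda>j. \<bar>\<rho> x - \<sigma> j x\<bar> * w x) \<longlonglongrightarrow> 0"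
      using w_pos
    proof eventually_elim
      case (elim x)
      define c where "c = \<bar>\<rho> x * (w x)\<^sup>2\<bar>"
      obtain j0 :: nat where j0: "max c (c * w x) \<le> real j0" using real_arch_simple by blast
      have "\<sigma> j x = \<rho> x" if "j0 \<le> j" for j
      proof -
        have "c \<le> real j" "c * w x \<le> real j" using j0 that by auto
        then have "c \<le> b j x" using elim unfolding b_def by (simp add: field_simps)
        then have "clip (b j x) (\<rho> x * (w x)\<^sup>2) = \<rho> x * (w x)\<^sup>2"
          unfolding c_def by (rule clip_eq)
        moreover have "(w x)\<^sup>2 * (inverse (w x))\<^sup>2 = 1"
          using elim by (simp flip: power_mult_distrib)
        ultimately show ?thesis unfolding \<sigma>_def by (simp add: mult.assoc)
      qed
      then show ?case by (intro tendsto_eventually) (auto simp: eventually_sequentially intro!: exI[of _ j0])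
    qed
    show "AE x in M. norm (\<bar>\<rho> x - \<sigma> j x\<bar> * w x) \<le> \<bar>\<rho> x\<bar> * w x" for j
      using \<sigma>_le[of j] w_pos by eventually_elim simp
  qed measurable
  then have "\<forall>\<^sub>F j in sequentially. (LINT x|M. \<bar>\<rho> x - \<sigma> j x\<bar> * w x) < e"
    using e by (intro order_tendstoD(2)) auto
  then obtain j where "(LINT x|M. \<bar>\<rho> x - \<sigma> j x\<bar> * w x) < e"
    unfolding eventually_sequentially by blast
  then show ?thesis
    using tame[of j] by (intro that[of "real j" "\<sigma> j"]) (auto simp: norm_L1w_def)
qed

theorem S_strongly_continuous:
  assumes \<rho>: "\<rho> \<in> L1w \<Omega> w"
  shows "((\<lambda>t. norm_L1w \<Omega> w (\<lambda>x. S t \<rho> x - \<rho> x)) \<longlongrightarrow> 0) (at_right 0)"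
  unfolding tendsto_at_iff_sequentially comp_def
proof (intro allI impI)
  fix \<tau> :: "nat \<Rightarrow> real" assume *: "\<forall>i. \<tau> i \<in> {0<..} - {0}" and lim: "\<tau> \<longlonglongrightarrow> 0"
  have \<tau>: "0 < \<tau> i" "0 \<le> \<tau> i" for i using * by (auto simp: less_imp_le)
  show "(\<lambda>i. norm_L1w \<Omega> w (\<lambda>x. S (\<tau> i) \<rho> x - \<rho> x)) \<longlonglongrightarrow> 0"
  proof (rule LIMSEQ_I)
    fix e :: real assume e: "0 < e"
    obtain n \<sigma> where n: "0 \<le> n" and tame: "tame n \<sigma>" and close: "norm_L1w \<Omega> w (\<lambda>x. \<rho> x - \<sigma> x) < e / 3"
      using tame_dense[OF \<rho>, of "e / 3"] e by auto
    have \<sigma>: "\<sigma> \<in> L1w \<Omega> w" using tame unfolding tame_def by blast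
    have "\<forall>\<^sub>F i in sequentially. norm_L1w \<Omega> w (\<lambda>x. S (\<tau> i) \<sigma> x - \<sigma> x) < e / 3"
      using S_tame_tendsto[OF tame n \<tau>(1) lim] e by (intro order_tendstoD(2)) auto
    then have "\<forall>\<^sub>F i in sequentially. norm (norm_L1w \<Omega> w (\<lambda>x. S (\<tau> i) \<rho> x - \<rho> x) - 0) < e"
    proof eventually_elim
      case (elim i)
      note S\<rho> = S_L1w[OF \<tau>(2)[of i] \<rho>] and S\<sigma> = S_L1w[OF \<tau>(2)[of i] \<sigma>]
      have "norm_L1w \<Omega> w (\<lambda>x. S (\<tau> i) \<rho> x - S (\<tau> i) \<sigma> x) = norm_L1w \<Omega> w (S (\<tau> i) (\<lambda>x. 1 * \<rho> x + (- 1) * \<sigma> x))"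
      proof (rule norm_L1w_cong)
        have "bounded_operator_L1w \<Omega> w (S (\<tau> i))"
          using preadjoint[OF \<tau>(2)] unfolding is_preadjoint_def by blast
        then have "AE x in M. S (\<tau> i) (\<lambda>y. 1 * \<rho> y + (- 1) * \<sigma> y) x = 1 * S (\<tau> i) \<rho> x + (- 1) * S (\<tau> i) \<sigma> x"
          using \<rho> \<sigma> unfolding bounded_operator_L1w_def by blast
        then show "AE x in M. S (\<tau> i) \<rho> x - S (\<tau> i) \<sigma> x = S (\<tau> i) (\<lambda>x. 1 * \<rho> x + (- 1) * \<sigma> x) x"
          by eventually_elim simp
      qed (intro L1w_diff S\<rho> S\<sigma>, intro S_L1w \<tau> L1w_combination \<rho> \<sigma>)
      also have "\<dots> \<le> exp (\<omega> * \<tau> i) * norm_L1w \<Omega> w (\<lambda>x. 1 * \<rho> x + (- 1) * \<sigma> x)"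
        by (intro norm_S_le \<tau> L1w_combination \<rho> \<sigma>)
      also have "\<dots> \<le> 1 * norm_L1w \<Omega> w (\<lambda>x. 1 * \<rho> x + (- 1) * \<sigma> x)"
      proof (rule mult_right_mono)
        show "exp (\<omega> * \<tau> i) \<le> 1" using \<omega>_nonpos \<tau>(2)[of i] by (simp add: mult_nonpos_nonneg)
        show "0 \<le> norm_L1w \<Omega> w (\<lambda>x. 1 * \<rho> x + (- 1) * \<sigma> x)"
          unfolding norm_L1w_def using w_pos by (intro integral_nonneg_AE) (auto elim: eventually_mono)
      qed
      finally have 1: "norm_L1w \<Omega> w (\<lambda>x. S (\<tau> i) \<rho> x - S (\<tau> i) \<sigma> x) \<le> norm_L1w \<Omega> w (\<lambda>x. \<rho> x - \<sigma> x)" by simp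
      have 2: "norm_L1w \<Omega> w (\<lambda>x. \<sigma> x - \<rho> x) = norm_L1w \<Omega> w (\<lambda>x. \<rho> x - \<sigma> x)"
        unfolding norm_L1w_def by (simp add: abs_minus_commute)
      have "norm_L1w \<Omega> w (\<lambda>x. S (\<tau> i) \<rho> x - \<rho> x) < e"
        using norm_L1w_triangle[OF S\<rho> S\<sigma> \<rho>] norm_L1w_triangle[OF S\<sigma> \<sigma> \<rho>] 1 2 elim close by linarith
      moreover have "0 \<le> norm_L1w \<Omega> w (\<lambda>x. S (\<tau> i) \<rho> x - \<rho> x)"
        unfolding norm_L1w_def using w_pos by (intro integral_nonneg_AE) (auto elim: eventually_mono)
      ultimately show ?case by simp
    qed
    then show "\<exists>no. \<forall>i\<ge>no. norm (norm_L1w \<Omega> w (\<lambda>x. S (\<tau> i) \<rho> x - \<rho> x) - 0) < e"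
      unfolding eventually_sequentially .
  qed
qed

theorem semigroup_S: "semigroup_L1w \<Omega> w S"
  unfolding semigroup_L1w_def
  using preadjoint S_0 S_add S_strongly_continuous unfolding is_preadjoint_def by blast

end

section \<open>Trajectories stay in the domain\<close>

lemma unweighted_Linfw_AE_bounded:
  assumes "\<phi> \<in> Linfw \<Omega> (\<lambda>_. 1)"
  obtains C where "0 \<le> C" "AE x in lebesgue_on \<Omega>. \<bar>\<phi> x\<bar> \<le> C"
proof -
  have "esssup (lebesgue_on \<Omega>) (\<lambda>x. ereal \<bar>\<phi> x\<bar>) < \<infinity>" using assms unfolding Linfw_def by simp
  then obtain C where C: "esssup (lebesgue_on \<Omega>) (\<lambda>x. ereal \<bar>\<phi> x\<bar>) \<le> ereal C"
    by (cases "esssup (lebesgue_on \<Omega>) (\<lambda>x. ereal \<bar>\<phi> x\<bar>)") auto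
  have "AE x in lebesgue_on \<Omega>. \<bar>\<phi> x\<bar> \<le> max 0 C"
    using esssup_AE[where M = "lebesgue_on \<Omega>" and f = "\<lambda>x. ereal \<bar>\<phi> x\<bar>"]
  proof eventually_elim
    case (elim x)
    then have "ereal \<bar>\<phi> x\<bar> \<le> ereal C" using C by (rule order_trans)
    then show ?case by simp
  qed
  then show ?thesis by (intro that[of "max 0 C"]) auto
qed

text \<open>The indicator of the exterior of \<open>\<Omega>\<close> vanishes on \<open>\<Omega>\<close>, so its pairing with any function is 0. By the
preadjoint identity the points of \<open>\<Omega>\<close> carried to the exterior form a null set; this set is open, hence
empty.\<close>

lemma preadjoint_imp_flow_in_closure:
  fixes \<Omega> :: "'a::euclidean_space set"
  assumes \<Omega>: "open \<Omega>" "bounded \<Omega>"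
    and cont: "continuous_on \<Omega> (\<Phi> t)"
    and w [measurable]: "w \<in> borel_measurable (lebesgue_on \<Omega>)"
    and w_pos: "AE x in lebesgue_on \<Omega>. 0 < w x"
    and w_inv: "AE x in lebesgue_on \<Omega>. inverse (w x) \<le> B"
    and pre: "is_preadjoint \<Omega> w T (composition_operator \<Phi> t)"
    and x: "x \<in> \<Omega>"
  shows "\<Phi> t x \<in> closure \<Omega>"
proof -
  let ?M = "lebesgue_on \<Omega>"
  have fin: "finite_measure ?M"
    using \<Omega> by (intro finite_measure_lebesgue_on) (simp add: bounded_set_imp_lmeasurable)
  define A where "A = {y \<in> \<Omega>. \<Phi> t y \<in> - closure \<Omega>}"
  have "A = \<Omega> \<inter> \<Phi> t -` (- closure \<Omega>)" unfolding A_def by auto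
  then have A: "open A"
    using continuous_open_preimage[OF cont \<Omega>(1)] by (simp add: open_Compl)
  have [measurable]: "A \<in> sets ?M"
    using A \<Omega> by (auto simp: sets_restrict_space_iff A_def)
  \<comment> \<open>With this choice \<open>\<rho> w\<^sup>2 = 1\<close>, so the pairing with an indicator is a Lebesgue measure.\<close>
  define \<rho> where "\<rho> y = (inverse (w y))\<^sup>2" for y
  define \<phi> where "\<phi> y = (indicator (- closure \<Omega>) y :: real)" for y
  have \<phi>0: "\<phi> y = 0" if "y \<in> \<Omega>" for y
    using that closure_subset[of \<Omega>] unfolding \<phi>_def by auto
  have "\<rho> \<in> L1w \<Omega> w"
  proof -
    have "integrable ?M (\<lambda>y. \<bar>\<rho> y\<bar> * w y)"
    proof (rule finite_measure.integrable_const_bound[OF fin])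
      show "AE y in ?M. norm (\<bar>\<rho> y\<bar> * w y) \<le> B"
        using w_pos w_inv by eventually_elim (simp add: \<rho>_def abs_mult power2_eq_square mult.assoc)
    qed (unfold \<rho>_def, measurable)
    then show ?thesis unfolding L1w_def \<rho>_def by simp
  qed
  moreover have "\<phi> \<in> Linfw \<Omega> w"
  proof -
    have "\<phi> \<in> borel_measurable ?M"
      by (subst measurable_cong[of _ _ "\<lambda>_. 0"]) (simp_all add: \<phi>0)
    moreover from this have "esssup ?M (\<lambda>y. ereal \<bar>\<phi> y * w y\<bar>) \<le> ereal 0"
      by (intro esssup_I AE_I2) (auto simp: \<phi>0)
    ultimately show ?thesis unfolding Linfw_def by (auto intro: le_less_trans)
  qed
  ultimately have "pairing \<Omega> w \<rho> (\<lambda>y. \<phi> (\<Phi> t y)) = pairing \<Omega> w (T \<rho>) \<phi>"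
    using pre unfolding is_preadjoint_def composition_operator_def by simp
  also have "\<dots> = (LINT y|?M. 0)"
    unfolding pairing_def by (rule Bochner_Integration.integral_cong) (simp_all add: \<phi>0)
  finally have "pairing \<Omega> w \<rho> (\<lambda>y. \<phi> (\<Phi> t y)) = 0" by simp
  moreover have "pairing \<Omega> w \<rho> (\<lambda>y. \<phi> (\<Phi> t y)) = (LINT y|?M. indicator A y)"
    unfolding pairing_def
  proof (rule integral_cong_AE)
    have "(\<lambda>y. \<phi> (\<Phi> t y)) \<in> borel_measurable ?M \<longleftrightarrow> (indicator A :: _ \<Rightarrow> real) \<in> borel_measurable ?M"
      by (rule measurable_cong) (auto simp: \<phi>_def A_def indicator_def)
    then have "(\<lambda>y. \<phi> (\<Phi> t y)) \<in> borel_measurable ?M" by simp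
    then show "(\<lambda>y. \<rho> y * \<phi> (\<Phi> t y) * (w y)\<^sup>2) \<in> borel_measurable ?M"
      unfolding \<rho>_def by measurable
    show "AE y in ?M. \<rho> y * \<phi> (\<Phi> t y) * (w y)\<^sup>2 = indicator A y"
      using w_pos AE_space
    proof eventually_elim
      case (elim y)
      then have "(inverse (w y))\<^sup>2 * (w y)\<^sup>2 = 1" by (simp flip: power_mult_distrib)
      moreover have "\<phi> (\<Phi> t y) = indicator A y"
        using elim by (auto simp: \<phi>_def A_def indicator_def)
      ultimately show ?case unfolding \<rho>_def by (simp add: mult.commute mult.left_commute)
    qed
  qed measurable
  moreover have "A \<inter> \<Omega> = A" unfolding A_def by auto
  ultimately have "measure ?M A = 0" by simp
  then have "emeasure ?M A = 0"
    using finite_measure.emeasure_eq_measure[OF fin] by simp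
  then have "emeasure lebesgue A = 0"
    using \<Omega> by (subst (asm) emeasure_restrict_space) (auto simp: A_def)
  then have "negligible A"
    using A by (simp add: negligible_iff_null_sets null_sets_def)
  then have "A = {}" using open_not_negligible[OF A] by blast
  then show ?thesis using x unfolding A_def by blast
qed

text \<open>Both sides solve the same initial value problem, so the claim is uniqueness of solutions.\<close>

lemma flow_add_if_invariant:
  assumes flow: "is_flow f \<Omega> \<Phi>" and f: "L-lipschitz_on \<Omega> f"
    and inv: "\<And>t x. 0 \<le> t \<Longrightarrow> x \<in> \<Omega> \<Longrightarrow> \<Phi> t x \<in> \<Omega>"
    and s: "0 \<le> s" and t: "0 \<le> t" and x: "x \<in> \<Omega>"
  shows "\<Phi> (s + t) x = \<Phi> s (\<Phi> t x)"
proof -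
  have cl: "y \<in> closure \<Omega>" if "y \<in> \<Omega>" for y using that closure_subset by blast
  have 1: "((\<lambda>r. \<Phi> (r + t) x) has_vector_derivative f (\<Phi> (r + t) x)) (at r within {0..})" if "0 \<le> r" for r
  proof -
    have "((\<lambda>r. r + t) has_vector_derivative 1) (at r within {0..})"
      by (auto intro!: derivative_eq_intros)
    moreover have "((\<lambda>q. \<Phi> q x) has_vector_derivative f (\<Phi> (r + t) x)) (at (r + t) within (\<lambda>r. r + t) ` {0..})"
      by (rule has_vector_derivative_within_subset[OF is_flow_deriv[OF flow cl[OF x]]]) (use that t in auto)
    ultimately show ?thesis using vector_diff_chain_within by (fastforce simp: comp_def)
  qed
  have "norm (\<Phi> (s + t) x - \<Phi> s (\<Phi> t x)) \<le> exp (L * s) * norm (\<Phi> (0 + t) x - \<Phi> 0 (\<Phi> t x))"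
    by (rule solutions_distance_bounds(1)[OF s 1 is_flow_deriv[OF flow cl[OF inv[OF t x]]] _ f])
      (use inv t x in auto)
  then show ?thesis using is_flow_0[OF flow cl[OF inv[OF t x]]] by simp
qed

lemma flow_tendsto_initial:
  assumes "is_flow f \<Omega> \<Phi>" "x \<in> closure \<Omega>"
  shows "((\<lambda>t. \<Phi> t x) \<longlongrightarrow> x) (at_right 0)"
proof -
  have "((\<lambda>t. \<Phi> t x) \<longlongrightarrow> \<Phi> 0 x) (at 0 within {0..})"
    using is_flow_continuous_on_time[OF assms] unfolding continuous_on_def by simp
  then show ?thesis
    unfolding is_flow_0[OF assms] by (rule tendsto_within_subset) auto
qed

lemma expanding_flow_measurable_and_volume:
  fixes T :: "'a::euclidean_space \<Rightarrow> 'a"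
  assumes \<Omega>: "open \<Omega>" and cont: "continuous_on \<Omega> T" and in_\<Omega>: "\<And>x. x \<in> \<Omega> \<Longrightarrow> T x \<in> \<Omega>"
    and K: "0 < K" and exp: "\<And>x y. x \<in> \<Omega> \<Longrightarrow> y \<in> \<Omega> \<Longrightarrow> norm (x - y) \<le> K * norm (T x - T y)"
  shows "T \<in> measurable (lebesgue_on \<Omega>) (lebesgue_on \<Omega>)"
    and "A \<in> sets (lebesgue_on \<Omega>) \<Longrightarrow>
      emeasure (lebesgue_on \<Omega>) (T -` A \<inter> \<Omega>) \<le> ennreal (K ^ DIM('a)) * emeasure (lebesgue_on \<Omega>) A"
proof -
  have pre_eq: "T -` A \<inter> \<Omega> = {x \<in> \<Omega>. T x \<in> A}" for A by auto
  have sets: "A \<in> sets (lebesgue_on \<Omega>) \<longleftrightarrow> A \<in> sets lebesgue \<and> A \<subseteq> \<Omega>" for A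
    using \<Omega> by (auto simp: sets_restrict_space_iff)
  have meas: "T -` A \<inter> \<Omega> \<in> sets (lebesgue_on \<Omega>)" if "A \<in> sets (lebesgue_on \<Omega>)" for A
    using expanding_preimage_measurable[OF exp cont \<Omega>, of A] that unfolding sets pre_eq by auto
  show "T \<in> measurable (lebesgue_on \<Omega>) (lebesgue_on \<Omega>)"
    using in_\<Omega> meas by (intro measurableI) (auto simp: space_restrict_space)
  show "emeasure (lebesgue_on \<Omega>) (T -` A \<inter> \<Omega>) \<le> ennreal (K ^ DIM('a)) * emeasure (lebesgue_on \<Omega>) A"
    if A: "A \<in> sets (lebesgue_on \<Omega>)"
  proof -
    have "emeasure (lebesgue_on \<Omega>) (T -` A \<inter> \<Omega>) = emeasure lebesgue {x \<in> \<Omega>. T x \<in> A}"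
      using \<Omega> by (subst emeasure_restrict_space) (auto simp: pre_eq)
    also have "\<dots> \<le> ennreal (K ^ DIM('a)) * emeasure lebesgue A"
      by (rule expanding_preimage_emeasure_le[OF exp K]) (use A sets in auto)
    also have "emeasure lebesgue A = emeasure (lebesgue_on \<Omega>) A"
      using \<Omega> A sets by (subst emeasure_restrict_space) auto
    finally show ?thesis .
  qed
qed

section \<open>Exponential stability of the preadjoint semigroup\<close>

theorem theorem2p12:
  fixes \<Omega> :: "'a::euclidean_space set"
    and \<nu> :: "'a \<Rightarrow> 'a"
    and f :: "'a \<Rightarrow> 'a"
    and w :: "'a \<Rightarrow> real"
    and Dw_inv :: "'a \<Rightarrow> 'a"
    and \<Phi> :: "real \<Rightarrow> 'a \<Rightarrow> 'a"
    and S :: "real \<Rightarrow> ('a \<Rightarrow> real) \<Rightarrow> ('a \<Rightarrow> real)"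
    and \<omega>0 :: real
  assumes "open \<Omega>" and "bounded \<Omega>" and "connected \<Omega>" and "\<Omega> \<noteq> {}"
    and "C1_boundary \<Omega>"
    and "\<forall>x\<in>frontier \<Omega>. outer_unit_normal \<Omega> x (\<nu> x)"
    and "C1_map f"
    and "\<forall>x\<in>frontier \<Omega>. \<nu> x \<bullet> f x \<le> 0"
    and "is_flow f \<Omega> \<Phi>"
    and "w \<in> borel_measurable (lebesgue_on \<Omega>)"
    and "\<forall>x\<in>\<Omega>. 0 \<le> w x"
    and "AE x in lebesgue_on \<Omega>. 0 < w x"
    and "has_W1inf_gradient \<Omega> (\<lambda>x. inverse (w x)) Dw_inv"
    and "\<forall>b\<in>Basis. (\<lambda>x. f x \<bullet> b) \<in> Linfw \<Omega> w"
    and "\<forall>t\<ge>0. is_preadjoint \<Omega> w (S t) (composition_operator \<Phi> t)"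
    and "esssup (lebesgue_on \<Omega>)
           (\<lambda>x. ereal (- (f x \<bullet> weight_gradient w Dw_inv x) / w x)) = ereal \<omega>0"
    and "\<omega>0 < 0"
  shows "semigroup_L1w \<Omega> w S \<and>
         (\<forall>t\<ge>0. \<forall>\<phi>\<in>L1w \<Omega> w.
            norm_L1w \<Omega> w (S t \<phi>) \<le> exp (\<omega>0 * t) * norm_L1w \<Omega> w \<phi>)"
proof -
  let ?M = "lebesgue_on \<Omega>"
  note \<Omega> = \<open>open \<Omega>\<close> \<open>bounded \<Omega>\<close> and f = \<open>C1_map f\<close> and flow = \<open>is_flow f \<Omega> \<Phi>\<close>
    and w_pos = \<open>AE x in ?M. 0 < w x\<close>
  have fin: "finite_measure ?M"
    using \<Omega> by (intro finite_measure_lebesgue_on) (simp add: bounded_set_imp_lmeasurable)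
  have cl: "x \<in> closure \<Omega>" if "x \<in> \<Omega>" for x using that closure_subset by blast
  have cont: "continuous_on \<Omega> (\<Phi> t)" if "0 \<le> t" for t
    using flow_continuous_on[OF f flow that] closure_subset by (rule continuous_on_subset)
  have W: "(\<lambda>x. inverse (w x)) \<in> Linfw \<Omega> (\<lambda>_. 1)" "has_weak_gradient \<Omega> (\<lambda>x. inverse (w x)) Dw_inv"
    "\<And>b. b \<in> Basis \<Longrightarrow> (\<lambda>x. Dw_inv x \<bullet> b) \<in> Linfw \<Omega> (\<lambda>_. 1)"
    using \<open>has_W1inf_gradient \<Omega> (\<lambda>x. inverse (w x)) Dw_inv\<close> unfolding has_W1inf_gradient_def by auto
  obtain B where B: "0 \<le> B" "AE x in ?M. \<bar>inverse (w x)\<bar> \<le> B"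
    using unweighted_Linfw_AE_bounded[OF W(1)] by blast
  have w_inv: "AE x in ?M. inverse (w x) \<le> B" using B(2) by eventually_elim linarith
  have inv: "\<Phi> t x \<in> \<Omega>" if t: "0 \<le> t" and x: "x \<in> \<Omega>" for t x
  proof (rule flow_stays_in_domain[OF f flow \<Omega> \<open>C1_boundary \<Omega>\<close> _ t x])
    show "\<Phi> s y \<in> closure \<Omega>" if "0 \<le> s" "y \<in> \<Omega>" for s y
      using assms(15) that
      by (intro preadjoint_imp_flow_in_closure[OF \<Omega> cont \<open>w \<in> borel_measurable ?M\<close> w_pos w_inv, where t = s and T = "S s"]) auto
  qed
  obtain R where "\<Omega> \<subseteq> cball 0 R"
    using \<Omega>(2) by (metis bounded_iff mem_cball_0 subsetI)
  moreover obtain L where "L-lipschitz_on (cball 0 R) f"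
    by (rule C1_map_imp_lipschitz_on[OF f, of "cball 0 R"]) auto
  ultimately have lip: "L-lipschitz_on \<Omega> f" by (rule lipschitz_on_subset[rotated])
  have expand: "norm (x - y) \<le> exp (L * t) * norm (\<Phi> t x - \<Phi> t y)"
    if "0 \<le> t" "x \<in> \<Omega>" "y \<in> \<Omega>" for t x y
    using that inv cl by (intro flow_distance_bounds(2)[OF flow lip]) auto
  have volume: "\<Phi> t \<in> measurable ?M ?M"
    "A \<in> sets ?M \<Longrightarrow> emeasure ?M (\<Phi> t -` A \<inter> \<Omega>) \<le> ennreal (exp (L * DIM('a) * t)) * emeasure ?M A"
    if t: "0 \<le> t" for t A
  proof -
    have "exp (L * t) ^ DIM('a) = exp (L * DIM('a) * t)"
      by (simp add: exp_of_nat_mult[symmetric] mult_ac)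
    then show "\<Phi> t \<in> measurable ?M ?M"
      "A \<in> sets ?M \<Longrightarrow> emeasure ?M (\<Phi> t -` A \<inter> \<Omega>) \<le> ennreal (exp (L * DIM('a) * t)) * emeasure ?M A"
      using expanding_flow_measurable_and_volume[OF \<Omega>(1) cont[OF t] inv[OF t] _ expand[OF t]] by auto
  qed
  have "\<forall>b\<in>Basis. \<exists>c. 0 \<le> c \<and> (AE x in ?M. \<bar>Dw_inv x \<bullet> b\<bar> \<le> c)"
    using unweighted_Linfw_AE_bounded[OF W(3)] by blast
  from bchoice[OF this] obtain C where C: "\<forall>b\<in>Basis. 0 \<le> C b \<and> (AE x in ?M. \<bar>Dw_inv x \<bullet> b\<bar> \<le> C b)"
    by blast
  define D where "D = sum C Basis"
  have D: "0 \<le> D" unfolding D_def using C by (intro sum_nonneg) blast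
  have "AE x in ?M. \<forall>b\<in>Basis. \<bar>Dw_inv x \<bullet> b\<bar> \<le> C b"
    using C by (intro AE_finite_allI) auto
  then have grad_le: "AE x in ?M. norm (Dw_inv x) \<le> D"
    by eventually_elim (auto simp: D_def intro!: order_trans[OF norm_le_l1 sum_mono])
  have grad_meas: "Dw_inv \<in> borel_measurable ?M"
    by (rule borel_measurable_euclidean_space[THEN iffD2]) (use W(3) in \<open>simp add: Linfw_def\<close>)
  have grad_int: "integrable ?M Dw_inv"
    using grad_le grad_meas by (rule finite_measure.integrable_const_bound[OF fin])
  have "(\<lambda>x. inverse (w x)) \<in> borel_measurable ?M"
    using \<open>w \<in> borel_measurable ?M\<close> by measurable
  then have w_inv_int: "integrable ?M (\<lambda>x. inverse (w x))"
    using B(2) by (intro finite_measure.integrable_const_bound[OF fin, where B = B]) auto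
  \<comment> \<open>Substituting \<open>\<nabla>w = - w\<^sup>2 \<nabla>(1 / w)\<close> turns the bound on the essential supremum into a
    differential inequality for \<open>1 / w\<close> along the field.\<close>
  have growth: "AE x in ?M. f x \<bullet> Dw_inv x \<le> \<omega>0 * inverse (w x)"
    using esssup_AE[where M = ?M and f = "\<lambda>x. ereal (- (f x \<bullet> weight_gradient w Dw_inv x) / w x)"] w_pos
  proof eventually_elim
    case (elim x)
    then have "- (f x \<bullet> weight_gradient w Dw_inv x) / w x \<le> \<omega>0" using assms(16) by simp
    moreover have "- (f x \<bullet> weight_gradient w Dw_inv x) / w x = w x * (f x \<bullet> Dw_inv x)"
      using elim(2) unfolding weight_gradient_def by (simp add: power2_eq_square)
    ultimately show ?case using elim(2) by (simp add: field_simps)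
  qed
  interpret weighted_preadjoint \<Omega> w \<Phi> S B "L * DIM('a)" \<omega>0
  proof
    show "AE x in ?M. inverse (w (\<Phi> t x)) \<le> exp (\<omega>0 * t) * inverse (w x)" if "0 \<le> t" for t
      using \<open>\<omega>0 < 0\<close> that
      by (intro AE_le_along_flow[OF \<Omega>(1) lip flow inv W(2) w_inv_int grad_int D grad_le growth]) auto
    show "\<Phi> (s + t) x = \<Phi> s (\<Phi> t x)" if "0 \<le> s" "0 \<le> t" "x \<in> \<Omega>" for s t x
      using that by (intro flow_add_if_invariant[OF flow lip inv])
  qed (use \<Omega> w_inv w_pos inv volume assms(10,15,17) flow_tendsto_initial[OF flow cl] is_flow_0[OF flow cl] in auto)
  show ?thesis using semigroup_S norm_S_le by blast
qed

end
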